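(* Let $G=(C(G),u)$, $S_N\subseteq G\subseteq O_N^+$, be a compact matrix quantum group corresponding to a linear category of partitions $\mathscr K\subseteq\mathscr P_{N\text{-lin}}$. Let $\tau_{(N)}:=|-\frac2N\uparrow\uparrow^*\in\mathscr P_{N\text{-lin}}(1,1)$. Then $\tilde G:=(C(G),T_{\tau_{(N)}}uT_{\tau_{(N)}}^{-1})$ is a compact matrix quantum group satisfying $S_N\subseteq\tilde G\subseteq O_N^+$ and it corresponds to the category $$\mathcal T_{(N)}\mathscr K=\{\tau_{(N)}^{\otimes l}\,p\,\tau_{(N)}^{\otimes k}\mid p\in\mathscr K(k,l)\}_{k,l\in\mathbb N_0},$$ where $\mathcal T_{(N)}:\mathscr P_{N\text{-lin}}\to\mathscr P_{N\text{-lin}}$, mapping $p\mapsto\tau_{(N)}^{\otimes l}p\,\tau_{(N)}^{\otimes k}$ for $p\in\mathscr P_{N\text{-lin}}(k,l)$, provides a monoidal $*$-isomorphism $\mathscr K\to\mathcal T_{(N)}\mathscr K$. In particular, if $N\ge2$ and $S_N\subseteq G\subseteq B_N^{\#+}$, then $T_{\tau_{(N-1)}}G_+^{\rm irr}T_{\tau_{(N-1)}}^{-1}=G_-^{\rm irr}$, while $T_{\tau_{(N)}}GT_{\tau_{(N)}}^{-1}=G$.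
   Context: **Partitions.** For $k,l\in\mathbb N_0$ let $\mathscr P(k,l)$ be the set of partitions (into disjoint non-empty blocks) of a set of $k$ upper and $l$ lower points (two rows). $\mathscr P_{N\text{-lin}}(k,l)$ is the complex vector space with basis $\mathscr P(k,l)$, and $\mathscr P_{N\text{-lin}}=\bigcup_{k,l}\mathscr P_{N\text{-lin}}(k,l)$. Operations: tensor product $p\otimes q$ (horizontal juxtaposition, $q$ to the right); composition $qp\in\mathscr P_{N\text{-lin}}(k,m)$ for $p\in\mathscr P(k,l)$, $q\in\mathscr P(l,m)$ (place $q$ below $p$, identify the lower row of $p$ with the upper row of $q$, join blocks accordingly, and replace each connected component containing neither upper nor lower points of the result by a factor $N$); involution $p^*$ (reflection at the horizontal axis). Tensor product and composition are extended bilinearly, $*$ antilinearly. Notation: $\uparrow\in\mathscr P(0,1)$ is the singleton, $|\in\mathscr P(1,1)$ the identity partition (one block), $\sqcap\in\mathscr P(0,2)$ the pair partition (one block), $\uparrow\uparrow^*\in\mathscr P(1,1)$ the partition with two singleton blocks. A linear category of partitions is a collection $\mathscr K$ of subspaces $\mathscr K(k,l)\subseteq\mathscr P_{N\text{-lin}}(k,l)$ containing $|$ and $\sqcap$ and closed under tensor product, composition and involution; it is a monoidal $*$-category with objects $\mathbb N_0$. $\langle\,\cdot\,\rangle_{N\text{-lin}}$ denotes the smallest linear category containing the given elements. A monoidal $*$-isomorphism is a family of linear bijections between the morphism spaces for each $(k,l)$ preserving tensor product, composition and involution. **Linear maps.** For $p\in\mathscr P(k,l)$, $T_p:(\mathbb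 C^N)^{\otimes k}\to(\mathbb C^N)^{\otimes l}$, $T_p(e_{i_1}\otimes\cdots\otimes e_{i_k})=\sum_{j_1,\dots,j_l=1}^N\delta_p(\mathbf i,\mathbf j)\,e_{j_1}\otimes\cdots\otimes e_{j_l}$, where $\delta_p(\mathbf i,\mathbf j)=1$ if, labelling the upper points by $\mathbf i$ and lower points by $\mathbf j$, points in the same block have equal labels, and $0$ otherwise; extended linearly in $p$. So $T_{\tau_{(N)}}\in M_N(\mathbb C)$ has entries $\delta_{ij}-\frac2N$; likewise $T_{\tau_{(N-1)}}\in M_{N-1}(\mathbb C)$ has entries $\delta_{ij}-\frac2{N-1}$. **Quantum groups.** A compact matrix quantum group (CMQG) is $G=(C(G),u)$, with $C(G)$ a unital C*-algebra generated by the entries of $u\in M_N(C(G))$, $u$ and $u^t$ invertible, and $u_{ij}\mapsto\sum_k u_{ik}\otimes u_{kj}$ extending to a unital $*$-homomorphism $C(G)\to C(G)\otimes_{\min}C(G)$. One always uses the full (universal) C*-completion of the Hopf $*$-algebra generated by the $u_{ij}$. $H=(C(H),v)\subseteq G=(C(G),u)$ means $u,v$ have the same size and $u_{ij}\mapsto v_{ij}$ defines a surjective $*$-homomorphism $C(G)\to C(H)$; $G=H$ means this is a $*$-isomorphism. For invertible $T$, $TGT^{-1}:=(C(G),TuT^{-1})$. $S_N$ is the group of permutation matrices with $C(S_N)$ and its coordinate functions. $O_N^+$: $C(O_N^+)$ is universal with $u_{ij}=u_{ij}^*$, $uu^t=u^tu=1$. $\operatorname{Mor}(u^{\otimes k},u^{\otimes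 l})=\{T\mid Tu^{\otimes k}=u^{\otimes l}T\}$. A CMQG $G$ with $S_N\subseteq G\subseteq O_N^+$ *corresponds* to a linear category $\mathscr K\subseteq\mathscr P_{N\text{-lin}}$ if $\operatorname{Mor}(u^{\otimes k},u^{\otimes l})=\{T_p\mid p\in\mathscr K(k,l)\}$ for all $k,l$ (by Tannaka–Krein every such $G$ corresponds to some $\mathscr K$ and each $\mathscr K$ determines a unique $G$). $B_N^{\#+}$ is the quantum group corresponding to $\langle\uparrow\otimes\uparrow\rangle_{N\text{-lin}}$. **The quantum groups $G^{\rm irr}_\pm$.** Let $U_{(N,\pm)}\in M_N(\mathbb C)$ be the orthogonal matrices with $[U_{(N,\pm)}]_{ij}=\delta_{ij}-\frac1{N-1}\bigl(1\pm\frac1{\sqrt N}\bigr)$ and $[U_{(N,\pm)}]_{iN}=[U_{(N,\pm)}]_{Nj}=[U_{(N,\pm)}]_{NN}=\pm\frac1{\sqrt N}$ for $i,j\in\{1,\dots,N-1\}$, and let $V_{(N,\pm)}$ be the $(N-1)\times N$ matrix of the first $N-1$ rows of $U_{(N,\pm)}$. For $S_N\subseteq G=(C(G),u)\subseteq B_N^{\#+}$ put $G^{\rm irr}_\pm:=(A,v)$, $v=V_{(N,\pm)}uV_{(N,\pm)}^*\in M_{N-1}(C(G))$, $A\subseteq C(G)$ the C*-subalgebra generated by the entries of $v$. *)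

theory Defs
  imports
    Complex_Main
    "HOL-Library.Disjoint_Sets"
    "HOL-Library.Poly_Mapping"
    "HOL-Combinatorics.Permutations"
    "HOL-Algebra.Module"
    "Jordan_Normal_Form.Matrix"
    "Jordan_Normal_Form.Gauss_Jordan_Elimination"
    "Jordan_Normal_Form.Schur_Decomposition"
begin

section \<open>Partitions and linear categories of partitions\<close>

text \<open>
  All points are counted from 0. \<open>Inl i\<close> is the \<open>i\<close>-th upper and \<open>Inr j\<close> the \<open>j\<close>-th lower point.
  A partition is its set of blocks; it determines \<open>k\<close> and \<open>l\<close>, being a partition of
  \<open>points k l\<close>.
\<close>

type_synonym ptn = "(nat + nat) set set"

definition points :: "nat \<Rightarrow> nat \<Rightarrow> (nat + nat) set" where
  "points k l = Inl ` {..<k} \<union> Inr ` {..<l}"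

definition Part :: "nat \<Rightarrow> nat \<Rightarrow> ptn set" where
  "Part k l = {p. partition_on (points k l) p}"

definition up_ptn :: ptn where "up_ptn = {{Inr 0}}"
definition id_ptn :: ptn where "id_ptn = {{Inl 0, Inr 0}}"
definition pair_ptn :: ptn where "pair_ptn = {{Inr 0, Inr 1}}"
definition up_up_star_ptn :: ptn where "up_up_star_ptn = {{Inl 0}, {Inr 0}}"

text \<open>\<open>ptensor k l p q\<close> is \<open>p \<otimes> q\<close> for \<open>p \<in> Part k l\<close>.\<close>

definition ptensor :: "nat \<Rightarrow> nat \<Rightarrow> ptn \<Rightarrow> ptn \<Rightarrow> ptn" where
  "ptensor k l p q = p \<union> (\<lambda>B. map_sum ((+) k) ((+) l) ` B) ` q"

definition pstar :: "ptn \<Rightarrow> ptn" where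
  "pstar p = (\<lambda>B. case_sum Inr Inl ` B) ` p"

text \<open>
  For the composition \<open>qp\<close> the partition \<open>p\<close> is put on the top and middle row, \<open>q\<close> on the middle
  and bottom row. Two points are in the same component if they are linked by a chain of blocks
  of \<open>p\<close> and \<open>q\<close>.
\<close>

datatype row_point = Top nat | Mid nat | Bot nat

definition stack_blocks :: "ptn \<Rightarrow> ptn \<Rightarrow> row_point set set" where
  "stack_blocks q p = (\<lambda>B. case_sum Top Mid ` B) ` p \<union> (\<lambda>B. case_sum Mid Bot ` B) ` q"

definition stack_components :: "ptn \<Rightarrow> ptn \<Rightarrow> row_point set set" where
  "stack_components q p =
     \<Union>(stack_blocks q p) // {(x, y). \<exists>B\<in>stack_blocks q p. x \<in> B \<and> y \<in> B}\<^sup>+"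

definition outer_part :: "row_point set \<Rightarrow> (nat + nat) set" where
  "outer_part C = {Inl i | i. Top i \<in> C} \<union> {Inr j | j. Bot j \<in> C}"

definition pcomp :: "ptn \<Rightarrow> ptn \<Rightarrow> ptn" where
  "pcomp q p = outer_part ` stack_components q p - {{}}"

definition loops :: "ptn \<Rightarrow> ptn \<Rightarrow> nat" where
  "loops q p = card {C \<in> stack_components q p. outer_part C = {}}"

type_synonym lptn = "ptn \<Rightarrow>\<^sub>0 complex"

definition Plin :: "nat \<Rightarrow> nat \<Rightarrow> lptn set" where
  "Plin k l = {f. Poly_Mapping.keys f \<subseteq> Part k l}"

definition basis :: "ptn \<Rightarrow> lptn" where
  "basis p = Poly_Mapping.single p 1"

definition scale :: "complex \<Rightarrow> lptn \<Rightarrow> lptn" where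
  "scale c f = Poly_Mapping.map ((*) c) f"

definition ltensor :: "nat \<Rightarrow> nat \<Rightarrow> lptn \<Rightarrow> lptn \<Rightarrow> lptn" where
  "ltensor k l f g = (\<Sum>p\<in>Poly_Mapping.keys f. \<Sum>q\<in>Poly_Mapping.keys g.
     scale (Poly_Mapping.lookup f p * Poly_Mapping.lookup g q) (basis (ptensor k l p q)))"

text \<open>\<open>lcomp N g f\<close> is the composition \<open>gf\<close> (first \<open>f\<close>, then \<open>g\<close>).\<close>

definition lcomp :: "nat \<Rightarrow> lptn \<Rightarrow> lptn \<Rightarrow> lptn" where
  "lcomp N g f = (\<Sum>p\<in>Poly_Mapping.keys f. \<Sum>q\<in>Poly_Mapping.keys g.
     scale (Poly_Mapping.lookup f p * Poly_Mapping.lookup g q * of_nat N ^ loops q p)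
       (basis (pcomp q p)))"

definition lstar :: "lptn \<Rightarrow> lptn" where
  "lstar f = (\<Sum>p\<in>Poly_Mapping.keys f. scale (cnj (Poly_Mapping.lookup f p)) (basis (pstar p)))"

type_synonym lfamily = "nat \<Rightarrow> nat \<Rightarrow> lptn set"

definition linear_category :: "nat \<Rightarrow> lfamily \<Rightarrow> bool" where
  "linear_category N K \<longleftrightarrow>
     (\<forall>k l. K k l \<subseteq> Plin k l \<and> 0 \<in> K k l \<and>
        (\<forall>f\<in>K k l. \<forall>g\<in>K k l. f + g \<in> K k l) \<and> (\<forall>c. \<forall>f\<in>K k l. scale c f \<in> K k l)) \<and>
     basis id_ptn \<in> K 1 1 \<and> basis pair_ptn \<in> K 0 2 \<and>
     (\<forall>k l k' l'. \<forall>f\<in>K k l. \<forall>g\<in>K k' l'. ltensor k l f g \<in> K (k + k') (l + l')) \<and>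
     (\<forall>k l m. \<forall>f\<in>K k l. \<forall>g\<in>K l m. lcomp N g f \<in> K k m) \<and>
     (\<forall>k l. \<forall>f\<in>K k l. lstar f \<in> K l k)"

definition generated_category :: "nat \<Rightarrow> lfamily \<Rightarrow> lfamily" where
  "generated_category N X =
     (\<lambda>k l. \<Inter>{K k l | K. linear_category N K \<and> (\<forall>k' l'. X k' l' \<subseteq> K k' l')})"

definition up_tensor_up :: lptn where
  "up_tensor_up = ltensor 0 1 (basis up_ptn) (basis up_ptn)"

definition up_up_category :: "nat \<Rightarrow> lfamily" where
  "up_up_category N = generated_category N (\<lambda>k l. if (k, l) = (0, 2) then {up_tensor_up} else {})"

definition monoidal_star_iso ::
  "nat \<Rightarrow> (nat \<Rightarrow> nat \<Rightarrow> lptn \<Rightarrow> lptn) \<Rightarrow> lfamily \<Rightarrow> lfamily \<Rightarrow> bool" where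
  "monoidal_star_iso N F K L \<longleftrightarrow>
     (\<forall>k l. bij_betw (F k l) (K k l) (L k l) \<and>
        (\<forall>f\<in>K k l. \<forall>g\<in>K k l. F k l (f + g) = F k l f + F k l g) \<and>
        (\<forall>c. \<forall>f\<in>K k l. F k l (scale c f) = scale c (F k l f))) \<and>
     (\<forall>k l k' l'. \<forall>f\<in>K k l. \<forall>g\<in>K k' l'.
        F (k + k') (l + l') (ltensor k l f g) = ltensor k l (F k l f) (F k' l' g)) \<and>
     (\<forall>k l m. \<forall>f\<in>K k l. \<forall>g\<in>K l m. F k m (lcomp N g f) = lcomp N (F l m g) (F k l f)) \<and>
     (\<forall>k l. \<forall>f\<in>K k l. F l k (lstar f) = lstar (F k l f))"

definition tau :: "nat \<Rightarrow> lptn" where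
  "tau N = basis id_ptn - scale (2 / of_nat N) (basis up_up_star_ptn)"

text \<open>The zeroth tensor power is the empty partition in \<open>Part 0 0\<close>.\<close>

primrec tau_pow :: "nat \<Rightarrow> nat \<Rightarrow> lptn" where
  "tau_pow N 0 = basis {}"
| "tau_pow N (Suc k) = ltensor k k (tau_pow N k) (tau N)"

definition calT :: "nat \<Rightarrow> nat \<Rightarrow> nat \<Rightarrow> lptn \<Rightarrow> lptn" where
  "calT N k l f = lcomp N (tau_pow N l) (lcomp N f (tau_pow N k))"

definition calT_family :: "nat \<Rightarrow> lfamily \<Rightarrow> lfamily" where
  "calT_family N K = (\<lambda>k l. calT N k l ` K k l)"

section \<open>The linear maps associated with partitions\<close>

text \<open>
  A linear map from the \<open>k\<close>-th to the \<open>l\<close>-th tensor power of the \<open>N\<close>-dimensional space is given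
  by its matrix in the standard bases, which are indexed by lists. As for matrices, the first
  index is the one of the target: \<open>T e\<^sub>i = (\<Sum>j. T j i e\<^sub>j)\<close>. Entries outside the index range are 0.
\<close>

type_synonym tmap = "nat list \<Rightarrow> nat list \<Rightarrow> complex"

definition multi_idx :: "nat \<Rightarrow> nat \<Rightarrow> nat list set" where
  "multi_idx N k = {xs. set xs \<subseteq> {..<N} \<and> length xs = k}"

definition tmaps :: "nat \<Rightarrow> nat \<Rightarrow> nat \<Rightarrow> tmap set" where
  "tmaps N k l = {T. \<forall>j i. T j i \<noteq> 0 \<longrightarrow> j \<in> multi_idx N l \<and> i \<in> multi_idx N k}"

definition delta :: "ptn \<Rightarrow> nat list \<Rightarrow> nat list \<Rightarrow> complex" where
  "delta p i j =
     (if \<forall>B\<in>p. \<forall>x\<in>B. \<forall>y\<in>B. case_sum (nth i) (nth j) x = case_sum (nth i) (nth j) y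
      then 1 else 0)"

definition Tmap :: "nat \<Rightarrow> nat \<Rightarrow> nat \<Rightarrow> lptn \<Rightarrow> tmap" where
  "Tmap N k l f = (\<lambda>j i. if j \<in> multi_idx N l \<and> i \<in> multi_idx N k
     then (\<Sum>p\<in>Poly_Mapping.keys f. Poly_Mapping.lookup f p * delta p i j) else 0)"

definition Tmat :: "nat \<Rightarrow> lptn \<Rightarrow> complex mat" where
  "Tmat N f = mat N N (\<lambda>(j, i). Tmap N 1 1 f [j] [i])"

section \<open>Unital C*-algebras\<close>

record 'a cstar = "(complex, 'a) module" +
  adj :: "'a \<Rightarrow> 'a"
  nrm :: "'a \<Rightarrow> real"

definition complex_ring :: "complex ring" where
  "complex_ring = \<lparr>carrier = UNIV, monoid.mult = (*), one = 1, zero = 0, add = (+)\<rparr>"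

locale cstar_algebra = ring A for A :: "'a cstar" (structure) +
  assumes complex_module: "Module.module complex_ring A"
    and smult_mult_left: "\<lbrakk>x \<in> carrier A; y \<in> carrier A\<rbrakk> \<Longrightarrow> (c \<odot> x) \<otimes> y = c \<odot> (x \<otimes> y)"
    and smult_mult_right: "\<lbrakk>x \<in> carrier A; y \<in> carrier A\<rbrakk> \<Longrightarrow> x \<otimes> (c \<odot> y) = c \<odot> (x \<otimes> y)"
    and adj_closed: "x \<in> carrier A \<Longrightarrow> adj A x \<in> carrier A"
    and adj_adj: "x \<in> carrier A \<Longrightarrow> adj A (adj A x) = x"
    and adj_add: "\<lbrakk>x \<in> carrier A; y \<in> carrier A\<rbrakk> \<Longrightarrow> adj A (x \<oplus> y) = adj A x \<oplus> adj A y"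
    and adj_smult: "x \<in> carrier A \<Longrightarrow> adj A (c \<odot> x) = cnj c \<odot> adj A x"
    and adj_mult: "\<lbrakk>x \<in> carrier A; y \<in> carrier A\<rbrakk> \<Longrightarrow> adj A (x \<otimes> y) = adj A y \<otimes> adj A x"
    and nrm_nonneg: "x \<in> carrier A \<Longrightarrow> 0 \<le> nrm A x"
    and nrm_eq_0: "x \<in> carrier A \<Longrightarrow> nrm A x = 0 \<longleftrightarrow> x = \<zero>"
    and nrm_add: "\<lbrakk>x \<in> carrier A; y \<in> carrier A\<rbrakk> \<Longrightarrow> nrm A (x \<oplus> y) \<le> nrm A x + nrm A y"
    and nrm_smult: "x \<in> carrier A \<Longrightarrow> nrm A (c \<odot> x) = cmod c * nrm A x"
    and nrm_mult: "\<lbrakk>x \<in> carrier A; y \<in> carrier A\<rbrakk> \<Longrightarrow> nrm A (x \<otimes> y) \<le> nrm A x * nrm A y"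
    and nrm_cstar: "x \<in> carrier A \<Longrightarrow> nrm A (adj A x \<otimes> x) = (nrm A x)\<^sup>2"
    and nrm_complete:
      "\<lbrakk>\<And>n::nat. s n \<in> carrier A; \<And>e::real. e > 0 \<Longrightarrow> \<exists>M. \<forall>m\<ge>M. \<forall>n\<ge>M. nrm A (s m \<ominus> s n) < e\<rbrakk>
         \<Longrightarrow> \<exists>x\<in>carrier A. (\<lambda>n. nrm A (s n \<ominus> x)) \<longlonglongrightarrow> 0"

definition star_subalgebra :: "'a cstar \<Rightarrow> 'a set \<Rightarrow> bool" where
  "star_subalgebra A S \<longleftrightarrow>
     S \<subseteq> carrier A \<and> \<one>\<^bsub>A\<^esub> \<in> S \<and>
     (\<forall>x\<in>S. \<forall>y\<in>S. x \<oplus>\<^bsub>A\<^esub> y \<in> S \<and> x \<otimes>\<^bsub>A\<^esub> y \<in> S) \<and>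
     (\<forall>c. \<forall>x\<in>S. c \<odot>\<^bsub>A\<^esub> x \<in> S) \<and> (\<forall>x\<in>S. adj A x \<in> S)"

definition cstar_subalgebra :: "'a cstar \<Rightarrow> 'a set \<Rightarrow> bool" where
  "cstar_subalgebra A S \<longleftrightarrow> star_subalgebra A S \<and>
     (\<forall>s x. (\<forall>n::nat. s n \<in> S) \<and> x \<in> carrier A \<and> (\<lambda>n. nrm A (s n \<ominus>\<^bsub>A\<^esub> x)) \<longlonglongrightarrow> 0 \<longrightarrow> x \<in> S)"

definition star_generated :: "'a cstar \<Rightarrow> 'a set \<Rightarrow> 'a set" where
  "star_generated A X = \<Inter>{S. star_subalgebra A S \<and> X \<subseteq> S}"

definition cstar_generated :: "'a cstar \<Rightarrow> 'a set \<Rightarrow> 'a set" where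
  "cstar_generated A X = \<Inter>{S. cstar_subalgebra A S \<and> X \<subseteq> S}"

definition cstar_seminorm_on :: "'a cstar \<Rightarrow> 'a set \<Rightarrow> ('a \<Rightarrow> real) \<Rightarrow> bool" where
  "cstar_seminorm_on A S q \<longleftrightarrow>
     (\<forall>x\<in>S. 0 \<le> q x \<and> q (adj A x \<otimes>\<^bsub>A\<^esub> x) = (q x)\<^sup>2 \<and> (\<forall>c. q (c \<odot>\<^bsub>A\<^esub> x) = cmod c * q x)) \<and>
     (\<forall>x\<in>S. \<forall>y\<in>S. q (x \<oplus>\<^bsub>A\<^esub> y) \<le> q x + q y \<and> q (x \<otimes>\<^bsub>A\<^esub> y) \<le> q x * q y)"

definition unital_star_hom :: "'a cstar \<Rightarrow> 'b cstar \<Rightarrow> ('a \<Rightarrow> 'b) \<Rightarrow> bool" where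
  "unital_star_hom A B \<phi> \<longleftrightarrow>
     \<phi> \<in> Ring.ring_hom A B \<and>
     (\<forall>c. \<forall>x\<in>carrier A. \<phi> (c \<odot>\<^bsub>A\<^esub> x) = c \<odot>\<^bsub>B\<^esub> \<phi> x) \<and>
     (\<forall>x\<in>carrier A. \<phi> (adj A x) = adj B (\<phi> x))"

text \<open>
  \<open>C\<close> together with \<open>t\<close> is the minimal tensor product of \<open>A\<close> with itself: \<open>t\<close> identifies the
  algebraic tensor product with a dense *-subalgebra of \<open>C\<close> (the condition with linearly
  independent \<open>x\<close> says that the induced linear map is injective), and the norm of \<open>C\<close> is
  the smallest C*-norm on it.
\<close>

definition min_tensor_square :: "'a cstar \<Rightarrow> 'c cstar \<Rightarrow> ('a \<Rightarrow> 'a \<Rightarrow> 'c) \<Rightarrow> bool" where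
  "min_tensor_square A C t \<longleftrightarrow>
     cstar_algebra C \<and>
     (\<forall>x\<in>carrier A. \<forall>y\<in>carrier A. t x y \<in> carrier C \<and> adj C (t x y) = t (adj A x) (adj A y) \<and>
        (\<forall>c. t (c \<odot>\<^bsub>A\<^esub> x) y = c \<odot>\<^bsub>C\<^esub> t x y \<and> t x (c \<odot>\<^bsub>A\<^esub> y) = c \<odot>\<^bsub>C\<^esub> t x y)) \<and>
     (\<forall>x\<in>carrier A. \<forall>x'\<in>carrier A. \<forall>y\<in>carrier A.
        t (x \<oplus>\<^bsub>A\<^esub> x') y = t x y \<oplus>\<^bsub>C\<^esub> t x' y \<and> t y (x \<oplus>\<^bsub>A\<^esub> x') = t y x \<oplus>\<^bsub>C\<^esub> t y x') \<and>
     (\<forall>x\<in>carrier A. \<forall>x'\<in>carrier A. \<forall>y\<in>carrier A. \<forall>y'\<in>carrier A.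
        t x y \<otimes>\<^bsub>C\<^esub> t x' y' = t (x \<otimes>\<^bsub>A\<^esub> x') (y \<otimes>\<^bsub>A\<^esub> y')) \<and>
     t \<one>\<^bsub>A\<^esub> \<one>\<^bsub>A\<^esub> = \<one>\<^bsub>C\<^esub> \<and>
     (\<forall>(n::nat) x y. x \<in> {..<n} \<rightarrow> carrier A \<and> y \<in> {..<n} \<rightarrow> carrier A \<and>
        (\<forall>c. (\<Oplus>\<^bsub>A\<^esub>i\<in>{..<n}. c i \<odot>\<^bsub>A\<^esub> x i) = \<zero>\<^bsub>A\<^esub> \<longrightarrow> (\<forall>i<n. c i = 0)) \<and>
        (\<Oplus>\<^bsub>C\<^esub>i\<in>{..<n}. t (x i) (y i)) = \<zero>\<^bsub>C\<^esub> \<longrightarrow> (\<forall>i<n. y i = \<zero>\<^bsub>A\<^esub>)) \<and>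
     (let R = {t x y | x y. x \<in> carrier A \<and> y \<in> carrier A} in
        cstar_generated C R = carrier C \<and>
        (\<forall>q. cstar_seminorm_on C (star_generated C R) q \<and>
             (\<forall>z\<in>star_generated C R. q z = 0 \<longrightarrow> z = \<zero>\<^bsub>C\<^esub>) \<longrightarrow>
             (\<forall>z\<in>star_generated C R. nrm C z \<le> q z)))"

section \<open>Matrices over C*-algebras\<close>

definition alg_mats :: "'a cstar \<Rightarrow> nat \<Rightarrow> 'a mat set" where
  "alg_mats A n = {u \<in> carrier_mat n n. \<forall>i<n. \<forall>j<n. u $$ (i, j) \<in> carrier A}"

definition alg_mat_mult :: "'a cstar \<Rightarrow> 'a mat \<Rightarrow> 'a mat \<Rightarrow> 'a mat" where
  "alg_mat_mult A u w = mat (dim_row u) (dim_col w)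
     (\<lambda>(i, j). \<Oplus>\<^bsub>A\<^esub>k\<in>{..<dim_col u}. u $$ (i, k) \<otimes>\<^bsub>A\<^esub> w $$ (k, j))"

definition alg_one_mat :: "'a cstar \<Rightarrow> nat \<Rightarrow> 'a mat" where
  "alg_one_mat A n = mat n n (\<lambda>(i, j). if i = j then \<one>\<^bsub>A\<^esub> else \<zero>\<^bsub>A\<^esub>)"

definition alg_invertible :: "'a cstar \<Rightarrow> nat \<Rightarrow> 'a mat \<Rightarrow> bool" where
  "alg_invertible A n u \<longleftrightarrow> (\<exists>w\<in>alg_mats A n.
     alg_mat_mult A u w = alg_one_mat A n \<and> alg_mat_mult A w u = alg_one_mat A n)"

text \<open>\<open>sandwich A M u M'\<close> is the product \<open>M u M'\<close> for scalar matrices \<open>M\<close> and \<open>M'\<close>.\<close>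

definition sandwich :: "'a cstar \<Rightarrow> complex mat \<Rightarrow> 'a mat \<Rightarrow> complex mat \<Rightarrow> 'a mat" where
  "sandwich A M u M' = mat (dim_row M) (dim_col M') (\<lambda>(i, j).
     \<Oplus>\<^bsub>A\<^esub>a\<in>{..<dim_row u}. \<Oplus>\<^bsub>A\<^esub>b\<in>{..<dim_col u}. (M $$ (i, a) * M' $$ (b, j)) \<odot>\<^bsub>A\<^esub> u $$ (a, b))"

section \<open>Compact matrix quantum groups\<close>

record 'a qgrp =
  fun_alg :: "'a cstar"
  fund :: "'a mat"

text \<open>
  The last condition expresses that \<open>fun_alg G\<close> is the universal C*-completion of the
  *-algebra generated by the entries of the fundamental representation: its norm is the largest
  C*-seminorm there.

  The carrier of \<open>C\<close> may be taken inside the type \<open>'a\<close>: the finitely generated algebra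
  \<open>fun_alg G\<close> is separable, so the minimal tensor product has at most the cardinality of the
  continuum, which is also the least cardinality of a nonzero complex algebra.
\<close>

definition cmqg :: "nat \<Rightarrow> 'a qgrp \<Rightarrow> bool" where
  "cmqg N G \<longleftrightarrow> (let A = fun_alg G; u = fund G in
     cstar_algebra A \<and> u \<in> alg_mats A N \<and>
     cstar_generated A (elements_mat u) = carrier A \<and>
     alg_invertible A N u \<and> alg_invertible A N (transpose_mat u) \<and>
     (\<exists>(C :: 'a cstar) t \<Delta>. min_tensor_square A C t \<and> unital_star_hom A C \<Delta> \<and>
        (\<forall>i<N. \<forall>j<N. \<Delta> (u $$ (i, j)) = (\<Oplus>\<^bsub>C\<^esub>k\<in>{..<N}. t (u $$ (i, k)) (u $$ (k, j))))) \<and>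
     (\<forall>q. cstar_seminorm_on A (star_generated A (elements_mat u)) q \<longrightarrow>
        (\<forall>x\<in>star_generated A (elements_mat u). q x \<le> nrm A x)))"

definition qsubgroup :: "'b qgrp \<Rightarrow> 'a qgrp \<Rightarrow> bool" where
  "qsubgroup H G \<longleftrightarrow>
     dim_row (fund H) = dim_row (fund G) \<and> dim_col (fund H) = dim_col (fund G) \<and>
     (\<exists>\<phi>. unital_star_hom (fun_alg G) (fun_alg H) \<phi> \<and>
        \<phi> ` carrier (fun_alg G) = carrier (fun_alg H) \<and>
        (\<forall>i<dim_row (fund G). \<forall>j<dim_col (fund G). \<phi> (fund G $$ (i, j)) = fund H $$ (i, j)))"

definition qequal :: "'b qgrp \<Rightarrow> 'a qgrp \<Rightarrow> bool" where
  "qequal H G \<longleftrightarrow>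
     dim_row (fund H) = dim_row (fund G) \<and> dim_col (fund H) = dim_col (fund G) \<and>
     (\<exists>\<phi>. unital_star_hom (fun_alg G) (fun_alg H) \<phi> \<and>
        bij_betw \<phi> (carrier (fun_alg G)) (carrier (fun_alg H)) \<and>
        (\<forall>i<dim_row (fund G). \<forall>j<dim_col (fund G). \<phi> (fund G $$ (i, j)) = fund H $$ (i, j)))"

definition conj_qgrp :: "complex mat \<Rightarrow> 'a qgrp \<Rightarrow> 'a qgrp" where
  "conj_qgrp T G = G\<lparr>fund := sandwich (fun_alg G) T (fund G) (the (mat_inverse T))\<rparr>"

text \<open>Functions on the permutation matrices are extended by 0 to all matrices.\<close>

definition perm_mats :: "nat \<Rightarrow> complex mat set" where
  "perm_mats N = {mat N N (\<lambda>(i, j). if i = \<pi> j then 1 else 0) | \<pi>. \<pi> permutes {..<N}}"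

definition sym_qgrp :: "nat \<Rightarrow> (complex mat \<Rightarrow> complex) qgrp" where
  "sym_qgrp N = \<lparr>
     fun_alg = \<lparr>
       carrier = {f. \<forall>g. g \<notin> perm_mats N \<longrightarrow> f g = 0},
       monoid.mult = (\<lambda>f h g. f g * h g),
       one = (\<lambda>g. if g \<in> perm_mats N then 1 else 0),
       zero = (\<lambda>g. 0),
       add = (\<lambda>f h g. f g + h g),
       module.smult = (\<lambda>c f g. c * f g),
       adj = (\<lambda>f g. cnj (f g)),
       nrm = (\<lambda>f. Max ((\<lambda>g. cmod (f g)) ` perm_mats N))\<rparr>,
     fund = mat N N (\<lambda>(i, j) g. if g \<in> perm_mats N then g $$ (i, j) else 0)\<rparr>"

definition orthogonal_relations :: "'a cstar \<Rightarrow> nat \<Rightarrow> 'a mat \<Rightarrow> bool" where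
  "orthogonal_relations A N u \<longleftrightarrow>
     (\<forall>i<N. \<forall>j<N. adj A (u $$ (i, j)) = u $$ (i, j)) \<and>
     alg_mat_mult A u (transpose_mat u) = alg_one_mat A N \<and>
     alg_mat_mult A (transpose_mat u) u = alg_one_mat A N"

text \<open>
  The universal property is tested against all C*-algebras carried by subsets of the type \<open>'a\<close>.
  This is the full universal property: only C*-algebras generated by \<open>N\<^sup>2\<close> elements matter, they
  have at most the cardinality of the continuum, and \<open>'a\<close> has at least this cardinality as soon
  as the algebra of \<open>Q\<close> is nonzero.
\<close>

definition free_orthogonal :: "nat \<Rightarrow> 'a qgrp \<Rightarrow> bool" where
  "free_orthogonal N Q \<longleftrightarrow> (let A = fun_alg Q; u = fund Q in
     cstar_algebra A \<and> u \<in> alg_mats A N \<and>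
     cstar_generated A (elements_mat u) = carrier A \<and> orthogonal_relations A N u \<and>
     (\<forall>(D :: 'a cstar) w. cstar_algebra D \<and> w \<in> alg_mats D N \<and> orthogonal_relations D N w \<longrightarrow>
        (\<exists>\<phi>. unital_star_hom A D \<phi> \<and> (\<forall>i<N. \<forall>j<N. \<phi> (u $$ (i, j)) = w $$ (i, j)))))"

text \<open>Entries of the tensor powers of \<open>u\<close>.\<close>

definition rep_pow :: "'a cstar \<Rightarrow> 'a mat \<Rightarrow> nat list \<Rightarrow> nat list \<Rightarrow> 'a" where
  "rep_pow A u i j = foldr (\<lambda>(a, b) x. u $$ (a, b) \<otimes>\<^bsub>A\<^esub> x) (zip i j) \<one>\<^bsub>A\<^esub>"

definition Mor :: "nat \<Rightarrow> 'a qgrp \<Rightarrow> nat \<Rightarrow> nat \<Rightarrow> tmap set" where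
  "Mor N G k l = (let A = fun_alg G; u = fund G in
     {T \<in> tmaps N k l. \<forall>j\<in>multi_idx N l. \<forall>i\<in>multi_idx N k.
        (\<Oplus>\<^bsub>A\<^esub>m\<in>multi_idx N k. T j m \<odot>\<^bsub>A\<^esub> rep_pow A u m i) =
        (\<Oplus>\<^bsub>A\<^esub>m\<in>multi_idx N l. T m i \<odot>\<^bsub>A\<^esub> rep_pow A u j m)})"

definition corresponds :: "nat \<Rightarrow> 'a qgrp \<Rightarrow> lfamily \<Rightarrow> bool" where
  "corresponds N G K \<longleftrightarrow> linear_category N K \<and> (\<forall>k l. Mor N G k l = Tmap N k l ` K k l)"

text \<open>Here \<open>Q\<close> stands for the free orthogonal quantum group.\<close>

definition bistochastic_sharp :: "nat \<Rightarrow> 'c qgrp \<Rightarrow> 'a qgrp \<Rightarrow> bool" where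
  "bistochastic_sharp N Q B \<longleftrightarrow>
     cmqg N B \<and> qsubgroup (sym_qgrp N) B \<and> qsubgroup B Q \<and> corresponds N B (up_up_category N)"

section \<open>The quantum groups acting on the orthogonal complement\<close>

text \<open>The sign is the real number \<open>s = 1\<close> or \<open>s = -1\<close>; the last index is \<open>N - 1\<close>.\<close>

definition Umat :: "nat \<Rightarrow> real \<Rightarrow> complex mat" where
  "Umat N s = mat N N (\<lambda>(i, j). complex_of_real (
     if i < N - 1 \<and> j < N - 1
     then (if i = j then 1 else 0) - 1 / (real N - 1) * (1 + s / sqrt (real N))
     else s / sqrt (real N)))"

definition Vmat :: "nat \<Rightarrow> real \<Rightarrow> complex mat" where
  "Vmat N s = mat (N - 1) N (\<lambda>(i, j). Umat N s $$ (i, j))"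

definition irr :: "nat \<Rightarrow> real \<Rightarrow> 'a qgrp \<Rightarrow> 'a qgrp" where
  "irr N s G = (let A = fun_alg G; v = sandwich A (Vmat N s) (fund G) (mat_adjoint (Vmat N s)) in
     \<lparr>fun_alg = A\<lparr>carrier := cstar_generated A (elements_mat v)\<rparr>, fund = v\<rparr>)"

end

theory Submission
  imports Defs
begin

text \<open>
  The matrix of \<open>tau N\<close> is \<open>T = 1 - 2/N J\<close> with the all-ones matrix \<open>J\<close>, a reflection: it is real,
  symmetric, commutes with permutation matrices and satisfies \<open>T T = 1\<close>. So \<open>u \<mapsto> T u T\<close> and
  \<open>p \<mapsto> tau\<^sup>\<otimes>\<^sup>l p tau\<^sup>\<otimes>\<^sup>k\<close> are conjugations by an involution, and the first half of the theorem says that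
  such conjugations preserve all structure in sight.

  On the side of categories this requires the laws of composition, tensor product and involution of
  partitions, with the loop factors. They are deduced from the matrices of partitions. Counting
  labelings gives \<open>T\<^sub>q T\<^sub>p = n\<^sup>l T\<^sub>q\<^sub>p\<close> with the number \<open>l\<close> of loops (\<open>delta_pcomp\<close>), in every dimension \<open>n\<close>, and a
  partition is determined by its matrices in all dimensions (\<open>delta_unique\<close>). So an identity of
  matrices for all \<open>n\<close> yields both the identity of partitions and that of the loop numbers, which then
  holds for the parameter \<open>N\<close> of the theorem. Together with \<open>tau tau = 1\<close> and \<open>(tau \<otimes> tau) \<sqinter> = \<sqinter>\<close> this
  shows that \<open>calT\<close> maps linear categories isomorphically to linear categories
  (\<open>linear_category_calT\<close>, \<open>monoidal_star_iso_calT\<close>).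

  On the side of quantum groups, \<open>T u T\<close> generates the same algebra as \<open>u\<close> and the same comultiplication
  works (\<open>cmqg_reflect\<close>). The symmetric group remains a subgroup as its matrices commute with \<open>T\<close>
  (\<open>sym_qsubgroup_reflect\<close>). For the inclusion in the free orthogonal quantum group, the universal
  property provides an endomorphism of its algebra that sends \<open>u\<close> to \<open>T u T\<close>. Applied twice it is the
  identity on generators, hence everywhere, because *-homomorphisms are contractive
  (\<open>star_hom_contractive\<close>); so it is onto and can be followed by the given quotient map
  (\<open>qsubgroup_free_orthogonal_reflect\<close>). Contractivity is obtained by writing a self-adjoint element of
  norm less than 1 as the average of \<open>v\<close> and \<open>v\<^sup>*\<close> with \<open>v\<^sup>* v = 1\<close>. Finally, the tensor powers of
  \<open>T u T\<close> are conjugates of those of \<open>u\<close>, and so are the intertwiners (\<open>corresponds_reflect\<close>).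

  In the second half, the intertwiner of \<open>\<up> \<otimes> \<up>\<close> says that the product of any two row sums of \<open>u\<close> is 1.
  Then all row sums and column sums are one element \<open>s\<close> with \<open>s s = 1\<close>, and expanding \<open>T u T\<close> gives \<open>u\<close>
  itself (\<open>reflect_bistochastic\<close>). On the orthogonal complement, the reflection in dimension
  \<open>N - 1\<close> maps \<open>V\<^sub>+\<close> to \<open>V\<^sub>-\<close> (\<open>irr_reflect\<close>). So both equalities of quantum groups hold with equal
  fundamental matrices.
\<close>

section \<open>Labelings of partitions\<close>

lemma finite_multi_idx [simp]: "finite (multi_idx n k)"
  unfolding multi_idx_def by (rule finite_lists_length_eq) simp

lemma points_eq_iff [simp]:
  "Inl i \<in> points k l \<longleftrightarrow> i < k" "Inr j \<in> points k l \<longleftrightarrow> j < l"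
  by (auto simp: points_def)

lemma finite_points [simp]: "finite (points k l)"
  by (simp add: points_def)

lemma Part_D:
  assumes "p \<in> Part k l"
  shows "\<Union>p = points k l" "\<And>B C. B \<in> p \<Longrightarrow> C \<in> p \<Longrightarrow> B \<noteq> C \<Longrightarrow> B \<inter> C = {}" "{} \<notin> p" "finite p"
proof -
  have P: "partition_on (points k l) p" using assms by (simp add: Part_def)
  show "\<Union>p = points k l" using P by (auto simp: partition_on_def)
  show "B \<inter> C = {}" if "B \<in> p" "C \<in> p" "B \<noteq> C" for B C
    using P that by (auto simp: partition_on_def disjoint_def)
  show "{} \<notin> p" using P by (auto simp: partition_on_def)
  show "finite p" using P finite_elements[OF finite_points] by blast
qed

text \<open>
  The condition in \<open>delta\<close> for labelings of arbitrary points: a stack of two partitions has three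
  rows of points.
\<close>

definition monochrome :: "'x set set \<Rightarrow> ('x \<Rightarrow> nat) \<Rightarrow> bool" where
  "monochrome \<C> z \<longleftrightarrow> (\<forall>C\<in>\<C>. \<forall>x\<in>C. \<forall>y\<in>C. z x = z y)"

lemma monochromeD: "monochrome \<C> z \<Longrightarrow> C \<in> \<C> \<Longrightarrow> x \<in> C \<Longrightarrow> y \<in> C \<Longrightarrow> z x = z y"
  unfolding monochrome_def by blast

lemma delta_monochrome: "delta p i j = (if monochrome p (case_sum (nth i) (nth j)) then 1 else 0)"
  by (simp add: delta_def monochrome_def)

definition block_of :: "'x set set \<Rightarrow> 'x \<Rightarrow> 'x set" where
  "block_of \<C> x = (THE C. C \<in> \<C> \<and> x \<in> C)"

lemma block_of:
  assumes "partition_on X \<C>" "x \<in> X"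
  shows "block_of \<C> x \<in> \<C>" "x \<in> block_of \<C> x" "\<And>C. C \<in> \<C> \<Longrightarrow> x \<in> C \<Longrightarrow> block_of \<C> x = C"
proof -
  from assms obtain C where C: "C \<in> \<C>" "x \<in> C" by (auto simp: partition_on_def)
  have unique: "D = C" if "D \<in> \<C>" "x \<in> D" for D
    using partition_onD2[OF assms(1)] C that unfolding disjoint_def by blast
  have "block_of \<C> x = C" unfolding block_of_def by (rule the_equality) (use C unique in blast)+
  with C show "block_of \<C> x \<in> \<C>" "x \<in> block_of \<C> x" by simp_all
  show "block_of \<C> x = D" if "D \<in> \<C>" "x \<in> D" for D
    using unique[OF that] \<open>block_of \<C> x = C\<close> by simp
qed

lemma monochrome_iff_factors:
  assumes "partition_on X \<C>"
  shows "monochrome \<C> z \<longleftrightarrow> (\<exists>g. \<forall>x\<in>X. z x = g (block_of \<C> x))"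
proof
  assume m: "monochrome \<C> z"
  have "z x = z (SOME y. y \<in> block_of \<C> x)" if "x \<in> X" for x
    by (rule monochromeD[OF m block_of(1)[OF assms that] block_of(2)[OF assms that]
      someI[of "\<lambda>y. y \<in> block_of \<C> x", OF block_of(2)[OF assms that]]])
  then show "\<exists>g. \<forall>x\<in>X. z x = g (block_of \<C> x)" by (intro exI[of _ "\<lambda>C. z (SOME y. y \<in> C)"]) simp
next
  assume "\<exists>g. \<forall>x\<in>X. z x = g (block_of \<C> x)"
  then obtain g where g: "\<And>x. x \<in> X \<Longrightarrow> z x = g (block_of \<C> x)" by blast
  have "X = \<Union>\<C>" using assms by (simp add: partition_on_def)
  then have "z x = g C" if "C \<in> \<C>" "x \<in> C" for C x
    using g[of x] block_of(3)[OF assms, of x C] that by auto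
  then show "monochrome \<C> z" by (auto simp: monochrome_def)
qed

text \<open>
  The counting argument behind the composition of partitions. The labels \<open>w\<close> of the outer points
  are given. They force the label of each block that meets the outer points, provided that they agree
  on it; a block consisting of middle points only may carry any of the \<open>n\<close> labels. So the admissible
  labelings of the middle row correspond to choice functions on the set of blocks.
\<close>

lemma card_monochrome_extensions:
  fixes X :: "'x set" and mid :: "nat \<Rightarrow> 'x"
  assumes X: "partition_on X \<C>" "finite X"
    and split: "X = Out \<union> mid ` {..<l}" "Out \<inter> mid ` {..<l} = {}" "inj_on mid {..<l}"
    and w: "\<And>x. x \<in> Out \<Longrightarrow> w x < n"
    and z: "\<And>a x. x \<in> Out \<Longrightarrow> z a x = w x" "\<And>a b. b < l \<Longrightarrow> z a (mid b) = a ! b"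
  shows "card {a \<in> multi_idx n l. monochrome \<C> (z a)} =
    (if monochrome ((\<lambda>C. C \<inter> Out) ` \<C>) w then n ^ card {C \<in> \<C>. C \<inter> Out = {}} else 0)"
proof (cases "monochrome ((\<lambda>C. C \<inter> Out) ` \<C>) w")
  case False
  have "\<not> monochrome \<C> (z a)" for a
  proof
    assume "monochrome \<C> (z a)"
    then have "z a x = z a y" if "C \<in> \<C>" "x \<in> C" "y \<in> C" for C x y
      using that unfolding monochrome_def by blast
    then have "w x = w y" if "C \<in> \<C>" "x \<in> C" "y \<in> C" "x \<in> Out" "y \<in> Out" for C x y
      using that z(1) by metis
    then have "monochrome ((\<lambda>C. C \<inter> Out) ` \<C>) w"
      by (auto simp: monochrome_def)
    with False show False by blast
  qed
  with False show ?thesis by simp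
next
  case True
  have fin: "finite \<C>" using finite_elements[OF X(2,1)] .
  \<comment> \<open>the labels that the block C may carry\<close>
  define V where "V C = (if C \<inter> Out = {} then {..<n} else {w (SOME x. x \<in> C \<inter> Out)})" for C
  have V: "V C = {w x}" if "C \<in> \<C>" "x \<in> C" "x \<in> Out" for C x
  proof -
    have x: "x \<in> C \<inter> Out" using that by simp
    have "w (SOME x. x \<in> C \<inter> Out) = w x"
      by (rule monochromeD[OF True imageI[OF that(1)] someI[of "\<lambda>x. x \<in> C \<inter> Out", OF x] x])
    then show ?thesis using that by (auto simp: V_def)
  qed
  have Vn: "V C \<subseteq> {..<n}" if "C \<in> \<C>" for C
  proof (cases "C \<inter> Out = {}")
    case False
    then obtain x where "x \<in> C" "x \<in> Out" by blast
    then show ?thesis using V[OF that] w by auto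
  qed (simp add: V_def)
  have blk_mid: "block_of \<C> (mid b) \<in> \<C>" "mid b \<in> block_of \<C> (mid b)" if "b < l" for b
  proof -
    have "mid b \<in> X" using that split(1) by blast
    then show "block_of \<C> (mid b) \<in> \<C>" "mid b \<in> block_of \<C> (mid b)" by (rule block_of[OF X(1)])+
  qed
  let ?F = "\<lambda>g. map (\<lambda>b. g (block_of \<C> (mid b))) [0..<l]"
  let ?H = "\<lambda>a. restrict (\<lambda>C. z a (SOME x. x \<in> C)) \<C>"
  have zF: "z (?F g) x = g (block_of \<C> x)" if g: "g \<in> PiE \<C> V" and x: "x \<in> X" for g x
  proof (cases "x \<in> Out")
    case True
    have "g (block_of \<C> x) \<in> V (block_of \<C> x)" by (rule PiE_mem[OF g block_of(1)[OF X(1) x]])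
    then show ?thesis using V[OF block_of(1,2)[OF X(1) x] True] z(1)[OF True] by simp
  next
    case False
    then obtain b where "b < l" "x = mid b" using x split(1) by blast
    then show ?thesis by (simp add: z(2))
  qed
  have some: "(SOME x. x \<in> C) \<in> C" if "C \<in> \<C>" for C
    using X(1) that by (metis ex_in_conv partition_onD3 someI_ex)
  have CX: "C \<subseteq> X" if "C \<in> \<C>" for C
    using X(1) that by (auto simp: partition_on_def)
  have "bij_betw ?F (PiE \<C> V) {a \<in> multi_idx n l. monochrome \<C> (z a)}"
  proof (rule bij_betw_byWitness[where f' = ?H])
    show "\<forall>g\<in>PiE \<C> V. ?H (?F g) = g"
    proof
      fix g assume g: "g \<in> PiE \<C> V"
      show "?H (?F g) = g"
      proof
        fix C
        show "?H (?F g) C = g C"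
        proof (cases "C \<in> \<C>")
          case True
          have "z (?F g) (SOME x. x \<in> C) = g (block_of \<C> (SOME x. x \<in> C))"
            by (rule zF[OF g subsetD[OF CX[OF True] some[OF True]]])
          also have "block_of \<C> (SOME x. x \<in> C) = C"
            by (rule block_of(3)[OF X(1) subsetD[OF CX[OF True] some[OF True]] True some[OF True]])
          finally show ?thesis using True by simp
        next
          case False
          then show ?thesis using PiE_arb[OF g] by simp
        qed
      qed
    qed
    show "\<forall>a\<in>{a \<in> multi_idx n l. monochrome \<C> (z a)}. ?F (?H a) = a"
    proof
      fix a assume a: "a \<in> {a \<in> multi_idx n l. monochrome \<C> (z a)}"
      show "?F (?H a) = a"
      proof (rule nth_equalityI)
        show "length (?F (?H a)) = length a" using a by (simp add: multi_idx_def)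
        fix b assume "b < length (?F (?H a))"
        then have b: "b < l" by simp
        have "z a (SOME x. x \<in> block_of \<C> (mid b)) = z a (mid b)"
          using a by (auto intro: monochromeD[OF _ blk_mid(1)[OF b] some[OF blk_mid(1)[OF b]] blk_mid(2)[OF b]])
        then show "?F (?H a) ! b = a ! b" using b blk_mid[OF b] z(2)[OF b] by simp
      qed
    qed
    show "?F ` PiE \<C> V \<subseteq> {a \<in> multi_idx n l. monochrome \<C> (z a)}"
    proof safe
      fix g assume g: "g \<in> PiE \<C> V"
      have "g (block_of \<C> (mid b)) < n" if "b < l" for b
        using PiE_mem[OF g blk_mid(1)[OF that]] Vn[OF blk_mid(1)[OF that]] by blast
      then show "?F g \<in> multi_idx n l" by (auto simp: multi_idx_def)
      show "monochrome \<C> (z (?F g))"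
        unfolding monochrome_iff_factors[OF X(1)] using zF[OF g] by blast
    qed
    show "?H ` {a \<in> multi_idx n l. monochrome \<C> (z a)} \<subseteq> PiE \<C> V"
    proof (rule image_subsetI)
      fix a assume "a \<in> {a \<in> multi_idx n l. monochrome \<C> (z a)}"
      then have a: "a \<in> multi_idx n l" "monochrome \<C> (z a)" by auto
      have zn: "z a x < n" if "x \<in> X" for x
      proof (cases "x \<in> Out")
        case True
        then show ?thesis using w z(1) by simp
      next
        case False
        then obtain b where b: "b < l" "x = mid b" using \<open>x \<in> X\<close> split(1) by blast
        have "a ! b \<in> set a" using a(1) b(1) by (simp add: multi_idx_def)
        then have "a ! b < n" using a(1) by (auto simp: multi_idx_def)
        then show ?thesis using b z(2)[OF b(1)] by simp
      qed
      show "?H a \<in> PiE \<C> V"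
      unfolding restrict_PiE_iff
      proof (rule ballI)
        fix C assume C: "C \<in> \<C>"
        show "z a (SOME x. x \<in> C) \<in> V C"
        proof (cases "C \<inter> Out = {}")
          case True
          have "z a (SOME x. x \<in> C) < n" by (rule zn[OF subsetD[OF CX[OF C] some[OF C]]])
          with True show ?thesis by (simp add: V_def)
        next
          case False
          then obtain x where x: "x \<in> C" "x \<in> Out" by blast
          have "z a (SOME x. x \<in> C) = z a x"
            by (rule monochromeD[OF a(2) C some[OF C] x(1)])
          then show ?thesis using V[OF C x] z(1)[OF x(2)] by simp
        qed
      qed
    qed
  qed
  then have "card {a \<in> multi_idx n l. monochrome \<C> (z a)} = card (PiE \<C> V)"
    by (simp add: bij_betw_same_card)
  also have "\<dots> = (\<Prod>C\<in>\<C>. card (V C))" by (rule card_PiE[OF fin])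
  also have "\<dots> = (\<Prod>C\<in>\<C>. if C \<inter> Out = {} then n else 1)"
    by (intro prod.cong) (auto simp: V_def)
  also have "\<dots> = n ^ card {C \<in> \<C>. C \<inter> Out = {}}"
    by (subst prod.inter_filter[OF fin, symmetric]) simp
  finally show ?thesis using True by simp
qed

section \<open>Composition of partitions counts labelings\<close>

lemma monochrome_image: "monochrome ((\<lambda>B. f ` B) ` p) z \<longleftrightarrow> monochrome p (\<lambda>x. z (f x))"
  by (simp add: monochrome_def)

lemma monochrome_Un: "monochrome (p \<union> q) z \<longleftrightarrow> monochrome p z \<and> monochrome q z"
  by (simp add: monochrome_def ball_Un)

lemma monochrome_cong:
  assumes "\<And>x. x \<in> \<Union>p \<Longrightarrow> y x = z x"
  shows "monochrome p y \<longleftrightarrow> monochrome p z"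
proof -
  have "z x = z x' \<longleftrightarrow> y x = y x'" if "C \<in> p" "x \<in> C" "x' \<in> C" for C x x'
    using assms[OF UnionI[OF that(1,2)]] assms[OF UnionI[OF that(1,3)]] by auto
  then show ?thesis unfolding monochrome_def by blast
qed

lemma stack_blocks_Union:
  assumes p: "p \<in> Part k l" and q: "q \<in> Part l m"
  shows "\<Union>(stack_blocks q p) = Top ` {..<k} \<union> Bot ` {..<m} \<union> Mid ` {..<l}"
proof -
  have "\<Union>(stack_blocks q p) = case_sum Top Mid ` \<Union>p \<union> case_sum Mid Bot ` \<Union>q"
    by (simp add: stack_blocks_def image_Union)
  also have "\<dots> = case_sum Top Mid ` points k l \<union> case_sum Mid Bot ` points l m"
    by (simp only: Part_D(1)[OF p] Part_D(1)[OF q])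
  also have "\<dots> = Top ` {..<k} \<union> Bot ` {..<m} \<union> Mid ` {..<l}"
    by (simp add: points_def image_Un image_image Un_ac)
  finally show ?thesis .
qed

lemma equiv_linked:
  "equiv (\<Union>\<B>) ({(x, y). \<exists>B\<in>\<B>. x \<in> B \<and> y \<in> B}\<^sup>+)"
proof (rule equivI)
  let ?R = "{(x, y). \<exists>B\<in>\<B>. x \<in> B \<and> y \<in> B}"
  have "?R \<subseteq> \<Union>\<B> \<times> \<Union>\<B>" by blast
  from trancl_subset_Sigma[OF this] show "?R\<^sup>+ \<subseteq> \<Union>\<B> \<times> \<Union>\<B>" .
  show "refl_on (\<Union>\<B>) (?R\<^sup>+)" unfolding refl_on_def by (intro ballI r_into_trancl) blast
  show "sym (?R\<^sup>+)" by (rule sym_trancl) (auto simp: sym_def)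
  show "trans (?R\<^sup>+)" by (rule trans_trancl)
qed

lemma stack_components_partition:
  assumes "p \<in> Part k l" and "q \<in> Part l m"
  shows "partition_on (Top ` {..<k} \<union> Bot ` {..<m} \<union> Mid ` {..<l}) (stack_components q p)"
  using partition_on_quotient[OF equiv_linked[of "stack_blocks q p"]]
  unfolding stack_components_def stack_blocks_Union[OF assms] .

text \<open>
  A labeling that is constant on blocks is constant along chains of overlapping blocks.
\<close>

lemma monochrome_components: "monochrome (stack_components q p) z \<longleftrightarrow> monochrome (stack_blocks q p) z"
proof
  let ?R = "{(x, y). \<exists>B\<in>stack_blocks q p. x \<in> B \<and> y \<in> B}"
  { assume m: "monochrome (stack_components q p) z"
    show "monochrome (stack_blocks q p) z"
      unfolding monochrome_def
    proof (intro ballI)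
      fix B x y assume B: "B \<in> stack_blocks q p" and x: "x \<in> B" and y: "y \<in> B"
      have "?R\<^sup>+ `` {x} \<in> stack_components q p"
        unfolding stack_components_def by (rule quotientI) (use B x in blast)
      moreover have "x \<in> ?R\<^sup>+ `` {x}" "y \<in> ?R\<^sup>+ `` {x}"
        using B x y by (auto intro!: r_into_trancl)
      ultimately show "z x = z y" by (rule monochromeD[OF m])
    qed }
  { assume m: "monochrome (stack_blocks q p) z"
    have *: "z a = z x" if "(a, x) \<in> ?R\<^sup>+" for a x
      using that
    proof (induction rule: trancl_induct)
      case (base x)
      then show ?case using monochromeD[OF m] by blast
    next
      case (step x y)
      then show ?case using monochromeD[OF m, of _ x y] by auto
    qed
    show "monochrome (stack_components q p) z"
      unfolding monochrome_def
    proof (intro ballI)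
      fix C x y assume C: "C \<in> stack_components q p" and xy: "x \<in> C" "y \<in> C"
      from C obtain a where "C = ?R\<^sup>+ `` {a}"
        unfolding stack_components_def by (rule quotientE)
      with xy have "(a, x) \<in> ?R\<^sup>+" "(a, y) \<in> ?R\<^sup>+" by simp_all
      from this[THEN *] show "z x = z y" by simp
    qed }
qed

lemma outer_part_vimage: "outer_part C = case_sum Top Bot -` C"
  by (auto simp: outer_part_def split: sum.splits)

lemma outer_part_empty_iff:
  assumes "C \<subseteq> Top ` {..<k} \<union> Bot ` {..<m} \<union> Mid ` {..<l}"
  shows "outer_part C = {} \<longleftrightarrow> C \<inter> (Top ` {..<k} \<union> Bot ` {..<m}) = {}"
  using assms unfolding outer_part_def by blast

lemma monochrome_outer_part:
  assumes "\<And>C. C \<in> \<C> \<Longrightarrow> C \<subseteq> Top ` {..<k} \<union> Bot ` {..<m} \<union> Mid ` {..<l}"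
  shows "monochrome (outer_part ` \<C> - {{}}) (\<lambda>x. w (case_sum Top Bot x)) \<longleftrightarrow>
    monochrome ((\<lambda>C. C \<inter> (Top ` {..<k} \<union> Bot ` {..<m})) ` \<C>) w"
proof -
  have eq: "C \<inter> (Top ` {..<k} \<union> Bot ` {..<m}) = case_sum Top Bot ` outer_part C" if "C \<in> \<C>" for C
  proof (intro equalityI subsetI)
    fix x assume "x \<in> C \<inter> (Top ` {..<k} \<union> Bot ` {..<m})"
    then consider i where "x = Top i" "Top i \<in> C" | j where "x = Bot j" "Bot j \<in> C" by blast
    then show "x \<in> case_sum Top Bot ` outer_part C"
    proof cases
      case 1
      then show ?thesis by (intro image_eqI[of _ _ "Inl i"]) (simp_all add: outer_part_vimage)
    next
      case 2
      then show ?thesis by (intro image_eqI[of _ _ "Inr j"]) (simp_all add: outer_part_vimage)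
    qed
  next
    fix x assume "x \<in> case_sum Top Bot ` outer_part C"
    then obtain y where "x = case_sum Top Bot y" "x \<in> C" by (auto simp: outer_part_vimage)
    then show "x \<in> C \<inter> (Top ` {..<k} \<union> Bot ` {..<m})"
      using assms[OF that] by (cases y) auto
  qed
  have "monochrome ((\<lambda>C. C \<inter> (Top ` {..<k} \<union> Bot ` {..<m})) ` \<C>) w \<longleftrightarrow>
      monochrome ((\<lambda>B. case_sum Top Bot ` B) ` outer_part ` \<C>) w"
    unfolding image_image using eq by (intro arg_cong[of _ _ "\<lambda>x. monochrome x w"] image_cong) auto
  also have "\<dots> \<longleftrightarrow> monochrome (outer_part ` \<C>) (\<lambda>x. w (case_sum Top Bot x))"
    by (rule monochrome_image)
  also have "\<dots> \<longleftrightarrow> monochrome (outer_part ` \<C> - {{}}) (\<lambda>x. w (case_sum Top Bot x))"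
    unfolding monochrome_def by blast
  finally show ?thesis by simp
qed

lemma pcomp_Part:
  assumes "p \<in> Part k l" and "q \<in> Part l m"
  shows "pcomp q p \<in> Part k m"
proof -
  have "outer_part = (-`) (case_sum Top Bot)" by (intro ext) (rule outer_part_vimage)
  moreover have "case_sum Top Bot -` (Top ` {..<k} \<union> Bot ` {..<m} \<union> Mid ` {..<l}) = points k m"
    by (auto simp: points_def split: sum.splits)
  ultimately show ?thesis
    using partition_on_vimage[OF stack_components_partition[OF assms], of "case_sum Top Bot"]
    by (simp only: Part_def pcomp_def mem_Collect_eq)
qed

text \<open>
  Functoriality of \<open>p \<mapsto> T\<^sub>p\<close> in every dimension \<open>n\<close>: the sum counts the labelings of the middle row
  that are compatible with both partitions, and each loop is a component with a free label.
\<close>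

theorem delta_pcomp:
  assumes p: "p \<in> Part k l" and q: "q \<in> Part l m"
    and i: "i \<in> multi_idx n k" and j: "j \<in> multi_idx n m"
  shows "(\<Sum>a\<in>multi_idx n l. delta q a j * delta p i a) = of_nat n ^ loops q p * delta (pcomp q p) i j"
proof -
  let ?z = "\<lambda>a. case_row_point (nth i) (nth a) (nth j)"
  let ?w = "case_row_point (nth i) (\<lambda>_. 0) (nth j)"
  let ?C = "stack_components q p"
  let ?O = "Top ` {..<k} \<union> Bot ` {..<m}"
  note P = stack_components_partition[OF p q]
  have Csub: "C \<subseteq> ?O \<union> Mid ` {..<l}" if "C \<in> ?C" for C
    using partition_onD1[OF P] that by blast
  have both: "delta q a j * delta p i a = (if monochrome ?C (?z a) then 1 else 0)" for a
  proof -
    have "monochrome ?C (?z a) \<longleftrightarrow>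
      monochrome p (\<lambda>x. ?z a (case_sum Top Mid x)) \<and> monochrome q (\<lambda>x. ?z a (case_sum Mid Bot x))"
      by (simp only: monochrome_components stack_blocks_def monochrome_Un monochrome_image)
    also have "(\<lambda>x. ?z a (case_sum Top Mid x)) = case_sum (nth i) (nth a)"
      by (auto split: sum.splits)
    also have "(\<lambda>x. ?z a (case_sum Mid Bot x)) = case_sum (nth a) (nth j)"
      by (auto split: sum.splits)
    finally show ?thesis by (simp add: delta_monochrome)
  qed
  have "(\<Sum>a\<in>multi_idx n l. delta q a j * delta p i a) =
      of_nat (card {a \<in> multi_idx n l. monochrome ?C (?z a)})"
    unfolding both by (subst sum.inter_filter[symmetric]) simp_all
  also have "card {a \<in> multi_idx n l. monochrome ?C (?z a)} =
    (if monochrome ((\<lambda>C. C \<inter> ?O) ` ?C) ?w then n ^ card {C \<in> ?C. C \<inter> ?O = {}} else 0)"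
  proof (rule card_monochrome_extensions[OF P])
    show "inj_on Mid {..<l}" by (simp add: inj_on_def)
    show "?w x < n" if "x \<in> ?O" for x
      using that i j by (force simp: multi_idx_def subset_eq)
    show "?O \<inter> Mid ` {..<l} = {}" by blast
  qed auto
  also have "{C \<in> ?C. C \<inter> ?O = {}} = {C \<in> ?C. outer_part C = {}}"
    using outer_part_empty_iff[OF Csub] by (intro Collect_cong conj_cong refl) simp
  also have "monochrome ((\<lambda>C. C \<inter> ?O) ` ?C) ?w \<longleftrightarrow> monochrome (pcomp q p) (\<lambda>x. ?w (case_sum Top Bot x))"
    unfolding pcomp_def by (rule monochrome_outer_part[OF Csub, symmetric])
  also have "(\<lambda>x. ?w (case_sum Top Bot x)) = case_sum (nth i) (nth j)"
    by (auto split: sum.splits)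
  finally show ?thesis by (simp add: loops_def delta_monochrome)
qed

lemma partition_eq_image_block_of: "partition_on X p \<Longrightarrow> p = block_of p ` X"
proof (intro equalityI subsetI)
  assume P: "partition_on X p"
  fix B assume "B \<in> p"
  then have "B \<noteq> {}" using partition_onD3[OF P] by auto
  then obtain x where "x \<in> B" by auto
  moreover have "x \<in> X" using partition_onD1[OF P] \<open>B \<in> p\<close> \<open>x \<in> B\<close> by blast
  ultimately show "B \<in> block_of p ` X" using block_of(3)[OF P _ \<open>B \<in> p\<close>] by (metis imageI)
next
  assume P: "partition_on X p"
  fix B assume "B \<in> block_of p ` X"
  then show "B \<in> p" using block_of(1)[OF P] by blast
qed

text \<open>
  Label the points by the blocks of \<open>p\<close>, with different labels for different blocks. This labeling is
  compatible with \<open>p'\<close> only if every block of \<open>p'\<close> lies in a block of \<open>p\<close>.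
\<close>

lemma delta_refines:
  assumes p: "p \<in> Part k l" and p': "p' \<in> Part k l"
    and le: "\<And>n i j. i \<in> multi_idx n k \<Longrightarrow> j \<in> multi_idx n l \<Longrightarrow> delta p i j \<noteq> 0 \<Longrightarrow> delta p' i j \<noteq> 0"
    and x: "x \<in> points k l"
  shows "block_of p' x \<subseteq> block_of p x"
proof
  fix y assume y: "y \<in> block_of p' x"
  have P: "partition_on (points k l) p" and P': "partition_on (points k l) p'"
    using p p' by (simp_all add: Part_def)
  obtain f n where f: "f ` p = {i. i < (n::nat)}" "inj_on f p"
    using finite_imp_inj_to_nat_seg[OF Part_D(4)[OF p]] by blast
  let ?i = "map (\<lambda>a. f (block_of p (Inl a))) [0..<k]"
  let ?j = "map (\<lambda>a. f (block_of p (Inr a))) [0..<l]"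
  have lab: "case_sum (nth ?i) (nth ?j) a = f (block_of p a)" if "a \<in> points k l" for a
    using that by (cases a) auto
  have fn: "f (block_of p a) < n" if "a \<in> points k l" for a
    using f(1) block_of(1)[OF P that] by blast
  have "?i \<in> multi_idx n k" "?j \<in> multi_idx n l" using fn by (auto simp: multi_idx_def)
  moreover have "delta p ?i ?j \<noteq> 0"
    using lab unfolding delta_monochrome monochrome_iff_factors[OF P] by auto
  ultimately have "delta p' ?i ?j \<noteq> 0" by (rule le)
  then have m: "monochrome p' (case_sum (nth ?i) (nth ?j))"
    by (simp add: delta_monochrome split: if_splits)
  have yX: "y \<in> points k l" using y block_of(1)[OF P' x] partition_onD1[OF P'] by blast
  from monochromeD[OF m block_of(1)[OF P' x] block_of(2)[OF P' x] y]
  have "f (block_of p x) = f (block_of p y)" unfolding lab[OF x] lab[OF yX] .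
  then have "block_of p x = block_of p y" by (rule inj_onD[OF f(2) _ block_of(1)[OF P x] block_of(1)[OF P yX]])
  then show "y \<in> block_of p x" using block_of(2)[OF P yX] by simp
qed

text \<open>
  This is what transports matrix identities back to partitions, together with their numbers of loops.
  The dimension \<open>n\<close> has to vary, since in a small fixed dimension different partitions can define the
  same matrix: for \<open>n = 1\<close> all of them do.
\<close>

theorem delta_unique:
  assumes p: "p \<in> Part k l" and p': "p' \<in> Part k l"
    and eq: "\<And>n i j. i \<in> multi_idx n k \<Longrightarrow> j \<in> multi_idx n l \<Longrightarrow>
      of_nat n ^ a * delta p i j = of_nat n ^ b * delta p' i j"
  shows "p = p'" "a = b"
proof -
  have nz: "delta p i j \<noteq> 0 \<longleftrightarrow> delta p' i j \<noteq> 0" if "i \<in> multi_idx n k" "j \<in> multi_idx n l" for n i j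
  proof (cases "n = 0")
    case True
    then have "k = 0" "l = 0" using that by (auto simp: multi_idx_def)
    then have "\<Union>p = {}" "\<Union>p' = {}"
      using Part_D(1)[OF p] Part_D(1)[OF p'] by (simp_all add: points_def)
    then have "p = {}" "p' = {}"
      using Part_D(3)[OF p] Part_D(3)[OF p'] unfolding Union_empty_conv by fast+
    then show ?thesis by simp
  next
    case False
    then show ?thesis using eq[OF that] by auto
  qed
  have P: "partition_on (points k l) p" and P': "partition_on (points k l) p'"
    using p p' by (simp_all add: Part_def)
  have "block_of p x = block_of p' x" if "x \<in> points k l" for x
    by (intro equalityI delta_refines[OF p p' _ that] delta_refines[OF p' p _ that])
      (simp_all add: nz)
  then have "block_of p ` points k l = block_of p' ` points k l" by (rule image_cong[OF refl])
  then show "p = p'"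
    by (subst partition_eq_image_block_of[OF P], subst partition_eq_image_block_of[OF P'])
  \<comment> \<open>the constant labeling is compatible with both partitions, which leaves the powers of n; take n = 2\<close>
  let ?i = "replicate k (0::nat)" and ?j = "replicate l (0::nat)"
  have "case_sum (nth ?i) (nth ?j) x = 0" if "x \<in> points k l" for x
    using that by (cases x) auto
  then have "delta p ?i ?j = 1"
    using P unfolding delta_monochrome monochrome_iff_factors[OF P] by auto
  moreover have "(of_nat 2 ^ a :: complex) * delta p ?i ?j = of_nat 2 ^ b * delta p' ?i ?j"
    by (rule eq) (auto simp: multi_idx_def)
  ultimately have "(of_nat (2 ^ a) :: complex) = of_nat (2 ^ b)" using \<open>p = p'\<close> by simp
  then have "(2::nat) ^ a = 2 ^ b" unfolding of_nat_eq_iff .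
  then show "a = b" by simp
qed

section \<open>Laws of the category of partitions\<close>

lemma multi_idx_0 [simp]: "multi_idx n 0 = {[]}"
  by (auto simp: multi_idx_def)

lemma multi_idx_append: "i \<in> multi_idx n k \<Longrightarrow> j \<in> multi_idx n l \<Longrightarrow> i @ j \<in> multi_idx n (k + l)"
  by (auto simp: multi_idx_def)

lemma multi_idx_split:
  assumes "i \<in> multi_idx n (k + l)"
  obtains i1 i2 where "i = i1 @ i2" "i1 \<in> multi_idx n k" "i2 \<in> multi_idx n l"
proof
  show "i = take k i @ drop k i" by simp
  show "take k i \<in> multi_idx n k" "drop k i \<in> multi_idx n l"
    using assms by (auto simp: multi_idx_def dest: in_set_takeD in_set_dropD)
qed

lemma multi_idx_length: "i \<in> multi_idx n k \<Longrightarrow> length i = k"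
  by (simp add: multi_idx_def)

lemma sum_multi_idx_add:
  fixes f :: "nat list \<Rightarrow> 'b::comm_monoid_add"
  shows "(\<Sum>a\<in>multi_idx n (k + l). f a) = (\<Sum>a\<in>multi_idx n k. \<Sum>b\<in>multi_idx n l. f (a @ b))"
proof -
  have "(\<Sum>a\<in>multi_idx n k. \<Sum>b\<in>multi_idx n l. f (a @ b)) =
      (\<Sum>(a, b)\<in>multi_idx n k \<times> multi_idx n l. f (a @ b))"
    by (rule sum.cartesian_product)
  also have "\<dots> = (\<Sum>a\<in>multi_idx n (k + l). f a)"
  proof (rule sum.reindex_bij_witness[where i = "\<lambda>a. (take k a, drop k a)" and j = "\<lambda>(a, b). a @ b"])
    fix a assume a: "a \<in> multi_idx n (k + l)"
    then show "(take k a, drop k a) \<in> multi_idx n k \<times> multi_idx n l"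
      by (auto simp: multi_idx_def dest: in_set_takeD in_set_dropD)
  qed (auto simp: multi_idx_def)
  finally show ?thesis by simp
qed

lemma multi_idx_1: "multi_idx n (Suc 0) = (\<lambda>a. [a]) ` {..<n}"
  by (auto simp: multi_idx_def length_Suc_conv)

lemma sum_multi_idx_1: "(\<Sum>a\<in>multi_idx n (Suc 0). f a) = (\<Sum>a<n. f [a])"
  unfolding multi_idx_1 by (subst sum.reindex) (auto simp: inj_on_def)

lemma ptensor_Part:
  assumes p: "p \<in> Part k l" and q: "q \<in> Part k' l'"
  shows "ptensor k l p q \<in> Part (k + k') (l + l')"
proof -
  let ?s = "map_sum ((+) k) ((+) l)"
  have inj: "inj ?s" by (rule sum.inj_map) (simp_all add: inj_on_def)
  have U: "points (k + k') (l + l') = points k l \<union> ?s ` points k' l'"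
  proof -
    have "{..<a + b} = {..<a} \<union> (+) a ` {..<b}" for a b :: nat
    proof (intro equalityI subsetI)
      fix x assume "x \<in> {..<a + b}"
      then show "x \<in> {..<a} \<union> (+) a ` {..<b}"
        by (cases "x < a") (auto intro!: image_eqI[of _ _ "x - a"])
    qed auto
    then show ?thesis by (simp add: points_def image_Un image_image Un_ac)
  qed
  have D: "points k l \<inter> ?s ` points k' l' = {}" by (auto simp: points_def)
  have "partition_on (?s ` points k' l') ((`) ?s ` q - {{}})"
    using q by (intro partition_on_inj_image inj_on_subset[OF inj]) (simp_all add: Part_def)
  moreover have "(`) ?s ` q - {{}} = (`) ?s ` q" using Part_D(3)[OF q] by auto
  ultimately have "partition_on (?s ` points k' l') ((`) ?s ` q)" by simp
  moreover have "partition_on (points k l) p" using p by (simp add: Part_def)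
  ultimately show ?thesis
    using D unfolding Part_def ptensor_def U partition_on_def mem_Collect_eq
    by (metis (no_types) Un_iff Union_Un_distrib disjoint_union)
qed

lemma delta_ptensor:
  assumes p: "p \<in> Part k l" and i: "i \<in> multi_idx n k" and j: "j \<in> multi_idx n l"
  shows "delta (ptensor k l p q) (i @ i') (j @ j') = delta p i j * delta q i' j'"
proof -
  note len = multi_idx_length[OF i] multi_idx_length[OF j]
  have "monochrome p (case_sum (nth (i @ i')) (nth (j @ j'))) \<longleftrightarrow> monochrome p (case_sum (nth i) (nth j))"
  proof (rule monochrome_cong)
    fix x assume "x \<in> \<Union>p"
    then have "x \<in> points k l" by (simp only: Part_D(1)[OF p])
    then show "case_sum (nth (i @ i')) (nth (j @ j')) x = case_sum (nth i) (nth j) x"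
      using len by (cases x) (auto simp: nth_append)
  qed
  moreover have "(\<lambda>x. case_sum (nth (i @ i')) (nth (j @ j')) (map_sum ((+) k) ((+) l) x)) = case_sum (nth i') (nth j')"
    unfolding len[symmetric] by (auto split: sum.splits)
  ultimately show ?thesis
    by (simp add: delta_monochrome ptensor_def monochrome_Un monochrome_image)
qed

lemma case_sum_swap_swap: "case_sum Inr Inl (case_sum Inr Inl x) = x"
  by (cases x) auto

lemma pstar_Part:
  assumes p: "p \<in> Part k l"
  shows "pstar p \<in> Part l k"
proof -
  let ?s = "case_sum Inr Inl :: nat + nat \<Rightarrow> nat + nat"
  have inj: "inj ?s" by (rule injI) (metis case_sum_swap_swap)
  have U: "points l k = ?s ` points k l"
    by (simp add: points_def image_Un image_image Un_ac)
  have "partition_on (?s ` points k l) ((`) ?s ` p - {{}})"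
    using p by (intro partition_on_inj_image inj_on_subset[OF inj]) (simp_all add: Part_def)
  moreover have "(`) ?s ` p - {{}} = (`) ?s ` p" using Part_D(3)[OF p] by auto
  ultimately show ?thesis by (simp add: Part_def pstar_def U)
qed

lemma delta_pstar: "delta (pstar p) j i = delta p i j"
proof -
  have "(\<lambda>x. case_sum (nth j) (nth i) (case_sum Inr Inl x)) = case_sum (nth i) (nth j)"
    by (auto split: sum.splits)
  then show ?thesis by (simp add: delta_monochrome pstar_def monochrome_image)
qed

text \<open>
  The laws of the category of partitions are the corresponding laws of matrices, here the associativity
  of the product. The loop counts are compared at the same time because they are the exponents of \<open>n\<close>.
\<close>

lemma
  assumes p: "p \<in> Part k l" and q: "q \<in> Part l m" and r: "r \<in> Part m s"
  shows pcomp_assoc: "pcomp r (pcomp q p) = pcomp (pcomp r q) p" (is ?A)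
    and loops_assoc: "loops q p + loops r (pcomp q p) = loops r q + loops (pcomp r q) p" (is ?B)
proof -
  have eq: "of_nat n ^ (loops q p + loops r (pcomp q p)) * delta (pcomp r (pcomp q p)) i j =
      of_nat n ^ (loops r q + loops (pcomp r q) p) * delta (pcomp (pcomp r q) p) i j"
    if i: "i \<in> multi_idx n k" and j: "j \<in> multi_idx n s" for n i j
  proof -
    have "of_nat n ^ (loops q p + loops r (pcomp q p)) * delta (pcomp r (pcomp q p)) i j =
        (\<Sum>b\<in>multi_idx n m. delta r b j * (of_nat n ^ loops q p * delta (pcomp q p) i b))"
      by (simp add: power_add mult.assoc delta_pcomp[OF pcomp_Part[OF p q] r i j, symmetric]
          sum_distrib_left mult.left_commute)
    also have "\<dots> = (\<Sum>b\<in>multi_idx n m. delta r b j * (\<Sum>a\<in>multi_idx n l. delta q a b * delta p i a))"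
      by (intro sum.cong refl) (simp add: delta_pcomp[OF p q i])
    also have "\<dots> = (\<Sum>b\<in>multi_idx n m. \<Sum>a\<in>multi_idx n l. delta r b j * delta q a b * delta p i a)"
      by (simp add: sum_distrib_left mult.assoc)
    also have "\<dots> = (\<Sum>a\<in>multi_idx n l. (\<Sum>b\<in>multi_idx n m. delta r b j * delta q a b) * delta p i a)"
      by (subst sum.swap) (simp add: sum_distrib_right)
    also have "\<dots> = (\<Sum>a\<in>multi_idx n l. of_nat n ^ loops r q * delta (pcomp r q) a j * delta p i a)"
      by (intro sum.cong refl) (simp add: delta_pcomp[OF q r _ j])
    also have "\<dots> = of_nat n ^ (loops r q + loops (pcomp r q) p) * delta (pcomp (pcomp r q) p) i j"
      using delta_pcomp[OF p pcomp_Part[OF q r] i j]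
      by (simp add: power_add mult.assoc sum_distrib_left[symmetric])
    finally show ?thesis .
  qed
  note P = pcomp_Part[OF pcomp_Part[OF p q] r] pcomp_Part[OF p pcomp_Part[OF q r]]
  show ?A by (rule delta_unique(1)[OF P eq])
  show ?B by (rule delta_unique(2)[OF P eq])
qed

text \<open>
  The mixed product rule for Kronecker products of matrices.
\<close>

lemma
  assumes p: "p \<in> Part k l" and q: "q \<in> Part l m" and p': "p' \<in> Part k' l'" and q': "q' \<in> Part l' m'"
  shows pcomp_ptensor: "pcomp (ptensor l m q q') (ptensor k l p p') = ptensor k m (pcomp q p) (pcomp q' p')" (is ?A)
    and loops_ptensor: "loops (ptensor l m q q') (ptensor k l p p') = loops q p + loops q' p'" (is ?B)
proof -
  note pp = ptensor_Part[OF p p'] and qq = ptensor_Part[OF q q']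
  have eq: "of_nat n ^ loops (ptensor l m q q') (ptensor k l p p') *
        delta (pcomp (ptensor l m q q') (ptensor k l p p')) i j =
      of_nat n ^ (loops q p + loops q' p') * delta (ptensor k m (pcomp q p) (pcomp q' p')) i j"
    if i: "i \<in> multi_idx n (k + k')" and j: "j \<in> multi_idx n (m + m')" for n i j
  proof -
    obtain i1 i2 where i12: "i = i1 @ i2" "i1 \<in> multi_idx n k" "i2 \<in> multi_idx n k'"
      by (rule multi_idx_split[OF i])
    obtain j1 j2 where j12: "j = j1 @ j2" "j1 \<in> multi_idx n m" "j2 \<in> multi_idx n m'"
      by (rule multi_idx_split[OF j])
    have "of_nat n ^ loops (ptensor l m q q') (ptensor k l p p') *
        delta (pcomp (ptensor l m q q') (ptensor k l p p')) i j =
      (\<Sum>a\<in>multi_idx n l. \<Sum>b\<in>multi_idx n l'.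
        delta (ptensor l m q q') (a @ b) (j1 @ j2) * delta (ptensor k l p p') (i1 @ i2) (a @ b))"
      using delta_pcomp[OF pp qq i j] unfolding sum_multi_idx_add i12(1) j12(1) by simp
    also have "\<dots> = (\<Sum>a\<in>multi_idx n l. \<Sum>b\<in>multi_idx n l'.
        (delta q a j1 * delta p i1 a) * (delta q' b j2 * delta p' i2 b))"
      by (intro sum.cong refl) (simp add: delta_ptensor[OF q _ j12(2)] delta_ptensor[OF p i12(2)])
    also have "\<dots> = (\<Sum>a\<in>multi_idx n l. delta q a j1 * delta p i1 a) *
        (\<Sum>b\<in>multi_idx n l'. delta q' b j2 * delta p' i2 b)"
      by (rule sum_product[symmetric])
    also have "\<dots> = of_nat n ^ (loops q p + loops q' p') * delta (ptensor k m (pcomp q p) (pcomp q' p')) i j"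
      by (simp add: delta_pcomp[OF p q i12(2) j12(2)] delta_pcomp[OF p' q' i12(3) j12(3)] i12(1) j12(1)
          delta_ptensor[OF pcomp_Part[OF p q] i12(2) j12(2)] power_add)
    finally show ?thesis .
  qed
  note P = pcomp_Part[OF pp qq] ptensor_Part[OF pcomp_Part[OF p q] pcomp_Part[OF p' q']]
  show ?A by (rule delta_unique(1)[OF P eq])
  show ?B by (rule delta_unique(2)[OF P eq])
qed

lemma
  assumes p: "p \<in> Part k l" and q: "q \<in> Part l m"
  shows pstar_pcomp: "pstar (pcomp q p) = pcomp (pstar p) (pstar q)" (is ?A)
    and loops_pstar: "loops q p = loops (pstar p) (pstar q)" (is ?B)
proof -
  have eq: "of_nat n ^ loops q p * delta (pstar (pcomp q p)) j i =
      of_nat n ^ loops (pstar p) (pstar q) * delta (pcomp (pstar p) (pstar q)) j i"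
    if "j \<in> multi_idx n m" "i \<in> multi_idx n k" for n i j
    using delta_pcomp[OF p q that(2,1)] delta_pcomp[OF pstar_Part[OF q] pstar_Part[OF p] that]
    by (simp add: delta_pstar mult.commute)
  note P = pstar_Part[OF pcomp_Part[OF p q]] pcomp_Part[OF pstar_Part[OF q] pstar_Part[OF p]]
  show ?A by (rule delta_unique(1)[OF P eq])
  show ?B by (rule delta_unique(2)[OF P eq])
qed

lemma ptensor_assoc:
  "ptensor (k + k') (l + l') (ptensor k l p q) r = ptensor k l p (ptensor k' l' q r)"
proof -
  have "map_sum ((+) (k + k')) ((+) (l + l')) x = map_sum ((+) k) ((+) l) (map_sum ((+) k') ((+) l') x)" for x
    by (cases x) (simp_all add: add.assoc)
  then show ?thesis by (simp add: ptensor_def image_Un image_image Un_assoc)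
qed

lemma pstar_ptensor: "pstar (ptensor k l p q) = ptensor l k (pstar p) (pstar q)"
proof -
  have "case_sum Inr Inl (map_sum ((+) k) ((+) l) x) = map_sum ((+) l) ((+) k) (case_sum Inr Inl x)" for x
    by (cases x) auto
  then show ?thesis by (simp add: pstar_def ptensor_def image_Un image_image)
qed

lemma ptensor_empty [simp]: "ptensor k l p {} = p" "ptensor 0 0 {} q = q"
proof -
  have "map_sum ((+) (0::nat)) ((+) (0::nat)) = id" by (simp add: fun_eq_iff map_sum_def split: sum.splits)
  then show "ptensor 0 0 {} q = q" by (simp add: ptensor_def)
qed (simp add: ptensor_def)

section \<open>Linear combinations of partitions and their linear maps\<close>

lemma lookup_scale [simp]: "Poly_Mapping.lookup (scale c f) p = c * Poly_Mapping.lookup f p"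
  unfolding scale_def by (simp add: Poly_Mapping.map.rep_eq when_def)

lemma lookup_basis: "Poly_Mapping.lookup (basis p) q = (if p = q then 1 else 0)"
  by (simp add: basis_def lookup_single when_def)

lemma scale_add [simp]: "scale c (f + g) = scale c f + scale c g"
  by (rule poly_mapping_eqI) (simp add: lookup_add algebra_simps)

lemma scale_scale [simp]: "scale c (scale d f) = scale (c * d) f"
  by (rule poly_mapping_eqI) simp

lemma scale_0 [simp]: "scale c 0 = 0" "scale 0 f = 0"
  by (rule poly_mapping_eqI, simp)+

lemma scale_1 [simp]: "scale 1 f = f"
  by (rule poly_mapping_eqI) simp

lemma scale_add_left: "scale (c + d) f = scale c f + scale d f"
  by (rule poly_mapping_eqI) (simp add: lookup_add algebra_simps)

lemma minus_eq_add_scale: "f - g = f + scale (- 1) g"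
  by (rule poly_mapping_eqI) (simp add: lookup_add lookup_minus)

lemma scale_sum: "scale c (\<Sum>i\<in>I. f i) = (\<Sum>i\<in>I. scale c (f i))"
  by (induction I rule: infinite_finite_induct) simp_all

lemma Plin_0 [simp]: "0 \<in> Plin k l"
  by (simp add: Plin_def)

lemma Plin_add: "f \<in> Plin k l \<Longrightarrow> g \<in> Plin k l \<Longrightarrow> f + g \<in> Plin k l"
  unfolding Plin_def using keys_add[of f g] by blast

lemma Plin_scale: "f \<in> Plin k l \<Longrightarrow> scale c f \<in> Plin k l"
  unfolding Plin_def by (auto simp: in_keys_iff)

lemma Plin_basis [simp]: "basis p \<in> Plin k l \<longleftrightarrow> p \<in> Part k l"
  by (simp add: Plin_def basis_def)

lemma basis_expansion: "f = (\<Sum>p\<in>Poly_Mapping.keys f. scale (Poly_Mapping.lookup f p) (basis p))"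
  by (rule poly_mapping_eqI) (simp add: lookup_sum lookup_basis in_keys_iff if_distrib cong: if_cong)

text \<open>
  A multilinear identity is reduced to partitions by one such induction for each argument.
\<close>

lemma Plin_induct [consumes 1, case_names zero add basis]:
  assumes f: "f \<in> Plin k l" and zero: "P 0"
    and add: "\<And>f g. P f \<Longrightarrow> P g \<Longrightarrow> P (f + g)"
    and basis: "\<And>c p. p \<in> Part k l \<Longrightarrow> P (scale c (basis p))"
  shows "P f"
proof -
  have "P (\<Sum>p\<in>I. scale (Poly_Mapping.lookup f p) (basis p))" if "finite I" "I \<subseteq> Part k l" for I
    using that by (induction I rule: finite_induct) (simp_all add: zero add basis)
  from this[of "Poly_Mapping.keys f"] show ?thesis
    using f by (simp add: Plin_def basis_expansion[symmetric])
qed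

text \<open>
  Tensor product, composition and involution are iterated linear extensions of operations on
  partitions, which makes their linearity in each argument immediate.
\<close>

definition lin_ext :: "(ptn \<Rightarrow> lptn) \<Rightarrow> lptn \<Rightarrow> lptn" where
  "lin_ext F f = (\<Sum>p\<in>Poly_Mapping.keys f. scale (Poly_Mapping.lookup f p) (F p))"

lemma lin_ext_superset:
  assumes "finite S" "Poly_Mapping.keys f \<subseteq> S"
  shows "lin_ext F f = (\<Sum>p\<in>S. scale (Poly_Mapping.lookup f p) (F p))"
  unfolding lin_ext_def using assms by (intro sum.mono_neutral_left) (auto simp: in_keys_iff)

lemma lin_ext_add: "lin_ext F (f + g) = lin_ext F f + lin_ext F g"
proof -
  let ?S = "Poly_Mapping.keys f \<union> Poly_Mapping.keys g"
  have "lin_ext F (f + g) = (\<Sum>p\<in>?S. scale (Poly_Mapping.lookup (f + g) p) (F p))"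
    by (rule lin_ext_superset) (simp_all add: keys_add)
  also have "\<dots> = lin_ext F f + lin_ext F g"
    by (simp add: lin_ext_superset[of ?S] lookup_add scale_add_left sum.distrib)
  finally show ?thesis .
qed

lemma lin_ext_scale: "lin_ext F (scale c f) = scale c (lin_ext F f)"
proof -
  have "lin_ext F (scale c f) = (\<Sum>p\<in>Poly_Mapping.keys f. scale (Poly_Mapping.lookup (scale c f) p) (F p))"
    by (rule lin_ext_superset) (auto simp: in_keys_iff)
  then show ?thesis by (simp add: lin_ext_def scale_sum)
qed

lemma lin_ext_basis: "lin_ext F (basis p) = F p"
  by (simp add: lin_ext_def basis_def)

lemma lin_ext_fun_add: "lin_ext (\<lambda>p. F p + G p) f = lin_ext F f + lin_ext G f"
  by (simp add: lin_ext_def sum.distrib)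

lemma lin_ext_fun_scale: "lin_ext (\<lambda>p. scale c (F p)) f = scale c (lin_ext F f)"
  by (simp add: lin_ext_def scale_sum mult.commute)

lemma lcomp_lin_ext:
  "lcomp N g f = lin_ext (\<lambda>p. lin_ext (\<lambda>q. scale (of_nat N ^ loops q p) (basis (pcomp q p))) g) f"
  by (simp add: lcomp_def lin_ext_def scale_sum mult.assoc)

lemma ltensor_lin_ext:
  "ltensor k l f g = lin_ext (\<lambda>p. lin_ext (\<lambda>q. basis (ptensor k l p q)) g) f"
  by (simp add: ltensor_def lin_ext_def scale_sum mult.assoc)

lemma lcomp_add [simp]:
  "lcomp N (g + g') f = lcomp N g f + lcomp N g' f"
  "lcomp N g (f + f') = lcomp N g f + lcomp N g f'"
  by (simp_all add: lcomp_lin_ext lin_ext_add lin_ext_fun_add)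

lemma lcomp_scale [simp]:
  "lcomp N (scale c g) f = scale c (lcomp N g f)"
  "lcomp N g (scale c f) = scale c (lcomp N g f)"
  by (simp_all add: lcomp_lin_ext lin_ext_scale lin_ext_fun_scale)

lemma lcomp_0 [simp]: "lcomp N 0 f = 0" "lcomp N g 0 = 0"
  using lcomp_scale[of N 0 0 f] lcomp_scale(2)[of N g 0 0] by simp_all

lemma lcomp_basis: "lcomp N (basis q) (basis p) = scale (of_nat N ^ loops q p) (basis (pcomp q p))"
  by (simp add: lcomp_lin_ext lin_ext_basis)

lemma ltensor_add [simp]:
  "ltensor k l (f + f') g = ltensor k l f g + ltensor k l f' g"
  "ltensor k l f (g + g') = ltensor k l f g + ltensor k l f g'"
  by (simp_all add: ltensor_lin_ext lin_ext_add lin_ext_fun_add)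

lemma ltensor_scale [simp]:
  "ltensor k l (scale c f) g = scale c (ltensor k l f g)"
  "ltensor k l f (scale c g) = scale c (ltensor k l f g)"
  by (simp_all add: ltensor_lin_ext lin_ext_scale lin_ext_fun_scale)

lemma ltensor_0 [simp]: "ltensor k l 0 g = 0" "ltensor k l f 0 = 0"
  using ltensor_scale[of k l 0 0 g] ltensor_scale(2)[of k l f 0 0] by simp_all

lemma ltensor_basis: "ltensor k l (basis p) (basis q) = basis (ptensor k l p q)"
  by (simp add: ltensor_lin_ext lin_ext_basis)

lemma lookup_map_cnj [simp]:
  "Poly_Mapping.lookup (Poly_Mapping.map cnj f) p = cnj (Poly_Mapping.lookup f p)"
  by (simp add: Poly_Mapping.map.rep_eq when_def)

lemma lstar_lin_ext: "lstar f = lin_ext (\<lambda>p. basis (pstar p)) (Poly_Mapping.map cnj f)"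
  unfolding lstar_def by (subst lin_ext_superset[of "Poly_Mapping.keys f"]) (auto simp: in_keys_iff)

lemma lstar_add [simp]: "lstar (f + g) = lstar f + lstar g"
proof -
  have "Poly_Mapping.map cnj (f + g) = Poly_Mapping.map cnj f + Poly_Mapping.map cnj g"
    by (rule poly_mapping_eqI) (simp add: lookup_add)
  then show ?thesis by (simp add: lstar_lin_ext lin_ext_add)
qed

lemma lstar_scale [simp]: "lstar (scale c f) = scale (cnj c) (lstar f)"
proof -
  have "Poly_Mapping.map cnj (scale c f) = scale (cnj c) (Poly_Mapping.map cnj f)"
    by (rule poly_mapping_eqI) simp
  then show ?thesis by (simp add: lstar_lin_ext lin_ext_scale)
qed

lemma lstar_0 [simp]: "lstar 0 = 0"
  using lstar_scale[of 0 0] by simp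

lemma lstar_basis: "lstar (basis p) = basis (pstar p)"
  by (simp add: lstar_def basis_def)

lemma lcomp_Plin:
  assumes f: "f \<in> Plin k l" and g: "g \<in> Plin l m"
  shows "lcomp N g f \<in> Plin k m"
  using f
proof (induction rule: Plin_induct)
  case p: (basis c p)
  from g show ?case
    by (induction rule: Plin_induct) (simp_all add: Plin_add Plin_scale lcomp_basis pcomp_Part[OF p])
qed (simp_all add: Plin_add)

lemma ltensor_Plin:
  assumes f: "f \<in> Plin k l" and g: "g \<in> Plin k' l'"
  shows "ltensor k l f g \<in> Plin (k + k') (l + l')"
  using f
proof (induction rule: Plin_induct)
  case p: (basis c p)
  from g show ?case
    by (induction rule: Plin_induct) (simp_all add: Plin_add Plin_scale ltensor_basis ptensor_Part[OF p])
qed (simp_all add: Plin_add)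

lemma lstar_Plin: "f \<in> Plin k l \<Longrightarrow> lstar f \<in> Plin l k"
  by (induction rule: Plin_induct) (simp_all add: Plin_add Plin_scale lstar_basis pstar_Part)

lemma lcomp_assoc:
  assumes f: "f \<in> Plin k l" and g: "g \<in> Plin l m" and h: "h \<in> Plin m s"
  shows "lcomp N h (lcomp N g f) = lcomp N (lcomp N h g) f"
  using f
proof (induction rule: Plin_induct)
  case p: (basis c p)
  from g show ?case
  proof (induction rule: Plin_induct)
    case q: (basis d q)
    from h show ?case
    proof (induction rule: Plin_induct)
      case r: (basis e r)
      have "(of_nat N :: complex) ^ loops q p * of_nat N ^ loops r (pcomp q p) =
          of_nat N ^ loops r q * of_nat N ^ loops (pcomp r q) p"
        by (simp only: power_add[symmetric] loops_assoc[OF p q r])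
      then show ?case
        by (simp add: lcomp_basis pcomp_assoc[OF p q r] mult.assoc mult.left_commute)
    qed simp_all
  qed simp_all
qed simp_all

lemma lcomp_ltensor:
  assumes f: "f \<in> Plin k l" and g: "g \<in> Plin l m" and f': "f' \<in> Plin k' l'" and g': "g' \<in> Plin l' m'"
  shows "lcomp N (ltensor l m g g') (ltensor k l f f') = ltensor k m (lcomp N g f) (lcomp N g' f')"
  using f
proof (induction rule: Plin_induct)
  case p: (basis c p)
  from g show ?case
  proof (induction rule: Plin_induct)
    case q: (basis d q)
    from f' show ?case
    proof (induction rule: Plin_induct)
      case p': (basis c' p')
      from g' show ?case
      proof (induction rule: Plin_induct)
        case q': (basis d' q')
        show ?case
          by (simp add: lcomp_basis ltensor_basis pcomp_ptensor[OF p q p' q'] loops_ptensor[OF p q p' q']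
              power_add mult_ac)
      qed simp_all
    qed simp_all
  qed simp_all
qed simp_all

lemma ltensor_assoc:
  assumes f: "f \<in> Plin k l" and g: "g \<in> Plin k' l'" and h: "h \<in> Plin k'' l''"
  shows "ltensor (k + k') (l + l') (ltensor k l f g) h = ltensor k l f (ltensor k' l' g h)"
  using f
proof (induction rule: Plin_induct)
  case p: (basis c p)
  from g show ?case
  proof (induction rule: Plin_induct)
    case q: (basis d q)
    from h show ?case
      by (induction rule: Plin_induct) (simp_all add: ltensor_basis ptensor_assoc mult_ac)
  qed simp_all
qed simp_all

lemma lstar_lcomp:
  assumes f: "f \<in> Plin k l" and g: "g \<in> Plin l m"
  shows "lstar (lcomp N g f) = lcomp N (lstar f) (lstar g)"
  using f
proof (induction rule: Plin_induct)
  case p: (basis c p)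
  from g show ?case
    by (induction rule: Plin_induct)
      (simp_all add: lcomp_basis lstar_basis pstar_pcomp[OF p] loops_pstar[OF p] mult.left_commute)
qed simp_all

lemma lstar_ltensor:
  assumes f: "f \<in> Plin k l" and g: "g \<in> Plin k' l'"
  shows "lstar (ltensor k l f g) = ltensor l k (lstar f) (lstar g)"
  using f
proof (induction rule: Plin_induct)
  case p: (basis c p)
  from g show ?case
    by (induction rule: Plin_induct) (simp_all add: ltensor_basis lstar_basis pstar_ptensor mult.commute)
qed simp_all

lemma Tmap_superset:
  assumes "finite S" "Poly_Mapping.keys f \<subseteq> S" "j \<in> multi_idx n l" "i \<in> multi_idx n k"
  shows "Tmap n k l f j i = (\<Sum>p\<in>S. Poly_Mapping.lookup f p * delta p i j)"
  unfolding Tmap_def using assms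
  by (simp, intro sum.mono_neutral_left) (auto simp: in_keys_iff)

lemma Tmap_outside: "\<not> (j \<in> multi_idx n l \<and> i \<in> multi_idx n k) \<Longrightarrow> Tmap n k l f j i = 0"
  by (auto simp: Tmap_def)

lemma Tmap_add: "Tmap n k l (f + g) j i = Tmap n k l f j i + Tmap n k l g j i"
proof (cases "j \<in> multi_idx n l \<and> i \<in> multi_idx n k")
  case True
  let ?S = "Poly_Mapping.keys f \<union> Poly_Mapping.keys g"
  show ?thesis
    using True keys_add[of f g]
    by (simp add: Tmap_superset[of ?S] lookup_add algebra_simps sum.distrib)
qed (simp add: Tmap_outside)

lemma Tmap_scale: "Tmap n k l (scale c f) j i = c * Tmap n k l f j i"
proof (cases "j \<in> multi_idx n l \<and> i \<in> multi_idx n k")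
  case True
  have "Poly_Mapping.keys (scale c f) \<subseteq> Poly_Mapping.keys f" by (auto simp: in_keys_iff)
  with True show ?thesis
    by (simp add: Tmap_superset[of "Poly_Mapping.keys f"] sum_distrib_left mult.assoc)
qed (simp add: Tmap_outside)

lemma Tmap_0: "Tmap n k l 0 j i = 0"
  by (simp add: Tmap_def)

lemma Tmap_basis:
  "Tmap n k l (basis p) j i = (if j \<in> multi_idx n l \<and> i \<in> multi_idx n k then delta p i j else 0)"
  by (simp add: Tmap_def basis_def)

lemmas Tmap_linear = Tmap_add Tmap_scale Tmap_0

lemma Tmap_lcomp:
  assumes f: "f \<in> Plin k l" and g: "g \<in> Plin l m"
  shows "Tmap N k m (lcomp N g f) j i = (\<Sum>a\<in>multi_idx N l. Tmap N l m g j a * Tmap N k l f a i)"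
  using f
proof (induction rule: Plin_induct)
  case p: (basis c p)
  from g show ?case
  proof (induction rule: Plin_induct)
    case q: (basis d q)
    show ?case
    proof (cases "j \<in> multi_idx N m \<and> i \<in> multi_idx N k")
      case True
      then show ?thesis
        using delta_pcomp[OF p q, of i N j, symmetric]
        by (simp add: lcomp_basis Tmap_scale Tmap_basis sum_distrib_left mult.assoc mult.left_commute)
    qed (auto simp: Tmap_outside Tmap_scale lcomp_basis Tmap_basis intro!: sum.neutral[symmetric])
  qed (simp_all add: Tmap_linear algebra_simps sum.distrib)
qed (simp_all add: Tmap_linear algebra_simps sum.distrib)

lemma Tmap_ltensor:
  assumes f: "f \<in> Plin k l" and g: "g \<in> Plin k' l'"
    and "j \<in> multi_idx n l" "i \<in> multi_idx n k" "j' \<in> multi_idx n l'" "i' \<in> multi_idx n k'"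
  shows "Tmap n (k + k') (l + l') (ltensor k l f g) (j @ j') (i @ i') = Tmap n k l f j i * Tmap n k' l' g j' i'"
  using f
proof (induction rule: Plin_induct)
  case p: (basis c p)
  from g have "Tmap n (k + k') (l + l') (ltensor k l (basis p) g) (j @ j') (i @ i') =
      Tmap n k l (basis p) j i * Tmap n k' l' g j' i'"
  proof (induction rule: Plin_induct)
    case q: (basis d q)
    show ?case
      using assms(3-) by (simp add: ltensor_basis Tmap_scale Tmap_basis multi_idx_append delta_ptensor[OF p])
  qed (simp_all add: Tmap_linear algebra_simps)
  then show ?case by (simp add: Tmap_scale)
qed (simp_all add: Tmap_linear algebra_simps)

section \<open>The reflection and the functor that it induces\<close>

abbreviation up_up_ptn :: ptn where "up_up_ptn \<equiv> {{Inr 0}, {Inr 1}}"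

lemma lessThan_2: "{..<2::nat} = {0, 1}" "{..<Suc (Suc 0)} = {0, 1}"
  by auto

lemma card_multi_idx_1: "card (multi_idx n (Suc 0)) = n"
  unfolding multi_idx_1 by (subst card_image) (simp_all add: inj_on_def)

lemma sum_multi_idx_2: "(\<Sum>a\<in>multi_idx n 2. f a) = (\<Sum>x<n. \<Sum>y<n. f [x, y])"
  using sum_multi_idx_add[of f n 1 1] by (simp add: sum_multi_idx_1 numeral_2_eq_2)

lemma basic_Part:
  "{} \<in> Part 0 0" "id_ptn \<in> Part 1 1" "up_up_star_ptn \<in> Part 1 1" "pair_ptn \<in> Part 0 2"
  "up_up_ptn \<in> Part 0 2" "up_ptn \<in> Part 0 1"
  unfolding Part_def id_ptn_def up_up_star_ptn_def pair_ptn_def up_ptn_def mem_Collect_eq points_def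
  by (rule partition_onI; auto simp: disjnt_def lessThan_2)+

lemma delta_basic:
  "delta {} i j = 1"
  "delta id_ptn i j = (if i ! 0 = j ! 0 then 1 else 0)"
  "delta up_up_star_ptn i j = 1"
  "delta pair_ptn i j = (if j ! 0 = j ! 1 then 1 else 0)"
  "delta up_up_ptn i j = 1"
  by (auto simp: delta_def id_ptn_def up_up_star_ptn_def pair_ptn_def)

text \<open>
  The identity morphism of the object \<open>k\<close>.
\<close>

primrec id_pow :: "nat \<Rightarrow> ptn" where
  "id_pow 0 = {}"
| "id_pow (Suc k) = ptensor k k (id_pow k) id_ptn"

lemma id_pow_Part: "id_pow k \<in> Part k k"
proof (induction k)
  case (Suc k)
  then show ?case using ptensor_Part[OF Suc basic_Part(2)] by simp
qed (simp add: basic_Part)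

lemma delta_id_pow:
  "i \<in> multi_idx n k \<Longrightarrow> j \<in> multi_idx n k \<Longrightarrow> delta (id_pow k) i j = (if i = j then 1 else 0)"
proof (induction k arbitrary: i j)
  case 0
  then show ?case by (simp add: delta_basic)
next
  case (Suc k)
  obtain i1 i2 where i: "i = i1 @ i2" "i1 \<in> multi_idx n k" "i2 \<in> multi_idx n 1"
    using multi_idx_split[of i n k 1] Suc.prems(1) by auto
  obtain j1 j2 where j: "j = j1 @ j2" "j1 \<in> multi_idx n k" "j2 \<in> multi_idx n 1"
    using multi_idx_split[of j n k 1] Suc.prems(2) by auto
  obtain a b where ab: "i2 = [a]" "j2 = [b]" using i(3) j(3) by (auto simp: multi_idx_1)
  show ?case
    using i(2) j(2) by (simp add: i(1) j(1) ab delta_ptensor[OF id_pow_Part i(2) j(2)] delta_basic Suc.IH)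
qed

lemma
  assumes p: "p \<in> Part k l"
  shows pcomp_id_left: "pcomp (id_pow l) p = p" (is ?A) and loops_id_left: "loops (id_pow l) p = 0" (is ?B)
proof -
  have eq: "of_nat n ^ loops (id_pow l) p * delta (pcomp (id_pow l) p) i j = of_nat n ^ 0 * delta p i j"
    if i: "i \<in> multi_idx n k" and j: "j \<in> multi_idx n l" for n i j
  proof -
    have "of_nat n ^ loops (id_pow l) p * delta (pcomp (id_pow l) p) i j =
        (\<Sum>a\<in>multi_idx n l. (if a = j then delta p i a else 0))"
      unfolding delta_pcomp[OF p id_pow_Part i j, symmetric]
      by (intro sum.cong refl) (simp add: delta_id_pow[OF _ j])
    also have "\<dots> = delta p i j" using j by simp
    finally show ?thesis by simp
  qed
  note P = pcomp_Part[OF p id_pow_Part] p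
  show ?A by (rule delta_unique(1)[OF P eq])
  show ?B by (rule delta_unique(2)[OF P eq])
qed

lemma
  assumes p: "p \<in> Part k l"
  shows pcomp_id_right: "pcomp p (id_pow k) = p" (is ?A) and loops_id_right: "loops p (id_pow k) = 0" (is ?B)
proof -
  have eq: "of_nat n ^ loops p (id_pow k) * delta (pcomp p (id_pow k)) i j = of_nat n ^ 0 * delta p i j"
    if i: "i \<in> multi_idx n k" and j: "j \<in> multi_idx n l" for n i j
  proof -
    have "of_nat n ^ loops p (id_pow k) * delta (pcomp p (id_pow k)) i j =
        (\<Sum>a\<in>multi_idx n k. (if i = a then delta p a j else 0))"
      unfolding delta_pcomp[OF id_pow_Part p i j, symmetric]
      by (intro sum.cong refl) (simp add: delta_id_pow[OF i])
    also have "\<dots> = delta p i j" using i by simp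
    finally show ?thesis by simp
  qed
  note P = pcomp_Part[OF id_pow_Part p] p
  show ?A by (rule delta_unique(1)[OF P eq])
  show ?B by (rule delta_unique(2)[OF P eq])
qed

lemma lcomp_id_left: "f \<in> Plin k l \<Longrightarrow> lcomp N (basis (id_pow l)) f = f"
  by (induction rule: Plin_induct) (simp_all add: lcomp_basis pcomp_id_left loops_id_left)

lemma lcomp_id_right: "f \<in> Plin k l \<Longrightarrow> lcomp N f (basis (id_pow k)) = f"
  by (induction rule: Plin_induct) (simp_all add: lcomp_basis pcomp_id_right loops_id_right)

lemma id_pow_1: "id_pow (Suc 0) = id_ptn" "id_pow 1 = id_ptn"
  by simp_all

lemma tau_expand: "tau N = basis id_ptn + scale (- (2 / of_nat N)) (basis up_up_star_ptn)"
  by (simp add: tau_def minus_eq_add_scale)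

lemma tau_Plin: "tau N \<in> Plin 1 1"
  unfolding tau_expand by (intro Plin_add Plin_scale) (simp_all add: basic_Part del: One_nat_def)

lemma
  shows pcomp_up_up_star: "pcomp up_up_star_ptn up_up_star_ptn = up_up_star_ptn" (is ?A)
    and loops_up_up_star: "loops up_up_star_ptn up_up_star_ptn = 1" (is ?B)
proof -
  note U = basic_Part(3)
  have eq: "of_nat n ^ loops up_up_star_ptn up_up_star_ptn * delta (pcomp up_up_star_ptn up_up_star_ptn) i j =
      of_nat n ^ 1 * delta up_up_star_ptn i j"
    if "i \<in> multi_idx n 1" "j \<in> multi_idx n 1" for n i j
    unfolding delta_pcomp[OF U U that, symmetric] by (simp add: delta_basic card_multi_idx_1)
  show ?A by (rule delta_unique(1)[OF pcomp_Part[OF U U] U eq])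
  show ?B by (rule delta_unique(2)[OF pcomp_Part[OF U U] U eq])
qed

lemma scale_combine: "scale a f + scale b f = scale (a + b) f" "f + scale b f = scale (1 + b) f"
  "scale a f + (scale b f + g) = scale (a + b) f + g"
  by (simp_all add: scale_add_left)

text \<open>
  The partition \<open>P\<close> with two singleton blocks satisfies \<open>P P = N P\<close> because of the loop in the middle, so
  \<open>(1 - 2/N P)\<^sup>2 = 1 - 4/N P + 4/N\<^sup>2 N P = 1\<close>.
\<close>

lemma lcomp_tau_tau:
  assumes "N \<ge> 1"
  shows "lcomp N (tau N) (tau N) = basis id_ptn"
proof -
  have "lcomp N (basis id_ptn) (basis id_ptn) = basis id_ptn"
    "lcomp N (basis id_ptn) (basis up_up_star_ptn) = basis up_up_star_ptn"
    "lcomp N (basis up_up_star_ptn) (basis id_ptn) = basis up_up_star_ptn"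
    using lcomp_id_left[of "basis id_ptn" 1 1 N] lcomp_id_left[of "basis up_up_star_ptn" 1 1 N]
      lcomp_id_right[of "basis up_up_star_ptn" 1 1 N] basic_Part
    by (simp_all del: One_nat_def add: id_pow_1)
  moreover have "lcomp N (basis up_up_star_ptn) (basis up_up_star_ptn) = scale (of_nat N) (basis up_up_star_ptn)"
    by (simp add: lcomp_basis pcomp_up_up_star loops_up_up_star)
  ultimately show ?thesis
    using assms by (simp add: tau_expand scale_combine add.assoc power2_eq_square field_simps)
qed

lemma pstar_basic: "pstar id_ptn = id_ptn" "pstar up_up_star_ptn = up_up_star_ptn" "pstar {} = {}"
  by (auto simp: pstar_def id_ptn_def up_up_star_ptn_def)

lemma lstar_tau: "lstar (tau N) = tau N"
  by (simp add: tau_expand lstar_basis pstar_basic)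

lemma tau_pow_Plin: "tau_pow N k \<in> Plin k k"
proof (induction k)
  case (Suc k)
  then show ?case using ltensor_Plin[OF Suc tau_Plin] by simp
qed (simp add: basic_Part)

lemma lcomp_tau_pow:
  assumes "N \<ge> 1"
  shows "lcomp N (tau_pow N k) (tau_pow N k) = basis (id_pow k)"
proof (induction k)
  case 0
  show ?case using lcomp_id_left[of "basis {}" 0 0 N] basic_Part(1) by simp
next
  case (Suc k)
  show ?case
    by (simp add: lcomp_ltensor[OF tau_pow_Plin tau_pow_Plin tau_Plin tau_Plin] Suc lcomp_tau_tau[OF assms]
        ltensor_basis)
qed

lemma lstar_tau_pow: "lstar (tau_pow N k) = tau_pow N k"
proof (induction k)
  case (Suc k)
  then show ?case by (simp add: lstar_ltensor[OF tau_pow_Plin tau_Plin] lstar_tau)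
qed (simp add: lstar_basis pstar_basic)

lemma ltensor_empty: "f \<in> Plin k l \<Longrightarrow> ltensor k l f (basis {}) = f" 
  by (induction rule: Plin_induct) (simp_all add: ltensor_basis)

lemma ltensor_empty_left: "f \<in> Plin k l \<Longrightarrow> ltensor 0 0 (basis {}) f = f"
  by (induction rule: Plin_induct) (simp_all add: ltensor_basis)

lemma tau_pow_add: "tau_pow N (k + l) = ltensor k k (tau_pow N k) (tau_pow N l)"
proof (induction l)
  case 0
  show ?case by (simp add: ltensor_empty[OF tau_pow_Plin])
next
  case (Suc l)
  then show ?case by (simp add: ltensor_assoc[OF tau_pow_Plin tau_pow_Plin tau_Plin])
qed

lemma calT_Plin: "f \<in> Plin k l \<Longrightarrow> calT N k l f \<in> Plin k l"
  unfolding calT_def by (intro lcomp_Plin[of _ k l] lcomp_Plin[of _ k k] tau_pow_Plin)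

lemma calT_add: "calT N k l (f + g) = calT N k l f + calT N k l g"
  by (simp add: calT_def)

lemma calT_scale: "calT N k l (scale c f) = scale c (calT N k l f)"
  by (simp add: calT_def)

text \<open>
  The two inner tensor powers of \<open>tau\<close> cancel.
\<close>

lemma calT_lcomp:
  assumes N: "N \<ge> 1" and f: "f \<in> Plin k l" and g: "g \<in> Plin l m"
  shows "calT N k m (lcomp N g f) = lcomp N (calT N l m g) (calT N k l f)"
proof -
  let ?K = "tau_pow N k" and ?L = "tau_pow N l" and ?M = "tau_pow N m"
  note K = tau_pow_Plin[of N k] and L = tau_pow_Plin[of N l] and M = tau_pow_Plin[of N m]
  note fK = lcomp_Plin[OF K f, of N] and gL = lcomp_Plin[OF L g, of N]
  note LfK = lcomp_Plin[OF fK L, of N]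
  have "lcomp N (lcomp N ?M (lcomp N g ?L)) (lcomp N ?L (lcomp N f ?K)) =
      lcomp N ?M (lcomp N (lcomp N g ?L) (lcomp N ?L (lcomp N f ?K)))"
    by (rule lcomp_assoc[OF LfK gL M, symmetric])
  also have "lcomp N (lcomp N g ?L) (lcomp N ?L (lcomp N f ?K)) = lcomp N g (lcomp N ?L (lcomp N ?L (lcomp N f ?K)))"
    by (rule lcomp_assoc[OF LfK L g, symmetric])
  also have "lcomp N ?L (lcomp N ?L (lcomp N f ?K)) = lcomp N (lcomp N ?L ?L) (lcomp N f ?K)"
    by (rule lcomp_assoc[OF fK L L])
  also have "\<dots> = lcomp N f ?K"
    by (simp add: lcomp_tau_pow[OF N] lcomp_id_left[OF fK])
  also have "lcomp N g (lcomp N f ?K) = lcomp N (lcomp N g f) ?K"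
    by (rule lcomp_assoc[OF K f g])
  finally show ?thesis by (simp add: calT_def)
qed

lemma calT_calT:
  assumes N: "N \<ge> 1" and f: "f \<in> Plin k l"
  shows "calT N k l (calT N k l f) = f"
proof -
  let ?K = "tau_pow N k" and ?L = "tau_pow N l"
  note K = tau_pow_Plin[of N k] and L = tau_pow_Plin[of N l]
  note fK = lcomp_Plin[OF K f, of N]
  have "lcomp N (lcomp N ?L (lcomp N f ?K)) ?K = lcomp N ?L (lcomp N (lcomp N f ?K) ?K)"
    by (rule lcomp_assoc[OF K fK L, symmetric])
  also have "lcomp N (lcomp N f ?K) ?K = f"
    using lcomp_assoc[OF K K f, of N] by (simp add: lcomp_tau_pow[OF N] lcomp_id_right[OF f])
  finally show ?thesis
    using lcomp_assoc[OF f L L, of N] by (simp add: calT_def lcomp_tau_pow[OF N] lcomp_id_left[OF f])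
qed

lemma calT_ltensor:
  assumes f: "f \<in> Plin k l" and g: "g \<in> Plin k' l'"
  shows "calT N (k + k') (l + l') (ltensor k l f g) = ltensor k l (calT N k l f) (calT N k' l' g)"
  unfolding calT_def tau_pow_add
  by (simp add: lcomp_ltensor[OF tau_pow_Plin f tau_pow_Plin g]
      lcomp_ltensor[OF lcomp_Plin[OF tau_pow_Plin f] tau_pow_Plin lcomp_Plin[OF tau_pow_Plin g] tau_pow_Plin])

lemma calT_lstar:
  assumes f: "f \<in> Plin k l"
  shows "calT N l k (lstar f) = lstar (calT N k l f)"
proof -
  note K = tau_pow_Plin[of N k] and L = tau_pow_Plin[of N l]
  have "lstar (calT N k l f) = lcomp N (lcomp N (tau_pow N k) (lstar f)) (tau_pow N l)"
    by (simp add: calT_def lstar_lcomp[OF lcomp_Plin[OF K f] L] lstar_lcomp[OF K f] lstar_tau_pow)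
  also have "\<dots> = calT N l k (lstar f)"
    unfolding calT_def by (rule lcomp_assoc[OF L lstar_Plin[OF f] K, symmetric])
  finally show ?thesis by simp
qed

lemma calT_id:
  assumes N: "N \<ge> 1"
  shows "calT N 1 1 (basis id_ptn) = basis id_ptn"
proof -
  have "lcomp N (basis id_ptn) (tau_pow N 1) = tau_pow N 1"
    using lcomp_id_left[OF tau_pow_Plin[of N 1], of N] by simp
  then show ?thesis using lcomp_tau_pow[OF N, of 1] by (simp add: calT_def)
qed

text \<open>
  The uniqueness of partitions applied to composites with a middle row of two points.
\<close>

lemma
  assumes p: "p \<in> Part 0 2" and q: "q \<in> Part 2 2" and r: "r \<in> Part 0 2"
    and eq: "\<And>n b c. b < n \<Longrightarrow> c < n \<Longrightarrow>
      (\<Sum>x<n. \<Sum>y<n. delta q [x, y] [b, c] * delta p [] [x, y]) = of_nat n ^ e * delta r [] [b, c]"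
  shows pcomp_pairI: "pcomp q p = r" (is ?A) and loops_pairI: "loops q p = e" (is ?B)
proof -
  have eq': "of_nat n ^ loops q p * delta (pcomp q p) i j = of_nat n ^ e * delta r i j"
    if i: "i \<in> multi_idx n 0" and j: "j \<in> multi_idx n 2" for n i j
  proof -
    obtain b c where "j = [b, c]" "b < n" "c < n"
      using j by (auto simp: multi_idx_def length_Suc_conv numeral_2_eq_2)
    then show ?thesis
      using i eq[of b n c] unfolding delta_pcomp[OF p q i j, symmetric]
      by (simp add: sum_multi_idx_2)
  qed
  show ?A by (rule delta_unique(1)[OF pcomp_Part[OF p q] r eq'])
  show ?B by (rule delta_unique(2)[OF pcomp_Part[OF p q] r eq'])
qed

text \<open>
  The pair partition stands for the standard bilinear form, which is invariant under the orthogonal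
  matrix of \<open>tau\<close>. In terms of partitions, \<open>(tau \<otimes> tau) \<sqinter>\<close> has four terms. Three of them are multiples of
  two singletons, with coefficients \<open>- 2/N\<close>, \<open>- 2/N\<close> and, because of a loop, \<open>4/N\<^sup>2 N\<close>; they cancel.
\<close>

lemma calT_pair:
  assumes N: "N \<ge> 1"
  shows "calT N 0 2 (basis pair_ptn) = basis pair_ptn"
proof -
  let ?i = "id_ptn" and ?u = "up_up_star_ptn"
  have P: "ptensor 1 1 ?i ?i \<in> Part 2 2" "ptensor 1 1 ?i ?u \<in> Part 2 2" "ptensor 1 1 ?u ?i \<in> Part 2 2"
    "ptensor 1 1 ?u ?u \<in> Part 2 2"
    using ptensor_Part[OF basic_Part(2,2)] ptensor_Part[OF basic_Part(2,3)] ptensor_Part[OF basic_Part(3,2)]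
      ptensor_Part[OF basic_Part(3,3)] by (simp_all add: numeral_2_eq_2)
  have eq: "(\<Sum>x<n. \<Sum>y<n. delta (ptensor 1 1 p q) [x, y] [b, c] * delta pair_ptn [] [x, y]) =
      (\<Sum>x<n. delta p [x] [b] * delta q [x] [c])" if p: "p \<in> Part 1 1" and "b < n" for p q b c n
  proof (rule sum.cong[OF refl])
    fix x assume "x \<in> {..<n}"
    then have "delta (ptensor 1 1 p q) [x, y] [b, c] = delta p [x] [b] * delta q [y] [c]" for y
      using delta_ptensor[OF p, of "[x]" n "[b]" q "[y]" "[c]"] \<open>b < n\<close> by (simp add: multi_idx_1)
    then show "(\<Sum>y<n. delta (ptensor 1 1 p q) [x, y] [b, c] * delta pair_ptn [] [x, y]) =
        delta p [x] [b] * delta q [x] [c]"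
      using \<open>x \<in> {..<n}\<close> by (simp add: delta_basic if_distrib cong: if_cong)
  qed
  note eq1 = eq[OF basic_Part(2)] and eq2 = eq[OF basic_Part(3)]
  have ii: "(\<Sum>x<n. \<Sum>y<n. delta (ptensor 1 1 ?i ?i) [x, y] [b, c] * delta pair_ptn [] [x, y]) = of_nat n ^ 0 * delta pair_ptn [] [b, c]" if "b < n" "c < n" for n b c :: nat
    using that by (subst eq1) (simp_all add: delta_basic delta_basic(5)[simplified] if_distrib[of "\<lambda>x. x * _"] cong: if_cong)
  have iu: "(\<Sum>x<n. \<Sum>y<n. delta (ptensor 1 1 ?i ?u) [x, y] [b, c] * delta pair_ptn [] [x, y]) = of_nat n ^ 0 * delta up_up_ptn [] [b, c]" if "b < n" "c < n" for n b c :: nat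
    using that by (subst eq1) (simp_all add: delta_basic delta_basic(5)[simplified] if_distrib[of "\<lambda>x. x * _"] cong: if_cong)
  have ui: "(\<Sum>x<n. \<Sum>y<n. delta (ptensor 1 1 ?u ?i) [x, y] [b, c] * delta pair_ptn [] [x, y]) = of_nat n ^ 0 * delta up_up_ptn [] [b, c]" if "b < n" "c < n" for n b c :: nat
    using that by (subst eq2) (simp_all add: delta_basic delta_basic(5)[simplified] if_distrib[of "\<lambda>x. x * _"] cong: if_cong)
  have uu: "(\<Sum>x<n. \<Sum>y<n. delta (ptensor 1 1 ?u ?u) [x, y] [b, c] * delta pair_ptn [] [x, y]) = of_nat n ^ 1 * delta up_up_ptn [] [b, c]" if "b < n" "c < n" for n b c :: nat
    using that by (subst eq2) (simp_all add: delta_basic delta_basic(5)[simplified] if_distrib[of "\<lambda>x. x * _"] cong: if_cong)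
  note pair = basic_Part(4) and upup = basic_Part(5)
  note pc = pcomp_pairI[OF pair P(1) pair ii] pcomp_pairI[OF pair P(2) upup iu]
    pcomp_pairI[OF pair P(3) upup ui] pcomp_pairI[OF pair P(4) upup uu]
  note lp = loops_pairI[OF pair P(1) pair ii] loops_pairI[OF pair P(2) upup iu]
    loops_pairI[OF pair P(3) upup ui] loops_pairI[OF pair P(4) upup uu]
  have "lcomp N (tau_pow N 2) (basis pair_ptn) = basis pair_ptn"
    using N by (simp add: numeral_2_eq_2 ltensor_empty_left[OF tau_Plin] tau_expand ltensor_basis lcomp_basis
        pc[simplified] lp[simplified] scale_combine add.assoc)
  moreover have "lcomp N (basis pair_ptn) (tau_pow N 0) = basis pair_ptn"
    using lcomp_id_right[of "basis pair_ptn" 0 2 N] basic_Part(4) by simp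
  ultimately show ?thesis by (simp add: calT_def)
qed

lemma linear_categoryD:
  assumes "linear_category N K"
  shows "K k l \<subseteq> Plin k l" "0 \<in> K k l" "f \<in> K k l \<Longrightarrow> g \<in> K k l \<Longrightarrow> f + g \<in> K k l"
    "f \<in> K k l \<Longrightarrow> scale c f \<in> K k l" "basis id_ptn \<in> K 1 1" "basis pair_ptn \<in> K 0 2"
    "f \<in> K k l \<Longrightarrow> g \<in> K k' l' \<Longrightarrow> ltensor k l f g \<in> K (k + k') (l + l')"
    "f \<in> K k l \<Longrightarrow> g \<in> K l m \<Longrightarrow> lcomp N g f \<in> K k m"
    "f \<in> K k l \<Longrightarrow> lstar f \<in> K l k"
  using assms by (auto simp: linear_category_def)

theorem linear_category_calT:
  assumes N: "N \<ge> 1" and K: "linear_category N K"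
  shows "linear_category N (calT_family N K)"
proof -
  note KD = linear_categoryD[OF K]
  have KP: "f \<in> Plin k l" if "f \<in> K k l" for f k l using KD(1) that by blast
  have mem: "calT N k l f \<in> calT_family N K k l" if "f \<in> K k l" for f k l
    using that by (simp add: calT_family_def)
  have ex: "\<exists>f'\<in>K k l. f = calT N k l f'" if "f \<in> calT_family N K k l" for f k l
    using that by (auto simp: calT_family_def)
  show ?thesis
    unfolding linear_category_def
  proof (intro conjI allI ballI)
    fix k l
    show "calT_family N K k l \<subseteq> Plin k l" by (auto simp: calT_family_def intro: calT_Plin KP)
    show "0 \<in> calT_family N K k l" using mem[OF KD(2)[of k l]] by (simp add: calT_def)
    fix f assume f: "f \<in> calT_family N K k l"
    obtain f' where f': "f' \<in> K k l" "f = calT N k l f'" using ex[OF f] by blast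
    show "scale c f \<in> calT_family N K k l" for c
      using mem[OF KD(4)[OF f'(1)]] by (simp add: calT_scale f'(2))
    show "lstar f \<in> calT_family N K l k"
      using mem[OF KD(9)[OF f'(1)]] by (simp add: calT_lstar[OF KP[OF f'(1)]] f'(2))
    { fix g assume "g \<in> calT_family N K k l"
      then obtain g' where g': "g' \<in> K k l" "g = calT N k l g'" using ex by blast
      show "f + g \<in> calT_family N K k l"
        using mem[OF KD(3)[OF f'(1) g'(1)]] by (simp add: calT_add f'(2) g'(2)) }
    { fix k' l' g assume "g \<in> calT_family N K k' l'"
      then obtain g' where g': "g' \<in> K k' l'" "g = calT N k' l' g'" using ex by blast
      show "ltensor k l f g \<in> calT_family N K (k + k') (l + l')"
        using mem[OF KD(7)[OF f'(1) g'(1)]] by (simp add: calT_ltensor[OF KP[OF f'(1)] KP[OF g'(1)]] f'(2) g'(2)) }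
    { fix m g assume "g \<in> calT_family N K l m"
      then obtain g' where g': "g' \<in> K l m" "g = calT N l m g'" using ex by blast
      show "lcomp N g f \<in> calT_family N K k m"
        using mem[OF KD(8)[OF f'(1) g'(1)]] by (simp add: calT_lcomp[OF N KP[OF f'(1)] KP[OF g'(1)]] f'(2) g'(2)) }
  next
    show "basis id_ptn \<in> calT_family N K 1 1" using mem[OF KD(5)] by (simp only: calT_id[OF N])
    show "basis pair_ptn \<in> calT_family N K 0 2" using mem[OF KD(6)] by (simp only: calT_pair[OF N])
  qed
qed

text \<open>
  \<open>calT\<close> is conjugation by an involution, hence its own inverse.
\<close>

theorem monoidal_star_iso_calT:
  assumes N: "N \<ge> 1" and K: "linear_category N K"
  shows "monoidal_star_iso N (calT N) K (calT_family N K)"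
proof -
  have KP: "f \<in> Plin k l" if "f \<in> K k l" for f k l using linear_categoryD(1)[OF K] that by blast
  have "inj_on (calT N k l) (K k l)" for k l
    by (rule inj_on_inverseI[where g = "calT N k l"]) (simp add: calT_calT[OF N KP])
  then have "bij_betw (calT N k l) (K k l) (calT_family N K k l)" for k l
    by (simp add: bij_betw_def calT_family_def)
  then show ?thesis
    unfolding monoidal_star_iso_def
    by (intro conjI allI ballI calT_add calT_scale calT_ltensor calT_lcomp[OF N] calT_lstar KP) auto
qed

section \<open>Matrices over a C*-algebra and scalar matrices\<close>

lemma smult_simps:
  "carrier complex_ring = UNIV" "add complex_ring = (+)" "monoid.mult complex_ring = (*)"
  "one complex_ring = 1" "zero complex_ring = 0"
  by (simp_all add: complex_ring_def)

context cstar_algebra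
begin

lemma smult_closed [simp]: "x \<in> carrier A \<Longrightarrow> c \<odot> x \<in> carrier A"
  using module.smult_closed[OF complex_module] by (simp add: smult_simps)

lemma smult_add_left: "x \<in> carrier A \<Longrightarrow> (c + d) \<odot> x = c \<odot> x \<oplus> d \<odot> x"
  using module.smult_l_distr[OF complex_module] by (simp add: smult_simps)

lemma smult_add_right: "x \<in> carrier A \<Longrightarrow> y \<in> carrier A \<Longrightarrow> c \<odot> (x \<oplus> y) = c \<odot> x \<oplus> c \<odot> y"
  using module.smult_r_distr[OF complex_module] by (simp add: smult_simps)

lemma smult_smult: "x \<in> carrier A \<Longrightarrow> c \<odot> (d \<odot> x) = (c * d) \<odot> x"
  using module.smult_assoc1[OF complex_module, of c d x] by (simp add: smult_simps)

lemma smult_1 [simp]: "x \<in> carrier A \<Longrightarrow> 1 \<odot> x = x"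
  using module.smult_one[OF complex_module, of x] by (simp add: smult_simps)

lemma smult_0 [simp]: "x \<in> carrier A \<Longrightarrow> 0 \<odot> x = \<zero>"
  using module.smult_l_null[OF complex_module, of x] by (simp add: smult_simps)

lemma smult_zero [simp]: "c \<odot> \<zero> = \<zero>"
  using module.smult_r_null[OF complex_module, of c] by (simp add: smult_simps)

lemma smult_minus_1: "x \<in> carrier A \<Longrightarrow> \<ominus> x = (- 1) \<odot> x"
  using smult_add_left[of x "- 1" 1] by (intro minus_equality) simp_all

lemma adj_zero [simp]: "adj A \<zero> = \<zero>"
  using adj_smult[of \<zero> 0] adj_closed[of \<zero>] by simp

lemma adj_one [simp]: "adj A \<one> = \<one>"
proof -
  have "adj A (adj A \<one> \<otimes> \<one>) = \<one>" using adj_mult[of "adj A \<one>" \<one>] adj_closed[of \<one>] adj_adj[of \<one>] by simp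
  moreover have "adj A \<one> \<otimes> \<one> = adj A \<one>" using adj_closed[of \<one>] by simp
  ultimately show ?thesis using adj_mult[of \<one> "adj A \<one>"] adj_closed[of \<one>] adj_adj[of \<one>]
    by (metis l_one one_closed r_one)
qed

end

definition lin_map :: "'a cstar \<Rightarrow> 'b cstar \<Rightarrow> ('a \<Rightarrow> 'b) \<Rightarrow> bool" where
  "lin_map A B h \<longleftrightarrow> h \<in> carrier A \<rightarrow> carrier B \<and>
     (\<forall>x\<in>carrier A. \<forall>y\<in>carrier A. h (x \<oplus>\<^bsub>A\<^esub> y) = h x \<oplus>\<^bsub>B\<^esub> h y) \<and>
     (\<forall>c. \<forall>x\<in>carrier A. h (c \<odot>\<^bsub>A\<^esub> x) = c \<odot>\<^bsub>B\<^esub> h x)"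

lemma lin_map_finsum:
  assumes A: "cstar_algebra A" and B: "cstar_algebra B" and h: "lin_map A B h"
    and f: "f \<in> I \<rightarrow> carrier A"
  shows "h (\<Oplus>\<^bsub>A\<^esub>i\<in>I. f i) = (\<Oplus>\<^bsub>B\<^esub>i\<in>I. h (f i))"
proof -
  interpret A: cstar_algebra A by fact
  interpret B: cstar_algebra B by fact
  have "h (0 \<odot>\<^bsub>A\<^esub> \<zero>\<^bsub>A\<^esub>) = 0 \<odot>\<^bsub>B\<^esub> h \<zero>\<^bsub>A\<^esub>" using h unfolding lin_map_def by blast
  moreover have hc: "h x \<in> carrier B" if "x \<in> carrier A" for x using h that by (auto simp: lin_map_def)
  ultimately have h0: "h \<zero>\<^bsub>A\<^esub> = \<zero>\<^bsub>B\<^esub>" by simp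
  show ?thesis
    using f
  proof (induction I rule: infinite_finite_induct)
    case (infinite I)
    then show ?case by (simp add: A.finsum_infinite B.finsum_infinite h0)
  next
    case (insert i I)
    then have "h (f i \<oplus>\<^bsub>A\<^esub> (\<Oplus>\<^bsub>A\<^esub>i\<in>I. f i)) = h (f i) \<oplus>\<^bsub>B\<^esub> h (\<Oplus>\<^bsub>A\<^esub>i\<in>I. f i)"
      using h unfolding lin_map_def by (auto intro!: A.finsum_closed)
    then show ?case using insert hc by (subst A.finsum_insert, simp_all)+ (auto simp: Pi_def)
  qed (simp add: h0)
qed

context cstar_algebra
begin

lemma lin_map_smult: "lin_map A A (\<lambda>x. c \<odot> x)"
  unfolding lin_map_def by (auto simp: smult_add_right smult_smult mult.commute)

lemma smult_finsum:
  "f \<in> I \<rightarrow> carrier A \<Longrightarrow> c \<odot> (\<Oplus>i\<in>I. f i) = (\<Oplus>i\<in>I. c \<odot> f i)"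
  by (rule lin_map_finsum[OF cstar_algebra_axioms cstar_algebra_axioms lin_map_smult])

lemma finsum_swap:
  assumes "finite I" "finite J" "\<And>i j. i \<in> I \<Longrightarrow> j \<in> J \<Longrightarrow> f i j \<in> carrier A"
  shows "(\<Oplus>i\<in>I. \<Oplus>j\<in>J. f i j) = (\<Oplus>j\<in>J. \<Oplus>i\<in>I. f i j)"
  using assms(1,3)
proof (induction I rule: finite_induct)
  case empty
  then show ?case by (simp add: finsum_zero)
next
  case (insert i I)
  have 1: "(\<lambda>j. f i j) \<in> J \<rightarrow> carrier A" "(\<lambda>j. \<Oplus>i\<in>I. f i j) \<in> J \<rightarrow> carrier A"
    "(\<lambda>i. \<Oplus>j\<in>J. f i j) \<in> I \<rightarrow> carrier A"
    using insert by (auto intro!: finsum_closed)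
  have "(\<Oplus>i\<in>insert i I. \<Oplus>j\<in>J. f i j) = (\<Oplus>j\<in>J. f i j) \<oplus> (\<Oplus>j\<in>J. \<Oplus>i\<in>I. f i j)"
    using insert 1 by (subst finsum_insert) (auto intro!: finsum_closed)
  also have "\<dots> = (\<Oplus>j\<in>J. f i j \<oplus> (\<Oplus>i\<in>I. f i j))"
    using 1 by (simp add: finsum_addf)
  also have "\<dots> = (\<Oplus>j\<in>J. \<Oplus>i\<in>insert i I. f i j)"
    using insert by (intro finsum_cong') (auto simp: finsum_insert intro!: finsum_closed)
  finally show ?case .
qed

lemma sum_smult:
  assumes "x \<in> carrier A" "finite I"
  shows "(\<Sum>i\<in>I. c i) \<odot> x = (\<Oplus>i\<in>I. c i \<odot> x)"
  using assms(2) by (induction I rule: finite_induct) (use assms(1) in \<open>auto simp: smult_add_left finsum_insert\<close>)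

lemma finsum_delta:
  assumes "finite I" "i \<in> I" "f \<in> I \<rightarrow> carrier A"
  shows "(\<Oplus>j\<in>I. (if i = j then 1 else 0) \<odot> f j) = f i"
proof -
  have "(\<Oplus>j\<in>I. (if i = j then 1 else 0) \<odot> f j) = (\<Oplus>j\<in>I. if i = j then f j else \<zero>)"
    using assms by (intro finsum_cong') (auto simp: Pi_iff)
  also have "\<dots> = f i" by (rule finsum_singleton[OF assms(2,1,3)])
  finally show ?thesis .
qed

text \<open>
  The product of a scalar matrix and a matrix over the algebra, in either order. The index sets are
  arbitrary: they are intervals for a fundamental representation and sets of multi-indices for its
  tensor powers.
\<close>

definition lmul :: "'i set \<Rightarrow> ('h \<Rightarrow> 'i \<Rightarrow> complex) \<Rightarrow> ('i \<Rightarrow> 'j \<Rightarrow> 'a) \<Rightarrow> 'h \<Rightarrow> 'j \<Rightarrow> 'a" where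
  "lmul I T u i j = (\<Oplus>a\<in>I. T i a \<odot> u a j)"

definition rmul :: "'i set \<Rightarrow> ('h \<Rightarrow> 'i \<Rightarrow> 'a) \<Rightarrow> ('i \<Rightarrow> 'j \<Rightarrow> complex) \<Rightarrow> 'h \<Rightarrow> 'j \<Rightarrow> 'a" where
  "rmul I u T i j = (\<Oplus>b\<in>I. T b j \<odot> u i b)"

lemma lmul_closed [simp]: "(\<And>a. a \<in> I \<Longrightarrow> u a j \<in> carrier A) \<Longrightarrow> lmul I T u i j \<in> carrier A"
  unfolding lmul_def by (auto intro!: finsum_closed)

lemma rmul_closed [simp]: "(\<And>a. a \<in> I \<Longrightarrow> u i a \<in> carrier A) \<Longrightarrow> rmul I u T i j \<in> carrier A"
  unfolding rmul_def by (auto intro!: finsum_closed)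

lemma lmul_cong:
  assumes "\<And>a. a \<in> I \<Longrightarrow> T i a = T' i a" "\<And>a. a \<in> I \<Longrightarrow> u a j = u' a j" "\<And>a. a \<in> I \<Longrightarrow> u' a j \<in> carrier A"
  shows "lmul I T u i j = lmul I T' u' i j"
  unfolding lmul_def using assms by (intro finsum_cong') auto

lemma rmul_cong:
  assumes "\<And>a. a \<in> I \<Longrightarrow> T a j = T' a j" "\<And>a. a \<in> I \<Longrightarrow> u i a = u' i a" "\<And>a. a \<in> I \<Longrightarrow> u' i a \<in> carrier A"
  shows "rmul I u T i j = rmul I u' T' i j"
  unfolding rmul_def using assms by (intro finsum_cong') auto

lemma lin_comb_assoc:
  assumes "finite I" "finite J" "\<And>j. j \<in> J \<Longrightarrow> x j \<in> carrier A"
  shows "(\<Oplus>i\<in>I. c i \<odot> (\<Oplus>j\<in>J. d i j \<odot> x j)) = (\<Oplus>j\<in>J. (\<Sum>i\<in>I. c i * d i j) \<odot> x j)"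
proof -
  have "(\<Oplus>i\<in>I. c i \<odot> (\<Oplus>j\<in>J. d i j \<odot> x j)) = (\<Oplus>i\<in>I. \<Oplus>j\<in>J. (c i * d i j) \<odot> x j)"
    using assms by (intro finsum_cong') (auto simp: smult_finsum smult_smult intro!: finsum_closed finsum_cong')
  also have "\<dots> = (\<Oplus>j\<in>J. \<Oplus>i\<in>I. (c i * d i j) \<odot> x j)"
    using assms by (intro finsum_swap) auto
  also have "\<dots> = (\<Oplus>j\<in>J. (\<Sum>i\<in>I. c i * d i j) \<odot> x j)"
    using assms by (intro finsum_cong') (auto simp: sum_smult)
  finally show ?thesis .
qed

lemma lmul_lmul:
  assumes "finite I" "finite J" "\<And>a. a \<in> J \<Longrightarrow> u a j \<in> carrier A"
  shows "lmul I T (lmul J S u) i j = lmul J (\<lambda>i a. \<Sum>b\<in>I. T i b * S b a) u i j"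
  unfolding lmul_def by (rule lin_comb_assoc[OF assms])

lemma rmul_rmul:
  assumes "finite I" "finite J" "\<And>a. a \<in> J \<Longrightarrow> u i a \<in> carrier A"
  shows "rmul I (rmul J u S) T i j = rmul J u (\<lambda>a j. \<Sum>b\<in>I. S a b * T b j) i j"
proof -
  have "rmul I (rmul J u S) T i j = (\<Oplus>a\<in>J. (\<Sum>b\<in>I. T b j * S a b) \<odot> u i a)"
    unfolding rmul_def by (rule lin_comb_assoc[OF assms])
  then show ?thesis by (simp add: rmul_def mult.commute)
qed

lemma lmul_rmul:
  assumes "finite I" "finite J" "\<And>a b. a \<in> I \<Longrightarrow> b \<in> J \<Longrightarrow> u a b \<in> carrier A"
  shows "lmul I T (rmul J u S) i j = rmul J (lmul I T u) S i j"
proof -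
  have "lmul I T (rmul J u S) i j = (\<Oplus>a\<in>I. \<Oplus>b\<in>J. (T i a * S b j) \<odot> u a b)"
    unfolding lmul_def rmul_def using assms
    by (intro finsum_cong') (auto simp: smult_finsum smult_smult intro!: finsum_closed finsum_cong')
  also have "\<dots> = (\<Oplus>b\<in>J. \<Oplus>a\<in>I. (T i a * S b j) \<odot> u a b)"
    using assms by (intro finsum_swap) auto
  also have "\<dots> = rmul J (lmul I T u) S i j"
    unfolding lmul_def rmul_def using assms
    by (intro finsum_cong') (auto simp: smult_finsum smult_smult mult.commute intro!: finsum_closed finsum_cong')
  finally show ?thesis .
qed

lemma lmul_id:
  assumes "finite I" "i \<in> I" "\<And>a. a \<in> I \<Longrightarrow> u a j \<in> carrier A" "\<And>a. a \<in> I \<Longrightarrow> T i a = (if i = a then 1 else 0)"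
  shows "lmul I T u i j = u i j"
proof -
  have "lmul I T u i j = (\<Oplus>a\<in>I. (if i = a then 1 else 0) \<odot> u a j)"
    unfolding lmul_def using assms by (intro finsum_cong') auto
  also have "\<dots> = u i j" using assms by (intro finsum_delta) auto
  finally show ?thesis .
qed

lemma rmul_id:
  assumes "finite I" "j \<in> I" "\<And>a. a \<in> I \<Longrightarrow> u i a \<in> carrier A" "\<And>a. a \<in> I \<Longrightarrow> T a j = (if j = a then 1 else 0)"
  shows "rmul I u T i j = u i j"
proof -
  have "rmul I u T i j = (\<Oplus>a\<in>I. (if j = a then 1 else 0) \<odot> u i a)"
    unfolding rmul_def using assms by (intro finsum_cong') auto
  also have "\<dots> = u i j" using assms by (intro finsum_delta[where f = "u i"]) auto
  finally show ?thesis .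
qed

definition conj_mat :: "'i set \<Rightarrow> ('h \<Rightarrow> 'i \<Rightarrow> complex) \<Rightarrow> ('i \<Rightarrow> 'i \<Rightarrow> 'a) \<Rightarrow> ('i \<Rightarrow> 'k \<Rightarrow> complex) \<Rightarrow> 'h \<Rightarrow> 'k \<Rightarrow> 'a" where
  "conj_mat I T u S = lmul I T (rmul I u S)"

lemma conj_mat_eq:
  assumes "finite I" "\<And>a b. a \<in> I \<Longrightarrow> b \<in> I \<Longrightarrow> u a b \<in> carrier A"
  shows "conj_mat I T u S i j = (\<Oplus>a\<in>I. \<Oplus>b\<in>I. (T i a * S b j) \<odot> u a b)"
  unfolding conj_mat_def lmul_def rmul_def using assms
  by (intro finsum_cong') (auto simp: smult_finsum smult_smult intro!: finsum_closed finsum_cong')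

lemma conj_mat_closed:
  assumes "\<And>a b. a \<in> I \<Longrightarrow> b \<in> I \<Longrightarrow> u a b \<in> carrier A"
  shows "conj_mat I T u S i j \<in> carrier A"
  unfolding conj_mat_def using assms by simp

lemma conj_mat_conj_mat:
  assumes fin: "finite I" "finite J" and u: "\<And>a b. a \<in> J \<Longrightarrow> b \<in> J \<Longrightarrow> u a b \<in> carrier A"
  shows "conj_mat I T (conj_mat J T' u S') S i j =
    conj_mat J (\<lambda>i a. \<Sum>b\<in>I. T i b * T' b a) u (\<lambda>a j. \<Sum>b\<in>I. S' a b * S b j) i j"
proof -
  let ?S = "\<lambda>a j. \<Sum>b\<in>I. S' a b * S b j"
  have "lmul I T (rmul I (lmul J T' (rmul J u S')) S) i j = lmul I T (lmul J T' (rmul I (rmul J u S') S)) i j"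
    by (rule lmul_cong) (use u fin in \<open>auto simp: lmul_rmul\<close>)
  also have "\<dots> = lmul I T (lmul J T' (rmul J u ?S)) i j"
    by (rule lmul_cong refl)+ (use u fin in \<open>auto simp: rmul_rmul\<close>)
  also have "\<dots> = lmul J (\<lambda>i a. \<Sum>b\<in>I. T i b * T' b a) (rmul J u ?S) i j"
    by (rule lmul_lmul) (use u fin in auto)
  finally show ?thesis by (simp add: conj_mat_def)
qed

lemma conj_mat_id:
  assumes "finite I" "i \<in> I" "j \<in> I" "\<And>a b. a \<in> I \<Longrightarrow> b \<in> I \<Longrightarrow> u a b \<in> carrier A"
    and "\<And>a. a \<in> I \<Longrightarrow> T i a = (if i = a then 1 else 0)" "\<And>a. a \<in> I \<Longrightarrow> S a j = (if j = a then 1 else 0)"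
  shows "conj_mat I T u S i j = u i j"
  unfolding conj_mat_def using assms by (subst lmul_id) (auto simp: rmul_id)

lemma conj_mat_cong:
  assumes "\<And>a. a \<in> I \<Longrightarrow> T i a = T' i a" "\<And>a. a \<in> I \<Longrightarrow> S a j = S' a j"
    "\<And>a b. a \<in> I \<Longrightarrow> b \<in> I \<Longrightarrow> u a b = u' a b" "\<And>a b. a \<in> I \<Longrightarrow> b \<in> I \<Longrightarrow> u' a b \<in> carrier A"
  shows "conj_mat I T u S i j = conj_mat I T' u' S' i j"
  unfolding conj_mat_def using assms by (intro lmul_cong rmul_cong) auto

end

lemma lin_map_conj_mat:
  assumes A: "cstar_algebra A" and B: "cstar_algebra B" and h: "lin_map A B h" and fin: "finite I"
    and u: "\<And>a b. a \<in> I \<Longrightarrow> b \<in> I \<Longrightarrow> u a b \<in> carrier A"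
  shows "h (cstar_algebra.conj_mat A I T u S i j) = cstar_algebra.conj_mat B I T (\<lambda>a b. h (u a b)) S i j"
proof -
  interpret A: cstar_algebra A by fact
  interpret B: cstar_algebra B by fact
  have hc: "h x \<in> carrier B" if "x \<in> carrier A" for x using h that by (auto simp: lin_map_def)
  have hs: "h (c \<odot>\<^bsub>A\<^esub> x) = c \<odot>\<^bsub>B\<^esub> h x" if "x \<in> carrier A" for c x using h that by (auto simp: lin_map_def)
  note hsum = lin_map_finsum[OF A B h]
  show ?thesis
    using u hc by (simp add: A.conj_mat_eq[OF fin u] B.conj_mat_eq[OF fin hc[OF u]])
     (subst hsum, force intro!: A.finsum_closed, intro B.finsum_cong',
      auto simp: hsum hs intro!: B.finsum_closed B.finsum_cong')
qed

text \<open>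
  The factors \<open>R\<close> and \<open>R'\<close> that meet in the middle cancel. The bilinear map \<open>t\<close> is the multiplication of
  the algebra when it comes to inverse matrices and orthogonality relations, and the map
  \<open>x, y \<mapsto> x \<otimes> y\<close> into the tensor square when it comes to the comultiplication.
\<close>

lemma (in cstar_algebra) conj_mat_mult:
  assumes B: "cstar_algebra B" and fin: "finite I"
    and t1: "\<And>y. y \<in> carrier B \<Longrightarrow> lin_map B A (\<lambda>x. t x y)"
    and t2: "\<And>x. x \<in> carrier B \<Longrightarrow> lin_map B A (t x)"
    and u: "\<And>a b. a \<in> I \<Longrightarrow> b \<in> I \<Longrightarrow> u a b \<in> carrier B"
    and w: "\<And>a b. a \<in> I \<Longrightarrow> b \<in> I \<Longrightarrow> w a b \<in> carrier B"
    and R: "\<And>a b. a \<in> I \<Longrightarrow> b \<in> I \<Longrightarrow> (\<Sum>k\<in>I. R a k * R' k b) = (if a = b then 1 else 0)"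
  shows "(\<Oplus>k\<in>I. t (cstar_algebra.conj_mat B I T u R i k) (cstar_algebra.conj_mat B I R' w S k j)) =
    conj_mat I T (\<lambda>a b. \<Oplus>c\<in>I. t (u a c) (w c b)) S i j"
proof -
  interpret B: cstar_algebra B by fact
  have tc: "t x y \<in> carrier A" if "x \<in> carrier B" "y \<in> carrier B" for x y
    using t2[OF that(1)] that by (auto simp: lin_map_def)
  have l: "t (\<Oplus>\<^bsub>B\<^esub>a\<in>J. c a \<odot>\<^bsub>B\<^esub> x a) y = (\<Oplus>a\<in>J. c a \<odot> t (x a) y)"
    if "\<And>a. a \<in> J \<Longrightarrow> x a \<in> carrier B" "y \<in> carrier B" for J c x y
    using that t1[OF that(2)] tc
    by (subst lin_map_finsum[OF B cstar_algebra_axioms t1[OF that(2)]]) (auto simp: lin_map_def intro!: finsum_cong')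
  have r: "t x (\<Oplus>\<^bsub>B\<^esub>a\<in>J. c a \<odot>\<^bsub>B\<^esub> y a) = (\<Oplus>a\<in>J. c a \<odot> t x (y a))"
    if "\<And>a. a \<in> J \<Longrightarrow> y a \<in> carrier B" "x \<in> carrier B" for J c x y
    using that t2[OF that(2)] tc
    by (subst lin_map_finsum[OF B cstar_algebra_axioms t2[OF that(2)]]) (auto simp: lin_map_def intro!: finsum_cong')
  have lr: "t (\<Oplus>\<^bsub>B\<^esub>a\<in>J. c a \<odot>\<^bsub>B\<^esub> x a) (\<Oplus>\<^bsub>B\<^esub>b\<in>J. d b \<odot>\<^bsub>B\<^esub> y b) =
      (\<Oplus>a\<in>J. c a \<odot> (\<Oplus>b\<in>J. d b \<odot> t (x a) (y b)))"
    if x: "\<And>a. a \<in> J \<Longrightarrow> x a \<in> carrier B" and y: "\<And>a. a \<in> J \<Longrightarrow> y a \<in> carrier B" for J c d x y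
  proof -
    have "t (\<Oplus>\<^bsub>B\<^esub>a\<in>J. c a \<odot>\<^bsub>B\<^esub> x a) (\<Oplus>\<^bsub>B\<^esub>b\<in>J. d b \<odot>\<^bsub>B\<^esub> y b) =
        (\<Oplus>a\<in>J. c a \<odot> t (x a) (\<Oplus>\<^bsub>B\<^esub>b\<in>J. d b \<odot>\<^bsub>B\<^esub> y b))"
      by (rule l) (use x y in \<open>auto intro!: B.finsum_closed\<close>)
    also have "\<dots> = (\<Oplus>a\<in>J. c a \<odot> (\<Oplus>b\<in>J. d b \<odot> t (x a) (y b)))"
    proof (rule finsum_cong')
      fix a assume "a \<in> J"
      then show "c a \<odot> t (x a) (\<Oplus>\<^bsub>B\<^esub>b\<in>J. d b \<odot>\<^bsub>B\<^esub> y b) =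
          c a \<odot> (\<Oplus>b\<in>J. d b \<odot> t (x a) (y b))"
        by (subst r) (use x y in auto)
    qed (use x y tc in \<open>auto intro!: finsum_closed\<close>)
    finally show ?thesis .
  qed
  let ?W = "B.rmul I w S" and ?U = "B.lmul I T u"
  have W: "?W a b \<in> carrier B" if "a \<in> I" for a b using w that by simp
  have U: "?U a b \<in> carrier B" if "b \<in> I" for a b using u that by simp
  have contract: "(\<Oplus>k\<in>I. R c k \<odot> (\<Oplus>d\<in>I. R' k d \<odot> t (?U i c) (?W d j))) = t (?U i c) (?W c j)"
    if c: "c \<in> I" for c
  proof -
    have "(\<Oplus>k\<in>I. R c k \<odot> (\<Oplus>d\<in>I. R' k d \<odot> t (?U i c) (?W d j))) =
        (\<Oplus>d\<in>I. (\<Sum>k\<in>I. R c k * R' k d) \<odot> t (?U i c) (?W d j))"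
      by (rule lin_comb_assoc) (use fin W U tc c in auto)
    also have "\<dots> = (\<Oplus>d\<in>I. (if c = d then 1 else 0) \<odot> t (?U i c) (?W d j))"
      by (rule finsum_cong') (use fin W U tc c R in auto)
    also have "\<dots> = t (?U i c) (?W c j)"
      by (rule finsum_delta) (use fin W U tc c in auto)
    finally show ?thesis .
  qed
  have inner: "(\<Oplus>c\<in>I. \<Oplus>b\<in>I. S b j \<odot> t (u a c) (w c b)) =
      (\<Oplus>b\<in>I. S b j \<odot> (\<Oplus>c\<in>I. t (u a c) (w c b)))" if a: "a \<in> I" for a
  proof -
    have "(\<Oplus>c\<in>I. \<Oplus>b\<in>I. S b j \<odot> t (u a c) (w c b)) =
        (\<Oplus>b\<in>I. \<Oplus>c\<in>I. S b j \<odot> t (u a c) (w c b))"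
      by (rule finsum_swap) (use u w tc fin a in auto)
    also have "\<dots> = (\<Oplus>b\<in>I. S b j \<odot> (\<Oplus>c\<in>I. t (u a c) (w c b)))"
      by (rule finsum_cong') (use u w tc fin a in \<open>auto simp: smult_finsum intro!: finsum_closed\<close>)
    finally show ?thesis .
  qed
  have "(\<Oplus>k\<in>I. t (B.conj_mat I T u R i k) (B.conj_mat I R' w S k j)) =
      (\<Oplus>k\<in>I. t (B.rmul I ?U R i k) (B.lmul I R' ?W k j))"
    unfolding B.conj_mat_def using u w fin tc by (intro finsum_cong') (auto simp: B.lmul_rmul)
  also have "\<dots> = (\<Oplus>k\<in>I. \<Oplus>c\<in>I. R c k \<odot> (\<Oplus>d\<in>I. R' k d \<odot> t (?U i c) (?W d j)))"
    unfolding B.rmul_def[of I ?U] B.lmul_def[of I R'] using W U tc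
    by (intro finsum_cong') (auto simp: lr intro!: finsum_closed)
  also have "\<dots> = (\<Oplus>c\<in>I. \<Oplus>k\<in>I. R c k \<odot> (\<Oplus>d\<in>I. R' k d \<odot> t (?U i c) (?W d j)))"
    using W U tc fin by (intro finsum_swap) (auto intro!: finsum_closed)
  also have "\<dots> = (\<Oplus>c\<in>I. t (?U i c) (?W c j))"
    using W U tc by (intro finsum_cong') (auto simp: contract)
  also have "\<dots> = (\<Oplus>c\<in>I. \<Oplus>a\<in>I. T i a \<odot> (\<Oplus>b\<in>I. S b j \<odot> t (u a c) (w c b)))"
    unfolding B.rmul_def B.lmul_def using u w tc
    by (intro finsum_cong') (auto simp: lr intro!: finsum_closed)
  also have "\<dots> = (\<Oplus>a\<in>I. \<Oplus>c\<in>I. T i a \<odot> (\<Oplus>b\<in>I. S b j \<odot> t (u a c) (w c b)))"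
    using u w tc fin by (intro finsum_swap) (auto intro!: finsum_closed)
  also have "\<dots> = (\<Oplus>a\<in>I. T i a \<odot> (\<Oplus>c\<in>I. \<Oplus>b\<in>I. S b j \<odot> t (u a c) (w c b)))"
    using u w tc fin by (intro finsum_cong') (auto simp: smult_finsum intro!: finsum_closed)
  also have "\<dots> = (\<Oplus>a\<in>I. T i a \<odot> (\<Oplus>b\<in>I. S b j \<odot> (\<Oplus>c\<in>I. t (u a c) (w c b))))"
    using u w tc by (intro finsum_cong') (auto simp: inner intro!: finsum_closed)
  also have "\<dots> = conj_mat I T (\<lambda>a b. \<Oplus>c\<in>I. t (u a c) (w c b)) S i j"
    by (simp add: conj_mat_def lmul_def rmul_def)
  finally show ?thesis .
qed

section \<open>Homomorphisms of C*-algebras are contractive\<close>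

context cstar_algebra
begin

lemma nrm_zero [simp]: "nrm A \<zero> = 0"
  by (simp add: nrm_eq_0)

lemma nrm_uminus: "x \<in> carrier A \<Longrightarrow> nrm A (\<ominus> x) = nrm A x"
  by (simp add: smult_minus_1 nrm_smult)

lemma nrm_minus_commute:
  assumes "x \<in> carrier A" "y \<in> carrier A"
  shows "nrm A (x \<ominus> y) = nrm A (y \<ominus> x)"
proof -
  have "x \<ominus> y = \<ominus> (y \<ominus> x)" using assms by algebra
  then show ?thesis using assms by (simp add: nrm_uminus)
qed

lemma nrm_triangle:
  assumes "x \<in> carrier A" "y \<in> carrier A" "z \<in> carrier A"
  shows "nrm A (x \<ominus> z) \<le> nrm A (x \<ominus> y) + nrm A (y \<ominus> z)"
proof -
  have "x \<ominus> z = (x \<ominus> y) \<oplus> (y \<ominus> z)" using assms by algebra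
  then show ?thesis using assms nrm_add[of "x \<ominus> y" "y \<ominus> z"] by simp
qed

lemma nrm_adj:
  assumes x: "x \<in> carrier A"
  shows "nrm A (adj A x) = nrm A x"
proof -
  have le: "nrm A y \<le> nrm A (adj A y)" if y: "y \<in> carrier A" for y
  proof (cases "nrm A y = 0")
    case True
    then show ?thesis using nrm_nonneg[OF adj_closed[OF y]] by simp
  next
    case False
    have "nrm A y * nrm A y \<le> nrm A (adj A y) * nrm A y"
      using nrm_cstar[OF y] nrm_mult[OF adj_closed[OF y] y] by (simp add: power2_eq_square)
    then show ?thesis using False nrm_nonneg[OF y] by simp
  qed
  show ?thesis using le[OF x] le[OF adj_closed[OF x]] x by (simp add: adj_adj)
qed

lemma nrm_one_le: "nrm A \<one> \<le> 1"
proof -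
  have "nrm A \<one> = nrm A \<one> * nrm A \<one>" using nrm_cstar[of \<one>] by (simp add: power2_eq_square)
  then show ?thesis by (cases "nrm A \<one> = 0") auto
qed

lemma adj_minus: "x \<in> carrier A \<Longrightarrow> y \<in> carrier A \<Longrightarrow> adj A (x \<ominus> y) = adj A x \<ominus> adj A y"
  by (simp add: a_minus_def smult_minus_1 adj_add adj_smult adj_closed)

lemma limit_unique:
  assumes s: "\<And>n::nat. s n \<in> carrier A" and x: "x \<in> carrier A" and y: "y \<in> carrier A"
    and "(\<lambda>n. nrm A (s n \<ominus> x)) \<longlonglongrightarrow> 0" "(\<lambda>n. nrm A (s n \<ominus> y)) \<longlonglongrightarrow> 0"
  shows "x = y"
proof -
  have "(\<lambda>n. nrm A (s n \<ominus> x) + nrm A (s n \<ominus> y)) \<longlonglongrightarrow> 0"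
    using tendsto_add[OF assms(4,5)] by simp
  moreover have "nrm A (x \<ominus> y) \<le> nrm A (s n \<ominus> x) + nrm A (s n \<ominus> y)" for n
    using nrm_triangle[OF x s y, of n] nrm_minus_commute[OF x s, of n] by simp
  ultimately have "nrm A (x \<ominus> y) \<le> 0" by (intro LIMSEQ_le_const) auto
  then have "x \<ominus> y = \<zero>" using nrm_nonneg[of "x \<ominus> y"] nrm_eq_0[of "x \<ominus> y"] x y by simp
  then show ?thesis using x y by simp
qed

lemma limit_dominated:
  assumes "(\<lambda>n. nrm A (s n \<ominus> x)) \<longlonglongrightarrow> 0" "\<And>n::nat. nrm A (t n \<ominus> y) \<le> C * nrm A (s n \<ominus> x)"
    "\<And>n. t n \<in> carrier A" "y \<in> carrier A"
  shows "(\<lambda>n. nrm A (t n \<ominus> y)) \<longlonglongrightarrow> 0"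
proof (rule tendsto_sandwich[OF _ _ tendsto_const])
  show "(\<lambda>n. C * nrm A (s n \<ominus> x)) \<longlonglongrightarrow> 0" using tendsto_mult_left[OF assms(1), of C] by simp
  show "\<forall>\<^sub>F n in sequentially. 0 \<le> nrm A (t n \<ominus> y)"
    using assms(3,4) by (intro always_eventually allI nrm_nonneg) simp
qed (use assms(2) in auto)

lemma geometric_limit:
  assumes s: "\<And>n::nat. s n \<in> carrier A" and r: "0 \<le> r" "r < 1"
    and step: "\<And>n. nrm A (s (Suc (Suc n)) \<ominus> s (Suc n)) \<le> r * nrm A (s (Suc n) \<ominus> s n)"
  obtains x where "x \<in> carrier A" "(\<lambda>n. nrm A (s n \<ominus> x)) \<longlonglongrightarrow> 0"
proof -
  define d where "d = nrm A (s 1 \<ominus> s 0)"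
  have d0: "0 \<le> d" unfolding d_def using s by (intro nrm_nonneg) simp
  have step': "nrm A (s (Suc n) \<ominus> s n) \<le> d * r ^ n" for n
  proof (induction n)
    case (Suc n)
    have "nrm A (s (Suc (Suc n)) \<ominus> s (Suc n)) \<le> r * nrm A (s (Suc n) \<ominus> s n)" by (rule step)
    also have "\<dots> \<le> r * (d * r ^ n)" by (intro mult_left_mono Suc r)
    finally show ?case by (simp add: mult_ac)
  qed (simp add: d_def)
  have tail: "nrm A (s (n + m) \<ominus> s n) \<le> d * (\<Sum>i<m. r ^ (n + i))" for n m
  proof (induction m)
    case 0
    have "s n \<ominus> s n = \<zero>" using s[of n] by algebra
    then show ?case by simp
  next
    case (Suc m)
    have "nrm A (s (n + Suc m) \<ominus> s n) \<le> nrm A (s (Suc (n + m)) \<ominus> s (n + m)) + nrm A (s (n + m) \<ominus> s n)"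
      using nrm_triangle[OF s s s] by simp
    also have "\<dots> \<le> d * r ^ (n + m) + d * (\<Sum>i<m. r ^ (n + i))"
      by (intro add_mono step' Suc)
    finally show ?case by (simp add: algebra_simps)
  qed
  have bound: "nrm A (s (n + m) \<ominus> s n) \<le> d * r ^ n / (1 - r)" for n m
  proof -
    have "(\<Sum>i<m. r ^ i) * (1 - r) \<le> 1" using r by (simp add: sum_gp_strict)
    then have "(\<Sum>i<m. r ^ i) \<le> 1 / (1 - r)" using r by (simp add: field_simps)
    then have "d * r ^ n * (\<Sum>i<m. r ^ i) \<le> d * r ^ n * (1 / (1 - r))"
      by (intro mult_left_mono) (use d0 r in auto)
    then show ?thesis using tail[of n m] by (simp add: power_add sum_distrib_left mult.assoc)
  qed
  have "\<exists>x\<in>carrier A. (\<lambda>n. nrm A (s n \<ominus> x)) \<longlonglongrightarrow> 0"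
  proof (rule nrm_complete[OF s])
    fix e :: real assume e: "e > 0"
    have "(\<lambda>n. d * r ^ n / (1 - r)) \<longlonglongrightarrow> d * 0 / (1 - r)"
      using r by (intro tendsto_intros LIMSEQ_realpow_zero) auto
    then have "\<forall>\<^sub>F n in sequentially. d * r ^ n / (1 - r) < e / 2"
      using e by (intro order_tendstoD(2)[where y = "d * 0 / (1 - r)"]) auto
    then obtain M where M: "d * r ^ M / (1 - r) < e / 2" by (auto simp: eventually_sequentially)
    have near: "nrm A (s m \<ominus> s M) < e / 2" if "m \<ge> M" for m
      using bound[of M "m - M"] that by (intro le_less_trans[OF _ M]) simp
    have "nrm A (s m \<ominus> s n) < e" if "m \<ge> M" "n \<ge> M" for m n
      using nrm_triangle[OF s[of m] s[of M] s[of n]] near[OF that(1)] near[OF that(2)]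
        nrm_minus_commute[OF s[of M] s[of n]] by simp
    then show "\<exists>M. \<forall>m\<ge>M. \<forall>n\<ge>M. nrm A (s m \<ominus> s n) < e" by blast
  qed
  then show ?thesis using that by blast
qed

text \<open>
  \<open>y = 1 - z\<close>, where \<open>z\<close> solves \<open>z = (x x + z z) / 2\<close>. The right-hand side contracts the ball of radius
  \<open>nrm A x < 1\<close> with this factor. Its iterates, started at 0, are self-adjoint and commute with \<open>x\<close>, and
  both properties pass to the limit.
\<close>

lemma selfadjoint_sqrt:
  assumes x: "x \<in> carrier A" and sa: "adj A x = x" and lt: "nrm A x < 1"
  obtains y where "y \<in> carrier A" "adj A y = y" "x \<otimes> y = y \<otimes> x" "x \<otimes> x \<oplus> y \<otimes> y = \<one>"
proof -
  define r where "r = nrm A x"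
  have r: "0 \<le> r" "r < 1" using nrm_nonneg[OF x] lt by (simp_all add: r_def)
  define step where "step z = (1/2) \<odot> (x \<otimes> x \<oplus> z \<otimes> z)" for z
  have step_c: "step z \<in> carrier A" if "z \<in> carrier A" for z using x that by (simp add: step_def)
  have step_lip: "nrm A (step a \<ominus> step b) \<le> (nrm A a + nrm A b) / 2 * nrm A (a \<ominus> b)"
    if a: "a \<in> carrier A" and b: "b \<in> carrier A" for a b
  proof -
    have "step a \<ominus> step b = (1/2) \<odot> (x \<otimes> x \<oplus> a \<otimes> a \<ominus> (x \<otimes> x \<oplus> b \<otimes> b))"
      using x a b by (simp add: step_def a_minus_def smult_minus_1 smult_add_right smult_smult)
    also have "x \<otimes> x \<oplus> a \<otimes> a \<ominus> (x \<otimes> x \<oplus> b \<otimes> b) = a \<otimes> (a \<ominus> b) \<oplus> (a \<ominus> b) \<otimes> b"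
      using x a b by algebra
    also have "nrm A ((1/2) \<odot> \<dots>) \<le> 1/2 * (nrm A a * nrm A (a \<ominus> b) + nrm A (a \<ominus> b) * nrm A b)"
      using a b nrm_add[of "a \<otimes> (a \<ominus> b)" "(a \<ominus> b) \<otimes> b"] nrm_mult[of a "a \<ominus> b"] nrm_mult[of "a \<ominus> b" b]
      by (simp add: nrm_smult)
    finally show ?thesis by (simp add: algebra_simps)
  qed
  define s where "s n = (step ^^ n) \<zero>" for n
  have s_Suc: "s (Suc n) = step (s n)" for n by (simp add: s_def)
  have s: "s n \<in> carrier A" for n by (induction n) (simp_all add: s_def step_c)
  have s_r: "nrm A (s n) \<le> r" for n
  proof (induction n)
    case (Suc n)
    have "nrm A (step (s n)) \<le> 1/2 * (r * r + r * r)"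
      using nrm_add[of "x \<otimes> x" "s n \<otimes> s n"] nrm_mult[OF x x] nrm_mult[OF s s, of n n] x s[of n]
        mult_mono[OF Suc Suc r(1) nrm_nonneg[OF s]]
      by (simp add: step_def nrm_smult r_def)
    also have "\<dots> \<le> r" using r mult_left_le[of r r] by simp
    finally show ?case by (simp add: s_Suc)
  qed (simp add: s_def r)
  have s_adj: "adj A (s n) = s n" for n
  proof (induction n)
    case (Suc n)
    then show ?case using x s[of n] sa by (simp add: s_Suc step_def adj_smult adj_add adj_mult)
  qed (simp add: s_def)
  have s_comm: "x \<otimes> s n = s n \<otimes> x" for n
  proof (induction n)
    case (Suc n)
    have "x \<otimes> (s n \<otimes> s n) = s n \<otimes> s n \<otimes> x"
      using Suc x s[of n] by (metis m_assoc)
    then show ?case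
      using x s[of n] by (simp add: s_Suc step_def smult_mult_left smult_mult_right r_distr l_distr m_assoc)
  qed (simp add: s_def x)
  obtain z where z: "z \<in> carrier A" and lim: "(\<lambda>n. nrm A (s n \<ominus> z)) \<longlonglongrightarrow> 0"
  proof (rule geometric_limit[OF s r])
    fix n
    have "nrm A (s (Suc (Suc n)) \<ominus> s (Suc n)) \<le> (nrm A (s (Suc n)) + nrm A (s n)) / 2 * nrm A (s (Suc n) \<ominus> s n)"
      unfolding s_Suc[of "Suc n"] s_Suc[of n] using step_lip[OF step_c[OF s[of n]] s[of n]] by (simp add: s_Suc[symmetric])
    also have "\<dots> \<le> r * nrm A (s (Suc n) \<ominus> s n)"
      using s_r[of "Suc n"] s_r[of n] s by (intro mult_right_mono nrm_nonneg) auto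
    finally show "nrm A (s (Suc (Suc n)) \<ominus> s (Suc n)) \<le> r * nrm A (s (Suc n) \<ominus> s n)" .
  qed
  have fixpoint: "step z = z"
  proof (rule limit_unique[where s = "\<lambda>n. s (Suc n)"])
    show "(\<lambda>n. nrm A (s (Suc n) \<ominus> z)) \<longlonglongrightarrow> 0" using lim by (rule LIMSEQ_Suc)
    show "(\<lambda>n. nrm A (s (Suc n) \<ominus> step z)) \<longlonglongrightarrow> 0"
    proof (rule limit_dominated[OF lim])
      fix n
      have "nrm A (s (Suc n) \<ominus> step z) \<le> (nrm A (s n) + nrm A z) / 2 * nrm A (s n \<ominus> z)"
        unfolding s_Suc by (rule step_lip[OF s z])
      also have "\<dots> \<le> (r + nrm A z) / 2 * nrm A (s n \<ominus> z)"
        using s_r[of n] s z by (intro mult_right_mono nrm_nonneg) auto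
      finally show "nrm A (s (Suc n) \<ominus> step z) \<le> (r + nrm A z) / 2 * nrm A (s n \<ominus> z)" .
    qed (simp_all add: s z step_c)
  qed (simp_all add: s z step_c)
  have z_adj: "adj A z = z"
  proof (rule limit_unique[OF s adj_closed[OF z] z _ lim])
    show "(\<lambda>n. nrm A (s n \<ominus> adj A z)) \<longlonglongrightarrow> 0"
    proof (rule limit_dominated[OF lim, where C = 1])
      fix n
      have "s n \<ominus> adj A z = adj A (s n \<ominus> z)" using s z by (simp add: adj_minus s_adj)
      then show "nrm A (s n \<ominus> adj A z) \<le> 1 * nrm A (s n \<ominus> z)" using s z by (simp add: nrm_adj)
    qed (simp_all add: s z adj_closed)
  qed
  have z_comm: "x \<otimes> z = z \<otimes> x"
  proof (rule limit_unique[where s = "\<lambda>n. x \<otimes> s n"])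
    show "(\<lambda>n. nrm A (x \<otimes> s n \<ominus> x \<otimes> z)) \<longlonglongrightarrow> 0"
    proof (rule limit_dominated[OF lim, where C = "nrm A x"])
      fix n
      have "x \<otimes> s n \<ominus> x \<otimes> z = x \<otimes> (s n \<ominus> z)" using x z s[of n] by algebra
      then show "nrm A (x \<otimes> s n \<ominus> x \<otimes> z) \<le> nrm A x * nrm A (s n \<ominus> z)" using x z s[of n] by (simp add: nrm_mult)
    qed (simp_all add: s z x)
    show "(\<lambda>n. nrm A (x \<otimes> s n \<ominus> z \<otimes> x)) \<longlonglongrightarrow> 0"
    proof (rule limit_dominated[OF lim, where C = "nrm A x"])
      fix n
      have "s n \<otimes> x \<ominus> z \<otimes> x = (s n \<ominus> z) \<otimes> x" using x z s[of n] by algebra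
      then show "nrm A (x \<otimes> s n \<ominus> z \<otimes> x) \<le> nrm A x * nrm A (s n \<ominus> z)"
        using x z s[of n] nrm_mult[of "s n \<ominus> z" x] by (simp add: s_comm mult.commute)
    qed (simp_all add: s z x)
  qed (simp_all add: s z x)
  have double: "z \<oplus> z = x \<otimes> x \<oplus> z \<otimes> z"
  proof -
    have "z \<oplus> z = step z \<oplus> step z" by (simp add: fixpoint)
    also have "\<dots> = (1/2 + 1/2) \<odot> (x \<otimes> x \<oplus> z \<otimes> z)"
      unfolding step_def using x z by (intro smult_add_left[symmetric]) simp
    also have "\<dots> = x \<otimes> x \<oplus> z \<otimes> z" using x z by simp
    finally show ?thesis .
  qed
  show thesis
  proof (rule that[of "\<one> \<ominus> z"])
    show "\<one> \<ominus> z \<in> carrier A" using z by simp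
    show "adj A (\<one> \<ominus> z) = \<one> \<ominus> z" using z by (simp add: adj_minus z_adj)
    show "x \<otimes> (\<one> \<ominus> z) = (\<one> \<ominus> z) \<otimes> x"
    proof -
      have "x \<otimes> (\<one> \<ominus> z) = x \<ominus> x \<otimes> z" "(\<one> \<ominus> z) \<otimes> x = x \<ominus> z \<otimes> x"
        using x z by (simp_all add: a_minus_def l_distr r_distr l_minus r_minus)
      then show ?thesis by (simp add: z_comm)
    qed
    have "x \<otimes> x \<oplus> (\<one> \<ominus> z) \<otimes> (\<one> \<ominus> z) = \<one> \<oplus> (x \<otimes> x \<oplus> z \<otimes> z) \<ominus> (z \<oplus> z)"
      using x z by (algebra, simp)
    also have "\<dots> = \<one>" unfolding double using x z by algebra
    finally show "x \<otimes> x \<oplus> (\<one> \<ominus> z) \<otimes> (\<one> \<ominus> z) = \<one>" .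
  qed
qed

text \<open>
  \<open>u = x + \<i> sqrt(1 - x\<^sup>2)\<close>.
\<close>

lemma selfadjoint_eq_unitary_average:
  assumes x: "x \<in> carrier A" and sa: "adj A x = x" and lt: "nrm A x < 1"
  obtains u where "u \<in> carrier A" "adj A u \<otimes> u = \<one>" "x = (1/2) \<odot> (u \<oplus> adj A u)"
proof -
  obtain y where y: "y \<in> carrier A" "adj A y = y" "x \<otimes> y = y \<otimes> x" "x \<otimes> x \<oplus> y \<otimes> y = \<one>"
    by (rule selfadjoint_sqrt[OF assms])
  let ?u = "x \<oplus> \<i> \<odot> y"
  have adj: "adj A ?u = x \<oplus> (- \<i>) \<odot> y"
    using x y by (simp add: adj_add adj_smult sa)
  show ?thesis
  proof (rule that[of ?u])
    have "adj A ?u \<otimes> ?u = x \<otimes> x \<oplus> \<i> \<odot> (y \<otimes> x) \<oplus> ((- \<i>) \<odot> (y \<otimes> x) \<oplus> y \<otimes> y)"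
      using x y(1) by (simp add: adj l_distr r_distr smult_mult_left smult_mult_right smult_smult
          smult_add_right a_ac y(3))
    also have "\<dots> = (x \<otimes> x \<oplus> y \<otimes> y) \<oplus> (\<i> \<odot> (y \<otimes> x) \<oplus> (- \<i>) \<odot> (y \<otimes> x))"
      using x y(1) by (simp add: a_ac)
    also have "\<i> \<odot> (y \<otimes> x) \<oplus> (- \<i>) \<odot> (y \<otimes> x) = \<zero>"
      using x y(1) smult_add_left[of "y \<otimes> x" "\<i>" "- \<i>"] by simp
    finally show "adj A ?u \<otimes> ?u = \<one>" by (simp add: y(4))
    have "?u \<oplus> adj A ?u = (x \<oplus> x) \<oplus> (\<i> \<odot> y \<oplus> (- \<i>) \<odot> y)"
      using x y(1) by (simp add: adj a_ac)
    also have "\<i> \<odot> y \<oplus> (- \<i>) \<odot> y = \<zero>" using y(1) smult_add_left[of y "\<i>" "- \<i>"] by simp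
    finally show "x = (1/2) \<odot> (?u \<oplus> adj A ?u)"
      using x smult_add_left[of x "1/2" "1/2"] by (simp add: smult_add_right)
  qed (simp add: x y)
qed

end

lemma unital_star_homD:
  assumes "unital_star_hom A B \<phi>"
  shows "x \<in> carrier A \<Longrightarrow> \<phi> x \<in> carrier B"
    and "x \<in> carrier A \<Longrightarrow> y \<in> carrier A \<Longrightarrow> \<phi> (x \<otimes>\<^bsub>A\<^esub> y) = \<phi> x \<otimes>\<^bsub>B\<^esub> \<phi> y"
    and "x \<in> carrier A \<Longrightarrow> y \<in> carrier A \<Longrightarrow> \<phi> (x \<oplus>\<^bsub>A\<^esub> y) = \<phi> x \<oplus>\<^bsub>B\<^esub> \<phi> y"
    and "\<phi> \<one>\<^bsub>A\<^esub> = \<one>\<^bsub>B\<^esub>"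
    and "x \<in> carrier A \<Longrightarrow> \<phi> (c \<odot>\<^bsub>A\<^esub> x) = c \<odot>\<^bsub>B\<^esub> \<phi> x"
    and "x \<in> carrier A \<Longrightarrow> \<phi> (adj A x) = adj B (\<phi> x)"
  using assms by (auto simp: unital_star_hom_def Ring.ring_hom_def)

text \<open>
  If \<open>u\<^sup>* u = 1\<close>, then the image of \<open>u\<close> has the same property and therefore norm at most 1. Averages of
  \<open>u\<close> and \<open>u\<^sup>*\<close> cover the self-adjoint part of the open unit ball, which settles self-adjoint elements by
  scaling, and the identity \<open>nrm (x\<^sup>* x) = (nrm x)\<^sup>2\<close> reduces the general case to them.
\<close>

theorem star_hom_contractive:
  assumes A: "cstar_algebra A" and B: "cstar_algebra B" and \<phi>: "unital_star_hom A B \<phi>"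
    and x: "x \<in> carrier A"
  shows "nrm B (\<phi> x) \<le> nrm A x"
proof -
  interpret A: cstar_algebra A by fact
  interpret B: cstar_algebra B by fact
  note hom = unital_star_homD[OF \<phi>]
  have unit_ball: "nrm B (\<phi> x) \<le> 1" if x: "x \<in> carrier A" "adj A x = x" "nrm A x < 1" for x
  proof -
    obtain u where u: "u \<in> carrier A" "adj A u \<otimes>\<^bsub>A\<^esub> u = \<one>\<^bsub>A\<^esub>" "x = (1/2) \<odot>\<^bsub>A\<^esub> (u \<oplus>\<^bsub>A\<^esub> adj A u)"
      by (rule A.selfadjoint_eq_unitary_average[OF x])
    have uB: "\<phi> u \<in> carrier B" using hom(1)[OF u(1)] .
    have "adj B (\<phi> u) \<otimes>\<^bsub>B\<^esub> \<phi> u = \<one>\<^bsub>B\<^esub>"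
      using hom(2)[OF A.adj_closed[OF u(1)] u(1)] by (simp add: u(2) hom(4) hom(6)[OF u(1)])
    then have "(nrm B (\<phi> u))\<^sup>2 \<le> 1" using B.nrm_cstar[OF uB] B.nrm_one_le by simp
    then have le: "nrm B (\<phi> u) \<le> 1" by (simp add: power_le_one_iff abs_square_le_1 abs_le_iff)
    have "\<phi> x = (1/2) \<odot>\<^bsub>B\<^esub> (\<phi> u \<oplus>\<^bsub>B\<^esub> adj B (\<phi> u))"
      unfolding u(3) using u(1) by (simp add: hom A.adj_closed)
    then show ?thesis
      using B.nrm_add[OF uB B.adj_closed[OF uB]] uB le by (simp add: B.nrm_smult B.nrm_adj B.adj_closed)
  qed
  have selfadj: "nrm B (\<phi> x) \<le> nrm A x" if x: "x \<in> carrier A" "adj A x = x" for x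
  proof (rule dense_ge)
    fix e assume e: "nrm A x < e"
    then have "0 < e" using A.nrm_nonneg[OF x(1)] by simp
    let ?c = "complex_of_real (1 / e)"
    have "nrm B (\<phi> (?c \<odot>\<^bsub>A\<^esub> x)) \<le> 1"
      using x e \<open>0 < e\<close> by (intro unit_ball) (simp_all add: A.adj_smult A.nrm_smult norm_divide)
    then show "nrm B (\<phi> x) \<le> e"
      using x(1) \<open>0 < e\<close> by (simp add: hom B.nrm_smult norm_divide field_simps)
  qed
  have "(nrm B (\<phi> x))\<^sup>2 = nrm B (\<phi> (adj A x \<otimes>\<^bsub>A\<^esub> x))"
    using x by (simp add: hom A.adj_closed B.nrm_cstar)
  also have "\<dots> \<le> nrm A (adj A x \<otimes>\<^bsub>A\<^esub> x)"
    using x by (intro selfadj) (simp_all add: A.adj_closed A.adj_mult A.adj_adj)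
  also have "\<dots> = (nrm A x)\<^sup>2" using x by (rule A.nrm_cstar)
  finally show ?thesis using A.nrm_nonneg[OF x] by (rule power2_le_imp_le)
qed

section \<open>Reflected quantum groups\<close>

text \<open>
  The matrix of \<open>tau\<close>. It is the reflection that negates the all-ones vector and fixes its orthogonal
  complement.
\<close>

definition refl_coeff :: "nat \<Rightarrow> nat \<Rightarrow> nat \<Rightarrow> complex" where
  "refl_coeff N i j = (if i = j then 1 else 0) - 2 / of_nat N"

lemma refl_coeff_commute: "refl_coeff N i j = refl_coeff N j i"
  by (simp add: refl_coeff_def)

lemma cnj_refl_coeff: "cnj (refl_coeff N i j) = refl_coeff N i j"
  by (simp add: refl_coeff_def)

lemma sum_refl_coeff_mult:
  assumes "i < N"
  shows "(\<Sum>k<N. refl_coeff N i k * f k) = f i - 2 / of_nat N * (\<Sum>k<N. f k)"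
proof -
  have "(\<Sum>k<N. refl_coeff N i k * f k) = (\<Sum>k<N. (if i = k then f k else 0) - 2 / of_nat N * f k)"
    by (intro sum.cong refl) (simp add: refl_coeff_def algebra_simps)
  then show ?thesis using assms by (simp add: sum_subtractf sum_distrib_left)
qed

lemma refl_coeff_square:
  assumes "i < N" "j < N"
  shows "(\<Sum>k<N. refl_coeff N i k * refl_coeff N k j) = (if i = j then 1 else 0)"
proof -
  have "(\<Sum>k<N. refl_coeff N k j) = 1 - 2"
    using sum_refl_coeff_mult[of j N "\<lambda>_. 1"] assms by (simp add: refl_coeff_commute)
  then show ?thesis using assms by (simp add: sum_refl_coeff_mult) (simp add: refl_coeff_def)
qed

lemma Tmap_tau:
  assumes "i < N" "j < N"
  shows "Tmap N (Suc 0) (Suc 0) (tau N) [j] [i] = refl_coeff N j i"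
  using assms by (simp add: tau_expand Tmap_add Tmap_scale Tmap_basis multi_idx_1 delta_basic refl_coeff_def)

definition refl_mat :: "nat \<Rightarrow> complex mat" where
  "refl_mat N = mat N N (\<lambda>(i, j). refl_coeff N i j)"

lemma Tmat_tau: "Tmat N (tau N) = refl_mat N"
  unfolding Tmat_def refl_mat_def by (rule eq_matI) (simp_all add: Tmap_tau)

lemma refl_mat_inverse: "the (mat_inverse (refl_mat N)) = refl_mat N"
proof -
  let ?T = "refl_mat N"
  have T: "?T \<in> carrier_mat N N" by (simp add: refl_mat_def)
  have TT: "?T * ?T = 1\<^sub>m N"
    by (rule eq_matI) (auto simp: refl_mat_def scalar_prod_def refl_coeff_square atLeast0LessThan)
  then have "?T \<in> Units (ring_mat TYPE(complex) N ())"
    using T by (auto simp: Units_def ring_mat_def)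
  with mat_inverse(1)[OF T] obtain B where B: "mat_inverse ?T = Some B" by fastforce
  from mat_inverse(2)[OF T B] have B': "?T * B = 1\<^sub>m N" "B \<in> carrier_mat N N" by auto
  have "B = ?T * ?T * B" using TT B' by simp
  also have "\<dots> = ?T * (?T * B)" using T B' by (intro assoc_mult_mat) auto
  finally show ?thesis using B B' T by simp
qed

definition reflect :: "'a cstar \<Rightarrow> nat \<Rightarrow> 'a mat \<Rightarrow> 'a mat" where
  "reflect A N u = mat N N (\<lambda>(i, j). cstar_algebra.conj_mat A {..<N} (refl_coeff N) (\<lambda>a b. u $$ (a, b)) (refl_coeff N) i j)"

lemma alg_matsD:
  assumes "u \<in> alg_mats A N"
  shows "dim_row u = N" "dim_col u = N" "i < N \<Longrightarrow> j < N \<Longrightarrow> u $$ (i, j) \<in> carrier A" "u \<in> carrier_mat N N"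
  using assms by (auto simp: alg_mats_def)

lemma lin_map_hom:
  assumes "unital_star_hom A B \<phi>"
  shows "lin_map A B \<phi>"
  unfolding lin_map_def using unital_star_homD[OF assms] by auto

context cstar_algebra
begin

lemma sandwich_conj_mat:
  assumes "u \<in> alg_mats A N" "M \<in> carrier_mat n N" "M' \<in> carrier_mat N n"
  shows "sandwich A M u M' = mat n n (\<lambda>(i, j).
    conj_mat {..<N} (\<lambda>i a. M $$ (i, a)) (\<lambda>a b. u $$ (a, b)) (\<lambda>b j. M' $$ (b, j)) i j)"
proof (rule eq_matI)
  note uD = alg_matsD[OF assms(1)]
  let ?c = "\<lambda>(i, j). conj_mat {..<N} (\<lambda>i a. M $$ (i, a)) (\<lambda>a b. u $$ (a, b)) (\<lambda>b j. M' $$ (b, j)) i j"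
  fix i j assume "i < dim_row (mat n n ?c)" "j < dim_col (mat n n ?c)"
  then have ij: "i < n" "j < n" by simp_all
  have "conj_mat {..<N} (\<lambda>i a. M $$ (i, a)) (\<lambda>a b. u $$ (a, b)) (\<lambda>b j. M' $$ (b, j)) i j =
      (\<Oplus>a\<in>{..<N}. \<Oplus>b\<in>{..<N}. (M $$ (i, a) * M' $$ (b, j)) \<odot> u $$ (a, b))"
    using uD(3) by (intro conj_mat_eq) auto
  then show "sandwich A M u M' $$ (i, j) = mat n n ?c $$ (i, j)"
    using ij assms(2,3) uD(1,2) by (simp add: sandwich_def)
qed (use assms(2,3) in \<open>simp_all add: sandwich_def\<close>)

lemma sandwich_refl_mat:
  assumes u: "u \<in> alg_mats A N"
  shows "sandwich A (refl_mat N) u (the (mat_inverse (refl_mat N))) = reflect A N u"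
proof -
  have T: "refl_mat N \<in> carrier_mat N N" by (simp add: refl_mat_def)
  show ?thesis
    unfolding refl_mat_inverse sandwich_conj_mat[OF u T T] reflect_def
    by (rule cong_mat) (use alg_matsD(3)[OF u] in \<open>auto simp: refl_mat_def intro!: conj_mat_cong\<close>)
qed

lemma reflect_index: "i < N \<Longrightarrow> j < N \<Longrightarrow>
    reflect A N u $$ (i, j) = conj_mat {..<N} (refl_coeff N) (\<lambda>a b. u $$ (a, b)) (refl_coeff N) i j"
  by (simp add: reflect_def)

lemma reflect_sum:
  assumes "u \<in> alg_mats A N" "i < N" "j < N"
  shows "reflect A N u $$ (i, j) =
    (\<Oplus>a\<in>{..<N}. \<Oplus>b\<in>{..<N}. (refl_coeff N i a * refl_coeff N b j) \<odot> u $$ (a, b))"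
  unfolding reflect_index[OF assms(2,3)] using alg_matsD(3)[OF assms(1)] by (intro conj_mat_eq) auto

lemma reflect_mats: "u \<in> alg_mats A N \<Longrightarrow> reflect A N u \<in> alg_mats A N"
proof -
  assume u: "u \<in> alg_mats A N"
  have "conj_mat {..<N} (refl_coeff N) (\<lambda>a b. u $$ (a, b)) (refl_coeff N) i j \<in> carrier A" for i j
    using alg_matsD(3)[OF u] by (intro conj_mat_closed) auto
  then show ?thesis by (simp add: alg_mats_def reflect_def)
qed

lemma reflect_reflect:
  assumes u: "u \<in> alg_mats A N"
  shows "reflect A N (reflect A N u) = u"
proof (rule eq_matI)
  note uD = alg_matsD[OF u]
  fix i j assume "i < dim_row u" "j < dim_col u"
  then have ij: "i < N" "j < N" by (simp_all add: uD)
  have "reflect A N (reflect A N u) $$ (i, j) = conj_mat {..<N} (refl_coeff N)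
      (conj_mat {..<N} (refl_coeff N) (\<lambda>a b. u $$ (a, b)) (refl_coeff N)) (refl_coeff N) i j"
    unfolding reflect_index[OF ij] using uD
    by (intro conj_mat_cong) (auto simp: reflect_index intro!: conj_mat_closed)
  also have "\<dots> = u $$ (i, j)"
    using ij uD by (subst conj_mat_conj_mat) (auto simp: refl_coeff_square intro!: conj_mat_id)
  finally show "reflect A N (reflect A N u) $$ (i, j) = u $$ (i, j)" .
qed (use alg_matsD[OF u] in \<open>simp_all add: reflect_def\<close>)

lemma transpose_mats: "u \<in> alg_mats A N \<Longrightarrow> transpose_mat u \<in> alg_mats A N"
  by (auto simp: alg_mats_def)

lemma reflect_transpose:
  assumes u: "u \<in> alg_mats A N"
  shows "transpose_mat (reflect A N u) = reflect A N (transpose_mat u)"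
proof (rule eq_matI)
  note uD = alg_matsD[OF u]
  fix i j assume "i < dim_row (reflect A N (transpose_mat u))" "j < dim_col (reflect A N (transpose_mat u))"
  then have ij: "i < N" "j < N" by (simp_all add: reflect_def)
  have "transpose_mat (reflect A N u) $$ (i, j) = reflect A N u $$ (j, i)"
    using ij by (simp add: reflect_def)
  also have "\<dots> = (\<Oplus>a\<in>{..<N}. \<Oplus>b\<in>{..<N}. (refl_coeff N j a * refl_coeff N b i) \<odot> u $$ (a, b))"
    by (rule reflect_sum[OF u ij(2,1)])
  also have "\<dots> = (\<Oplus>b\<in>{..<N}. \<Oplus>a\<in>{..<N}. (refl_coeff N j a * refl_coeff N b i) \<odot> u $$ (a, b))"
    using uD by (intro finsum_swap) auto
  also have "\<dots> = (\<Oplus>b\<in>{..<N}. \<Oplus>a\<in>{..<N}. (refl_coeff N i b * refl_coeff N a j) \<odot> transpose_mat u $$ (b, a))"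
    using uD by (intro finsum_cong') (auto simp: refl_coeff_commute mult.commute intro!: finsum_closed finsum_cong')
  also have "\<dots> = reflect A N (transpose_mat u) $$ (i, j)"
    by (rule reflect_sum[OF transpose_mats[OF u] ij, symmetric])
  finally show "transpose_mat (reflect A N u) $$ (i, j) = reflect A N (transpose_mat u) $$ (i, j)" .
qed (simp_all add: reflect_def)

lemma lin_map_mult: "y \<in> carrier A \<Longrightarrow> lin_map A A (\<lambda>x. x \<otimes> y)" "x \<in> carrier A \<Longrightarrow> lin_map A A (\<lambda>y. x \<otimes> y)"
  by (auto simp: lin_map_def l_distr r_distr smult_mult_left smult_mult_right)

lemma alg_mat_mult_index:
  assumes "u \<in> alg_mats A N" "w \<in> alg_mats A N" "i < N" "j < N"
  shows "alg_mat_mult A u w $$ (i, j) = (\<Oplus>k\<in>{..<N}. u $$ (i, k) \<otimes> w $$ (k, j))"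
  using assms(3,4) alg_matsD[OF assms(1)] alg_matsD[OF assms(2)] by (simp add: alg_mat_mult_def)

lemma reflect_mult:
  assumes u: "u \<in> alg_mats A N" and w: "w \<in> alg_mats A N"
  shows "alg_mat_mult A (reflect A N u) (reflect A N w) = reflect A N (alg_mat_mult A u w)"
proof (rule eq_matI)
  note uD = alg_matsD[OF u] and wD = alg_matsD[OF w]
  fix i j assume "i < dim_row (reflect A N (alg_mat_mult A u w))" "j < dim_col (reflect A N (alg_mat_mult A u w))"
  then have ij: "i < N" "j < N" by (simp_all add: reflect_def)
  have "alg_mat_mult A (reflect A N u) (reflect A N w) $$ (i, j) =
      (\<Oplus>k\<in>{..<N}. conj_mat {..<N} (refl_coeff N) (\<lambda>a b. u $$ (a, b)) (refl_coeff N) i k \<otimes>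
        conj_mat {..<N} (refl_coeff N) (\<lambda>a b. w $$ (a, b)) (refl_coeff N) k j)"
    unfolding alg_mat_mult_index[OF reflect_mats[OF u] reflect_mats[OF w] ij] using ij uD wD
    by (intro finsum_cong') (auto simp: reflect_index intro!: conj_mat_closed)
  also have "\<dots> = conj_mat {..<N} (refl_coeff N) (\<lambda>a b. \<Oplus>c\<in>{..<N}. u $$ (a, c) \<otimes> w $$ (c, b)) (refl_coeff N) i j"
    using uD wD
    by (intro conj_mat_mult[OF cstar_algebra_axioms]) (auto simp: lin_map_mult refl_coeff_square)
  also have "\<dots> = reflect A N (alg_mat_mult A u w) $$ (i, j)"
    unfolding reflect_index[OF ij] using uD wD
    by (intro conj_mat_cong) (auto simp: alg_mat_mult_index[OF u w] intro!: finsum_closed)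
  finally show "alg_mat_mult A (reflect A N u) (reflect A N w) $$ (i, j) = reflect A N (alg_mat_mult A u w) $$ (i, j)" .
qed (simp_all add: reflect_def alg_mat_mult_def)

lemma reflect_one: "reflect A N (alg_one_mat A N) = alg_one_mat A N"
proof (rule eq_matI)
  fix i j assume "i < dim_row (alg_one_mat A N)" "j < dim_col (alg_one_mat A N)"
  then have ij: "i < N" "j < N" by (simp_all add: alg_one_mat_def)
  have inner: "(\<Oplus>b\<in>{..<N}. (refl_coeff N i a * refl_coeff N b j) \<odot> alg_one_mat A N $$ (a, b)) =
      (refl_coeff N i a * refl_coeff N a j) \<odot> \<one>" if "a < N" for a
  proof -
    have "(\<Oplus>b\<in>{..<N}. (refl_coeff N i a * refl_coeff N b j) \<odot> alg_one_mat A N $$ (a, b)) =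
        (\<Oplus>b\<in>{..<N}. if a = b then (refl_coeff N i a * refl_coeff N b j) \<odot> \<one> else \<zero>)"
      using that by (intro finsum_cong') (auto simp: alg_one_mat_def)
    also have "\<dots> = (refl_coeff N i a * refl_coeff N a j) \<odot> \<one>"
      using that by (intro finsum_singleton) auto
    finally show ?thesis .
  qed
  have "reflect A N (alg_one_mat A N) $$ (i, j) =
      (\<Oplus>a\<in>{..<N}. \<Oplus>b\<in>{..<N}. (refl_coeff N i a * refl_coeff N b j) \<odot> alg_one_mat A N $$ (a, b))"
    unfolding reflect_index[OF ij] by (rule conj_mat_eq) (auto simp: alg_one_mat_def)
  also have "\<dots> = (\<Oplus>a\<in>{..<N}. (refl_coeff N i a * refl_coeff N a j) \<odot> \<one>)"
    by (intro finsum_cong') (auto simp: inner)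
  also have "\<dots> = (\<Sum>a<N. refl_coeff N i a * refl_coeff N a j) \<odot> \<one>"
    by (simp add: sum_smult)
  also have "\<dots> = alg_one_mat A N $$ (i, j)"
    using ij by (simp add: refl_coeff_square alg_one_mat_def)
  finally show "reflect A N (alg_one_mat A N) $$ (i, j) = alg_one_mat A N $$ (i, j)" .
qed (simp_all add: reflect_def alg_one_mat_def)

lemma adj_finsum:
  "f \<in> I \<rightarrow> carrier A \<Longrightarrow> adj A (\<Oplus>i\<in>I. f i) = (\<Oplus>i\<in>I. adj A (f i))"
proof (induction I rule: infinite_finite_induct)
  case (infinite I)
  then show ?case by (simp add: finsum_infinite)
next
  case (insert i I)
  then show ?case by (simp add: adj_add adj_closed finsum_closed Pi_iff)
qed simp

lemma reflect_orthogonal: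
  assumes u: "u \<in> alg_mats A N" and orth: "orthogonal_relations A N u"
  shows "orthogonal_relations A N (reflect A N u)"
proof -
  note uD = alg_matsD[OF u]
  have "adj A (reflect A N u $$ (i, j)) = reflect A N u $$ (i, j)" if ij: "i < N" "j < N" for i j
  proof -
    have "adj A (reflect A N u $$ (i, j)) =
        (\<Oplus>a\<in>{..<N}. \<Oplus>b\<in>{..<N}. adj A ((refl_coeff N i a * refl_coeff N b j) \<odot> u $$ (a, b)))"
      unfolding reflect_sum[OF u ij] using uD
      by (subst adj_finsum) (auto simp: adj_finsum adj_closed intro!: finsum_closed finsum_cong')
    also have "\<dots> = reflect A N u $$ (i, j)"
      unfolding reflect_sum[OF u ij] using uD orth
      by (auto simp: adj_smult cnj_refl_coeff orthogonal_relations_def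
          intro!: finsum_closed finsum_cong')
    finally show ?thesis .
  qed
  with orth show ?thesis
    by (simp add: orthogonal_relations_def reflect_transpose[OF u] reflect_mult u transpose_mats reflect_one)
qed

lemma reflect_invertible:
  assumes u: "u \<in> alg_mats A N" and inv: "alg_invertible A N u"
  shows "alg_invertible A N (reflect A N u)"
proof -
  obtain w where w: "w \<in> alg_mats A N" "alg_mat_mult A u w = alg_one_mat A N" "alg_mat_mult A w u = alg_one_mat A N"
    using inv unfolding alg_invertible_def by blast
  show ?thesis
    unfolding alg_invertible_def
    using w by (intro bexI[of _ "reflect A N w"]) (simp_all add: reflect_mult u reflect_one reflect_mats)
qed

lemma star_subalgebra_finsum:
  assumes S: "star_subalgebra A S" and f: "f \<in> I \<rightarrow> S"
  shows "(\<Oplus>i\<in>I. f i) \<in> S"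
proof -
  have SA: "S \<subseteq> carrier A" and add: "\<And>x y. x \<in> S \<Longrightarrow> y \<in> S \<Longrightarrow> x \<oplus> y \<in> S"
    using S by (auto simp: star_subalgebra_def)
  have "0 \<odot> \<one> \<in> S" using S unfolding star_subalgebra_def by blast
  then have zero: "\<zero> \<in> S" by simp
  show ?thesis
    using f
  proof (induction I rule: infinite_finite_induct)
    case (infinite I)
    then show ?case by (simp add: finsum_infinite zero)
  next
    case (insert i I)
    then have "(\<Oplus>i\<in>insert i I. f i) = f i \<oplus> (\<Oplus>i\<in>I. f i)"
      using SA by (intro finsum_insert) auto
    then show ?case using insert add by auto
  qed (simp add: zero)
qed

lemma star_subalgebra_conj_mat:
  assumes S: "star_subalgebra A S" and fin: "finite I" and u: "\<And>a b. a \<in> I \<Longrightarrow> b \<in> I \<Longrightarrow> u a b \<in> S"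
  shows "conj_mat I T u R i j \<in> S"
proof -
  have SA: "S \<subseteq> carrier A" and smult: "\<And>c x. x \<in> S \<Longrightarrow> c \<odot> x \<in> S"
    using S by (auto simp: star_subalgebra_def)
  have uA: "u a b \<in> carrier A" if "a \<in> I" "b \<in> I" for a b using u[OF that] SA by blast
  have "conj_mat I T u R i j = (\<Oplus>a\<in>I. \<Oplus>b\<in>I. (T i a * R b j) \<odot> u a b)"
    by (rule conj_mat_eq[OF fin]) (rule uA)
  also have "\<dots> \<in> S" using u smult by (auto intro!: star_subalgebra_finsum[OF S])
  finally show ?thesis .
qed

text \<open>
  The entries of \<open>u\<close> and of its reflection are linear combinations of each other, so they generate the
  same subalgebras.
\<close>

lemma elements_reflect_subset:
  assumes u: "u \<in> alg_mats A N" and S: "star_subalgebra A S"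
  shows "elements_mat (reflect A N u) \<subseteq> S \<longleftrightarrow> elements_mat u \<subseteq> S"
proof -
  have *: "elements_mat (reflect A N w) \<subseteq> S" if w: "w \<in> alg_mats A N" "elements_mat w \<subseteq> S" for w
  proof
    fix x assume "x \<in> elements_mat (reflect A N w)"
    then obtain i j where ij: "i < N" "j < N" "x = reflect A N w $$ (i, j)"
      by (auto simp: reflect_def)
    have "w $$ (a, b) \<in> S" if "a < N" "b < N" for a b
      using w(2) elements_matI[OF alg_matsD(4)[OF w(1)] that refl] by blast
    then show "x \<in> S" unfolding ij(3) reflect_index[OF ij(1,2)]
      by (intro star_subalgebra_conj_mat[OF S]) auto
  qed
  show ?thesis using *[OF u] *[OF reflect_mats[OF u]] by (auto simp: reflect_reflect[OF u])
qed

lemma star_generated_reflect: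
  assumes u: "u \<in> alg_mats A N"
  shows "star_generated A (elements_mat (reflect A N u)) = star_generated A (elements_mat u)"
  unfolding star_generated_def
  by (intro arg_cong[where f = Inter] Collect_cong conj_cong refl elements_reflect_subset[OF u])

lemma cstar_generated_reflect:
  assumes u: "u \<in> alg_mats A N"
  shows "cstar_generated A (elements_mat (reflect A N u)) = cstar_generated A (elements_mat u)"
  unfolding cstar_generated_def
  by (intro arg_cong[where f = Inter] Collect_cong conj_cong refl elements_reflect_subset[OF u])
    (simp add: cstar_subalgebra_def)

end

lemma hom_reflect:
  assumes A: "cstar_algebra A" and B: "cstar_algebra B" and \<phi>: "lin_map A B \<phi>"
    and u: "u \<in> alg_mats A N" and w: "\<And>i j. i < N \<Longrightarrow> j < N \<Longrightarrow> \<phi> (u $$ (i, j)) = w $$ (i, j)"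
    and ij: "i < N" "j < N"
  shows "\<phi> (reflect A N u $$ (i, j)) = reflect B N w $$ (i, j)"
proof -
  interpret A: cstar_algebra A by fact
  interpret B: cstar_algebra B by fact
  note uD = alg_matsD[OF u]
  have wc: "w $$ (a, b) \<in> carrier B" if "a < N" "b < N" for a b
    using w[OF that] \<phi> uD(3)[OF that] by (force simp: lin_map_def Pi_iff)
  have "\<phi> (reflect A N u $$ (i, j)) =
      B.conj_mat {..<N} (refl_coeff N) (\<lambda>a b. \<phi> (u $$ (a, b))) (refl_coeff N) i j"
    unfolding A.reflect_index[OF ij] using uD by (intro lin_map_conj_mat[OF A B \<phi>]) auto
  also have "\<dots> = reflect B N w $$ (i, j)"
    unfolding B.reflect_index[OF ij] using w wc by (intro B.conj_mat_cong) auto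
  finally show ?thesis .
qed

lemma conj_qgrp_reflect:
  assumes "cstar_algebra (fun_alg G)" "fund G \<in> alg_mats (fun_alg G) N"
  shows "conj_qgrp (Tmat N (tau N)) G = G\<lparr>fund := reflect (fun_alg G) N (fund G)\<rparr>"
  unfolding conj_qgrp_def Tmat_tau by (simp only: cstar_algebra.sandwich_refl_mat[OF assms])

lemma cmqgD:
  assumes "cmqg N G"
  shows "cstar_algebra (fun_alg G)" "fund G \<in> alg_mats (fun_alg G) N"
    "cstar_generated (fun_alg G) (elements_mat (fund G)) = carrier (fun_alg G)"
  using assms by (simp_all add: cmqg_def Let_def)

text \<open>
  Algebra and comultiplication stay the same. The comultiplication has the required form on the new
  entries because \<open>T T = 1\<close> can be inserted between the two tensor factors.
\<close>

theorem cmqg_reflect: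
  assumes G: "cmqg N (G :: 'a qgrp)"
  shows "cmqg N (G\<lparr>fund := reflect (fun_alg G) N (fund G)\<rparr>)"
proof -
  let ?A = "fun_alg G" and ?u = "fund G"
  note A = cmqgD(1)[OF G] and u = cmqgD(2)[OF G]
  interpret A: cstar_algebra ?A by fact
  note uD = alg_matsD[OF u]
  have inv: "alg_invertible ?A N ?u" "alg_invertible ?A N (transpose_mat ?u)"
    and univ: "\<forall>q. cstar_seminorm_on ?A (star_generated ?A (elements_mat ?u)) q \<longrightarrow>
        (\<forall>x\<in>star_generated ?A (elements_mat ?u). q x \<le> nrm ?A x)"
    using G by (simp_all add: cmqg_def Let_def)
  have "\<exists>(C :: 'a cstar) t \<Delta>. min_tensor_square ?A C t \<and> unital_star_hom ?A C \<Delta> \<and>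
      (\<forall>i<N. \<forall>j<N. \<Delta> (?u $$ (i, j)) = (\<Oplus>\<^bsub>C\<^esub>k\<in>{..<N}. t (?u $$ (i, k)) (?u $$ (k, j))))"
    using G by (simp add: cmqg_def Let_def)
  then obtain C :: "'a cstar" and t \<Delta> where C: "min_tensor_square ?A C t" and \<Delta>: "unital_star_hom ?A C \<Delta>"
    and comult: "\<And>i j. i < N \<Longrightarrow> j < N \<Longrightarrow> \<Delta> (?u $$ (i, j)) = (\<Oplus>\<^bsub>C\<^esub>k\<in>{..<N}. t (?u $$ (i, k)) (?u $$ (k, j)))"
    by blast
  have C': "cstar_algebra C" using C by (simp add: min_tensor_square_def)
  interpret C: cstar_algebra C by fact
  have t1: "lin_map ?A C (\<lambda>x. t x y)" and t2: "lin_map ?A C (t y)" if "y \<in> carrier ?A" for y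
    using C that by (auto simp: min_tensor_square_def lin_map_def)
  have tc: "t x y \<in> carrier C" if "x \<in> carrier ?A" "y \<in> carrier ?A" for x y
    using C that by (auto simp: min_tensor_square_def)
  have "\<Delta> (reflect ?A N ?u $$ (i, j)) = (\<Oplus>\<^bsub>C\<^esub>k\<in>{..<N}. t (reflect ?A N ?u $$ (i, k)) (reflect ?A N ?u $$ (k, j)))"
    if ij: "i < N" "j < N" for i j
  proof -
    have "\<Delta> (reflect ?A N ?u $$ (i, j)) =
        C.conj_mat {..<N} (refl_coeff N) (\<lambda>a b. \<Delta> (?u $$ (a, b))) (refl_coeff N) i j"
      unfolding A.reflect_index[OF ij] using uD by (intro lin_map_conj_mat[OF A C' lin_map_hom[OF \<Delta>]]) auto
    also have "\<dots> = C.conj_mat {..<N} (refl_coeff N) (\<lambda>a b. \<Oplus>\<^bsub>C\<^esub>k\<in>{..<N}. t (?u $$ (a, k)) (?u $$ (k, b))) (refl_coeff N) i j"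
      using uD tc by (intro C.conj_mat_cong) (auto simp: comult intro!: C.finsum_closed)
    also have "\<dots> = (\<Oplus>\<^bsub>C\<^esub>k\<in>{..<N}. t (A.conj_mat {..<N} (refl_coeff N) (\<lambda>a b. ?u $$ (a, b)) (refl_coeff N) i k)
        (A.conj_mat {..<N} (refl_coeff N) (\<lambda>a b. ?u $$ (a, b)) (refl_coeff N) k j))"
      using uD by (intro C.conj_mat_mult[OF A _ t1 t2, symmetric]) (auto simp: refl_coeff_square)
    also have "\<dots> = (\<Oplus>\<^bsub>C\<^esub>k\<in>{..<N}. t (reflect ?A N ?u $$ (i, k)) (reflect ?A N ?u $$ (k, j)))"
      using uD ij tc by (intro C.finsum_cong') (auto simp: A.reflect_index intro!: tc A.conj_mat_closed)
    finally show ?thesis .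
  qed
  then show ?thesis
    using C \<Delta> A u univ cmqgD(3)[OF G] A.reflect_invertible[OF u inv(1)]
      A.reflect_invertible[OF A.transpose_mats[OF u] inv(2)]
    unfolding cmqg_def Let_def
    by (simp add: A.reflect_mats A.cstar_generated_reflect A.star_generated_reflect A.reflect_transpose) blast
qed

lemma lin_functional_finsum:
  fixes e :: "'a \<Rightarrow> complex"
  assumes A: "cstar_algebra A" and add: "\<And>x y. x \<in> carrier A \<Longrightarrow> y \<in> carrier A \<Longrightarrow> e (x \<oplus>\<^bsub>A\<^esub> y) = e x + e y"
    and f: "f \<in> I \<rightarrow> carrier A" and fin: "finite I"
  shows "e (\<Oplus>\<^bsub>A\<^esub>i\<in>I. f i) = (\<Sum>i\<in>I. e (f i))"
proof -
  interpret cstar_algebra A by fact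
  have "e (\<zero>\<^bsub>A\<^esub> \<oplus>\<^bsub>A\<^esub> \<zero>\<^bsub>A\<^esub>) = e \<zero>\<^bsub>A\<^esub> + e \<zero>\<^bsub>A\<^esub>" by (rule add) simp_all
  then have e0: "e \<zero>\<^bsub>A\<^esub> = 0" by simp
  show ?thesis
    using fin f by (induction I rule: finite_induct) (simp_all add: e0 add Pi_iff finsum_closed)
qed

text \<open>
  Permutation matrices commute with the reflection.
\<close>

lemma perm_mats_reflect:
  assumes g: "g \<in> perm_mats N" and ij: "i < N" "j < N"
  shows "(\<Sum>a<N. \<Sum>b<N. refl_coeff N i a * refl_coeff N b j * g $$ (a, b)) = g $$ (i, j)"
proof -
  obtain \<pi> where \<pi>: "\<pi> permutes {..<N}" and g_def: "g = mat N N (\<lambda>(i, j). if i = \<pi> j then 1 else 0)"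
    using g by (auto simp: perm_mats_def)
  have \<pi>N: "\<pi> b < N" if "b < N" for b using permutes_in_image[OF \<pi>, of b] that by simp
  have "(\<Sum>a<N. \<Sum>b<N. refl_coeff N i a * refl_coeff N b j * g $$ (a, b)) =
      (\<Sum>b<N. \<Sum>a<N. refl_coeff N i a * refl_coeff N b j * g $$ (a, b))"
    by (rule sum.swap)
  also have "\<dots> = (\<Sum>b<N. refl_coeff N i (\<pi> b) * refl_coeff N b j)"
    by (intro sum.cong refl) (use \<pi>N in \<open>simp add: g_def if_distrib cong: if_cong\<close>)
  also have "\<dots> = (\<Sum>b<N. refl_coeff N (inv_into UNIV \<pi> i) b * refl_coeff N b j)"
    using permutes_inv_eq[OF \<pi>, of i] by (intro sum.cong refl) (auto simp: refl_coeff_def)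
  also have "\<dots> = (if inv_into UNIV \<pi> i = j then 1 else 0)"
    using permutes_in_image[OF permutes_inv[OF \<pi>], of i] ij by (intro refl_coeff_square) auto
  also have "\<dots> = g $$ (i, j)"
    using ij permutes_inv_eq[OF \<pi>, of i j] by (auto simp: g_def)
  finally show ?thesis .
qed

text \<open>
  The homomorphism given for \<open>G\<close> works, because the reflection fixes the fundamental representation
  of the symmetric group. Elements of the target are functions on the permutation matrices, so this can
  be checked at each of these matrices.
\<close>

theorem sym_qsubgroup_reflect:
  assumes A: "cstar_algebra (fun_alg G)" and u: "fund G \<in> alg_mats (fun_alg G) N"
    and sub: "qsubgroup (sym_qgrp N) G"
  shows "qsubgroup (sym_qgrp N) (G\<lparr>fund := reflect (fun_alg G) N (fund G)\<rparr>)"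
proof -
  let ?A = "fun_alg G" and ?u = "fund G" and ?S = "fun_alg (sym_qgrp N)"
  interpret A: cstar_algebra ?A by fact
  note uD = alg_matsD[OF u]
  obtain \<phi> where \<phi>: "unital_star_hom ?A ?S \<phi>" "\<phi> ` carrier ?A = carrier ?S"
    and \<phi>u: "\<And>i j. i < N \<Longrightarrow> j < N \<Longrightarrow> \<phi> (?u $$ (i, j)) = fund (sym_qgrp N) $$ (i, j)"
    using sub uD unfolding qsubgroup_def by auto
  note hom = unital_star_homD[OF \<phi>(1)]
  have "\<phi> (reflect ?A N ?u $$ (i, j)) = fund (sym_qgrp N) $$ (i, j)" if ij: "i < N" "j < N" for i j
  proof
    fix g
    have add: "\<phi> (x \<oplus>\<^bsub>?A\<^esub> y) g = \<phi> x g + \<phi> y g" if "x \<in> carrier ?A" "y \<in> carrier ?A" for x y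
      using hom(3)[OF that] by (simp add: sym_qgrp_def)
    have smult: "\<phi> (c \<odot>\<^bsub>?A\<^esub> x) g = c * \<phi> x g" if "x \<in> carrier ?A" for c x
      using hom(5)[OF that] by (simp add: sym_qgrp_def)
    show "\<phi> (reflect ?A N ?u $$ (i, j)) g = (fund (sym_qgrp N) $$ (i, j)) g"
    proof (cases "g \<in> perm_mats N")
      case True
      have "\<phi> (reflect ?A N ?u $$ (i, j)) g = (\<Sum>a<N. \<Sum>b<N. refl_coeff N i a * refl_coeff N b j * \<phi> (?u $$ (a, b)) g)"
        using ij uD
        by (simp add: A.reflect_sum[OF u] lin_functional_finsum[OF A, of "\<lambda>x. \<phi> x g"] add smult
            A.finsum_closed)
      also have "\<dots> = (\<Sum>a<N. \<Sum>b<N. refl_coeff N i a * refl_coeff N b j * g $$ (a, b))"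
        using True by (intro sum.cong refl) (simp add: \<phi>u, simp add: sym_qgrp_def)
      also have "\<dots> = g $$ (i, j)" by (rule perm_mats_reflect[OF True ij])
      finally show ?thesis using True ij by (simp add: sym_qgrp_def)
    next
      case False
      have "\<phi> (reflect ?A N ?u $$ (i, j)) \<in> carrier ?S"
        using alg_matsD(3)[OF A.reflect_mats[OF u] ij] by (rule hom(1))
      then show ?thesis using False ij by (simp add: sym_qgrp_def)
    qed
  qed
  then show ?thesis
    using \<phi> sub uD unfolding qsubgroup_def by (auto simp: reflect_def)
qed

text \<open>
  The elements fixed by \<open>\<alpha> \<circ> \<alpha>\<close> form a *-subalgebra; it is closed because \<open>\<alpha>\<close> is contractive.
\<close>

lemma hom_involution_on_generators:
  assumes A: "cstar_algebra A" and \<alpha>: "unital_star_hom A A \<alpha>"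
    and gen: "cstar_generated A X = carrier A" and X: "X \<subseteq> carrier A" "\<And>x. x \<in> X \<Longrightarrow> \<alpha> (\<alpha> x) = x"
    and x: "x \<in> carrier A"
  shows "\<alpha> (\<alpha> x) = x"
proof -
  interpret cstar_algebra A by fact
  note hom = unital_star_homD[OF \<alpha>]
  let ?S = "{x \<in> carrier A. \<alpha> (\<alpha> x) = x}"
  have star: "star_subalgebra A ?S"
    unfolding star_subalgebra_def using hom by (auto simp: adj_closed)
  have "cstar_subalgebra A ?S"
    unfolding cstar_subalgebra_def
  proof (intro conjI star allI impI)
    fix s :: "nat \<Rightarrow> 'a" and x
    assume "(\<forall>n. s n \<in> ?S) \<and> x \<in> carrier A \<and> (\<lambda>n. nrm A (s n \<ominus>\<^bsub>A\<^esub> x)) \<longlonglongrightarrow> 0"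
    then have s: "\<And>n. s n \<in> carrier A" "\<And>n. \<alpha> (\<alpha> (s n)) = s n" and x: "x \<in> carrier A"
      and lim: "(\<lambda>n. nrm A (s n \<ominus>\<^bsub>A\<^esub> x)) \<longlonglongrightarrow> 0" by auto
    have minus: "\<alpha> (y \<ominus>\<^bsub>A\<^esub> z) = \<alpha> y \<ominus>\<^bsub>A\<^esub> \<alpha> z" if "y \<in> carrier A" "z \<in> carrier A" for y z
      using that by (simp add: a_minus_def smult_minus_1 hom)
    have "\<alpha> (\<alpha> x) = x"
    proof (rule limit_unique[OF s(1) _ x _ lim])
      show "(\<lambda>n. nrm A (s n \<ominus>\<^bsub>A\<^esub> \<alpha> (\<alpha> x))) \<longlonglongrightarrow> 0"
      proof (rule limit_dominated[OF lim, where C = 1])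
        fix n
        have "s n \<ominus>\<^bsub>A\<^esub> \<alpha> (\<alpha> x) = \<alpha> (\<alpha> (s n \<ominus>\<^bsub>A\<^esub> x))"
          using s x by (simp add: minus hom)
        then show "nrm A (s n \<ominus>\<^bsub>A\<^esub> \<alpha> (\<alpha> x)) \<le> 1 * nrm A (s n \<ominus>\<^bsub>A\<^esub> x)"
          using star_hom_contractive[OF A A \<alpha>, of "s n \<ominus>\<^bsub>A\<^esub> x"] star_hom_contractive[OF A A \<alpha>, of "\<alpha> (s n \<ominus>\<^bsub>A\<^esub> x)"]
            s(1)[of n] x by (simp add: hom)
      qed (simp_all add: s x hom)
    qed (simp_all add: x hom)
    then show "x \<in> ?S" using x by simp
  qed
  then have "cstar_generated A X \<subseteq> ?S" unfolding cstar_generated_def using X by blast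
  then show ?thesis using gen x by blast
qed

text \<open>
  The universal property, applied to the algebra of \<open>Q\<close> and the reflected generators, yields an
  endomorphism \<open>\<alpha>\<close> of this algebra. It is an involution and hence onto, so its composition with the
  given surjection from the algebra of \<open>Q\<close> to that of \<open>G\<close> is again onto.
\<close>

theorem qsubgroup_free_orthogonal_reflect:
  fixes Q :: "'q qgrp"
  assumes Q: "free_orthogonal N Q" and A: "cstar_algebra (fun_alg G)" and u: "fund G \<in> alg_mats (fun_alg G) N"
    and sub: "qsubgroup G Q"
  shows "qsubgroup (G\<lparr>fund := reflect (fun_alg G) N (fund G)\<rparr>) Q"
proof -
  let ?A = "fun_alg G" and ?D = "fun_alg Q" and ?u = "fund G" and ?w = "fund Q"
  have D: "cstar_algebra ?D" and w: "?w \<in> alg_mats ?D N"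
    and gen: "cstar_generated ?D (elements_mat ?w) = carrier ?D" and orth: "orthogonal_relations ?D N ?w"
    and univ: "\<And>(D :: 'q cstar) w. cstar_algebra D \<Longrightarrow> w \<in> alg_mats D N \<Longrightarrow> orthogonal_relations D N w \<Longrightarrow>
        (\<exists>\<phi>. unital_star_hom ?D D \<phi> \<and> (\<forall>i<N. \<forall>j<N. \<phi> (?w $$ (i, j)) = w $$ (i, j)))"
    using Q by (auto simp: free_orthogonal_def Let_def)
  interpret D: cstar_algebra ?D by fact
  interpret A: cstar_algebra ?A by fact
  note wD = alg_matsD[OF w] and uD = alg_matsD[OF u]
  obtain \<psi> where \<psi>: "unital_star_hom ?D ?A \<psi>" "\<psi> ` carrier ?D = carrier ?A"
    and \<psi>w: "\<And>i j. i < N \<Longrightarrow> j < N \<Longrightarrow> \<psi> (?w $$ (i, j)) = ?u $$ (i, j)"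
    using sub wD unfolding qsubgroup_def by auto
  obtain \<alpha> where \<alpha>: "unital_star_hom ?D ?D \<alpha>"
    and \<alpha>w: "\<And>i j. i < N \<Longrightarrow> j < N \<Longrightarrow> \<alpha> (?w $$ (i, j)) = reflect ?D N ?w $$ (i, j)"
    using univ[OF D D.reflect_mats[OF w] D.reflect_orthogonal[OF w orth]] by blast
  note h\<alpha> = unital_star_homD[OF \<alpha>] and h\<psi> = unital_star_homD[OF \<psi>(1)]
  have \<alpha>\<alpha>: "\<alpha> (\<alpha> x) = x" if "x \<in> carrier ?D" for x
  proof (rule hom_involution_on_generators[OF D \<alpha> gen _ _ that])
    show "elements_mat ?w \<subseteq> carrier ?D" using wD by auto
    fix x assume "x \<in> elements_mat ?w"
    then obtain i j where ij: "i < N" "j < N" "x = ?w $$ (i, j)" using wD by auto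
    then show "\<alpha> (\<alpha> x) = x"
      using hom_reflect[OF D D lin_map_hom[OF \<alpha>] w \<alpha>w ij(1,2)] by (simp add: \<alpha>w D.reflect_reflect[OF w])
  qed
  have "\<alpha> ` carrier ?D = carrier ?D"
    using \<alpha>\<alpha> h\<alpha>(1) by (metis bij_betw_byWitness bij_betw_imp_surj_on image_subsetI)
  then have onto: "(\<psi> \<circ> \<alpha>) ` carrier ?D = carrier ?A" using \<psi>(2) by (metis image_comp)
  have "unital_star_hom ?D ?A (\<psi> \<circ> \<alpha>)"
    unfolding unital_star_hom_def Ring.ring_hom_def using h\<alpha> h\<psi> by auto
  moreover have "(\<psi> \<circ> \<alpha>) (?w $$ (i, j)) = reflect ?A N ?u $$ (i, j)" if "i < N" "j < N" for i j
    using hom_reflect[OF D A lin_map_hom[OF \<psi>(1)] w \<psi>w that] by (simp add: \<alpha>w that)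
  ultimately show ?thesis
    using onto wD unfolding qsubgroup_def by (auto simp: reflect_def intro!: exI[of _ "\<psi> \<circ> \<alpha>"])
qed

section \<open>Intertwiners of the reflected quantum group\<close>

definition mcomp :: "'i set \<Rightarrow> ('h \<Rightarrow> 'i \<Rightarrow> complex) \<Rightarrow> ('i \<Rightarrow> 'j \<Rightarrow> complex) \<Rightarrow> 'h \<Rightarrow> 'j \<Rightarrow> complex" where
  "mcomp I f g j i = (\<Sum>a\<in>I. f j a * g a i)"

lemma mcomp_assoc: "mcomp J (mcomp I f g) h j i = mcomp I f (mcomp J g h) j i"
  unfolding mcomp_def sum_distrib_left sum_distrib_right
  by (subst sum.swap) (simp add: mult.assoc)

lemma mcomp_cong:
  assumes "\<And>a. a \<in> I \<Longrightarrow> f j a = f' j a" "\<And>a. a \<in> I \<Longrightarrow> g a i = g' a i"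
  shows "mcomp I f g j i = mcomp I f' g' j i"
  unfolding mcomp_def using assms by (intro sum.cong) auto

lemma mcomp_id_right:
  assumes "finite I" "i \<in> I" "\<And>a. a \<in> I \<Longrightarrow> g a i = (if a = i then 1 else 0)"
  shows "mcomp I f g j i = f j i"
proof -
  have "mcomp I f g j i = (\<Sum>a\<in>I. if a = i then f j a else 0)"
    unfolding mcomp_def using assms by (intro sum.cong) auto
  then show ?thesis using assms by simp
qed

lemma mcomp_id_left:
  assumes "finite I" "j \<in> I" "\<And>a. a \<in> I \<Longrightarrow> f j a = (if j = a then 1 else 0)"
  shows "mcomp I f g j i = g j i"
proof -
  have "mcomp I f g j i = (\<Sum>a\<in>I. if j = a then g a i else 0)"
    unfolding mcomp_def using assms by (intro sum.cong) auto
  then show ?thesis using assms by simp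
qed

abbreviation refl_pow :: "nat \<Rightarrow> nat \<Rightarrow> tmap" where
  "refl_pow N k \<equiv> Tmap N k k (tau_pow N k)"

lemma refl_pow_square:
  assumes "N \<ge> 1" "j \<in> multi_idx N k" "i \<in> multi_idx N k"
  shows "mcomp (multi_idx N k) (refl_pow N k) (refl_pow N k) j i = (if j = i then 1 else 0)"
proof -
  have "mcomp (multi_idx N k) (refl_pow N k) (refl_pow N k) j i =
      Tmap N k k (lcomp N (tau_pow N k) (tau_pow N k)) j i"
    unfolding mcomp_def by (rule Tmap_lcomp[OF tau_pow_Plin tau_pow_Plin, symmetric])
  then show ?thesis using assms by (auto simp: lcomp_tau_pow Tmap_basis delta_id_pow)
qed

lemma tau_pow_Suc_left: "tau_pow N (Suc k) = ltensor 1 1 (tau N) (tau_pow N k)"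
  using tau_pow_add[of N 1 k] ltensor_empty_left[OF tau_Plin] by simp

lemma refl_pow_Cons:
  assumes "x < N" "y < N" "i \<in> multi_idx N k" "j \<in> multi_idx N k"
  shows "refl_pow N (Suc k) (x # i) (y # j) = refl_coeff N x y * refl_pow N k i j"
  using Tmap_ltensor[OF tau_Plin tau_pow_Plin, of "[x]" N "[y]" i k j] assms
  by (simp add: tau_pow_Suc_left multi_idx_1 Tmap_tau del: tau_pow.simps)

definition conj_tmap :: "nat \<Rightarrow> nat \<Rightarrow> nat \<Rightarrow> tmap \<Rightarrow> tmap" where
  "conj_tmap N k l S = mcomp (multi_idx N l) (refl_pow N l) (mcomp (multi_idx N k) S (refl_pow N k))"

lemma Tmap_calT:
  assumes f: "f \<in> Plin k l"
  shows "Tmap N k l (calT N k l f) = conj_tmap N k l (Tmap N k l f)"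
proof (intro ext)
  fix j i
  show "Tmap N k l (calT N k l f) j i = conj_tmap N k l (Tmap N k l f) j i"
    unfolding calT_def conj_tmap_def mcomp_def
    by (simp add: Tmap_lcomp[OF lcomp_Plin[OF tau_pow_Plin f] tau_pow_Plin] Tmap_lcomp[OF tau_pow_Plin f])
qed

lemma conj_tmap_tmaps: "conj_tmap N k l S \<in> tmaps N k l"
proof -
  have "conj_tmap N k l S j i = 0" if "\<not> (j \<in> multi_idx N l \<and> i \<in> multi_idx N k)" for j i
    unfolding conj_tmap_def mcomp_def using that by (auto simp: Tmap_outside)
  then show ?thesis unfolding tmaps_def by blast
qed

context
  fixes N :: nat assumes N: "N \<ge> 1"
begin

lemma conj_tmap_mult_right:
  assumes "i \<in> multi_idx N k"
  shows "mcomp (multi_idx N k) (conj_tmap N k l S) (refl_pow N k) j i =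
    mcomp (multi_idx N l) (refl_pow N l) S j i"
proof -
  let ?K = "multi_idx N k" and ?L = "multi_idx N l" and ?t = "refl_pow N k"
  have "mcomp ?K (conj_tmap N k l S) ?t j i = mcomp ?L (refl_pow N l) (mcomp ?K (mcomp ?K S ?t) ?t) j i"
    unfolding conj_tmap_def by (rule mcomp_assoc)
  also have "\<dots> = mcomp ?L (refl_pow N l) S j i"
  proof (rule mcomp_cong[OF refl])
    fix a
    have "mcomp ?K (mcomp ?K S ?t) ?t a i = mcomp ?K S (mcomp ?K ?t ?t) a i" by (rule mcomp_assoc)
    also have "\<dots> = S a i"
      by (rule mcomp_id_right) (use assms in \<open>simp_all add: refl_pow_square[OF N]\<close>)
    finally show "mcomp ?K (mcomp ?K S ?t) ?t a i = S a i" .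
  qed
  finally show ?thesis .
qed

lemma conj_tmap_mult_left:
  assumes "j \<in> multi_idx N l"
  shows "mcomp (multi_idx N l) (refl_pow N l) (conj_tmap N k l S) j i =
    mcomp (multi_idx N k) S (refl_pow N k) j i"
proof -
  let ?L = "multi_idx N l" and ?t = "refl_pow N l"
  have "mcomp ?L ?t (conj_tmap N k l S) j i = mcomp ?L (mcomp ?L ?t ?t) (mcomp (multi_idx N k) S (refl_pow N k)) j i"
    unfolding conj_tmap_def by (rule mcomp_assoc[symmetric])
  also have "\<dots> = mcomp (multi_idx N k) S (refl_pow N k) j i"
    by (rule mcomp_id_left) (use assms in \<open>simp_all add: refl_pow_square[OF N]\<close>)
  finally show ?thesis .
qed

lemma conj_tmap_conj_tmap:
  assumes S: "S \<in> tmaps N k l"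
  shows "conj_tmap N k l (conj_tmap N k l S) = S"
proof (intro ext)
  fix j i
  let ?L = "multi_idx N l" and ?t = "refl_pow N l"
  show "conj_tmap N k l (conj_tmap N k l S) j i = S j i"
  proof (cases "j \<in> multi_idx N l \<and> i \<in> multi_idx N k")
    case True
    have "conj_tmap N k l (conj_tmap N k l S) j i = mcomp ?L ?t (mcomp ?L ?t S) j i"
      unfolding conj_tmap_def[of N k l "conj_tmap N k l S"]
      by (rule mcomp_cong[OF refl]) (use True in \<open>simp add: conj_tmap_mult_right\<close>)
    also have "\<dots> = mcomp ?L (mcomp ?L ?t ?t) S j i" by (rule mcomp_assoc[symmetric])
    also have "\<dots> = S j i" by (rule mcomp_id_left) (use True in \<open>simp_all add: refl_pow_square[OF N]\<close>)
    finally show ?thesis .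
  next
    case False
    then have "conj_tmap N k l (conj_tmap N k l S) j i = 0" "S j i = 0"
      using S conj_tmap_tmaps[of N k l "conj_tmap N k l S"] unfolding tmaps_def by blast+
    then show ?thesis by simp
  qed
qed

end

lemma multi_idx_Suc: "multi_idx N (Suc k) = (\<Union>a\<in>{..<N}. (#) a ` multi_idx N k)"
proof (intro equalityI subsetI)
  fix xs assume "xs \<in> multi_idx N (Suc k)"
  then obtain a c where "xs = a # c" "a < N" "c \<in> multi_idx N k"
    by (auto simp: multi_idx_def length_Suc_conv)
  then show "xs \<in> (\<Union>a\<in>{..<N}. (#) a ` multi_idx N k)" by blast
qed (auto simp: multi_idx_def)

context cstar_algebra
begin

lemma finsum_multi_idx_Suc:
  assumes f: "\<And>a c. a < N \<Longrightarrow> c \<in> multi_idx N k \<Longrightarrow> f (a # c) \<in> carrier A"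
  shows "(\<Oplus>p\<in>multi_idx N (Suc k). f p) = (\<Oplus>a\<in>{..<N}. \<Oplus>c\<in>multi_idx N k. f (a # c))"
proof -
  have "(\<Oplus>p\<in>multi_idx N (Suc k). f p) = (\<Oplus>a\<in>{..<N}. \<Oplus>p\<in>(#) a ` multi_idx N k. f p)"
    unfolding multi_idx_Suc by (rule add.finprod_UN_disjoint) (auto simp: pairwise_def disjnt_def f)
  also have "\<dots> = (\<Oplus>a\<in>{..<N}. \<Oplus>c\<in>multi_idx N k. f (a # c))"
    by (intro finsum_cong' finsum_reindex) (auto simp: f inj_on_def intro!: finsum_closed)
  finally show ?thesis .
qed

lemma rep_pow_simps [simp]:
  "rep_pow A u [] j = \<one>" "rep_pow A u (x # i) (y # j) = u $$ (x, y) \<otimes> rep_pow A u i j"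
  by (simp_all add: rep_pow_def)

lemma rep_pow_closed:
  assumes u: "u \<in> alg_mats A N"
  shows "i \<in> multi_idx N k \<Longrightarrow> j \<in> multi_idx N k \<Longrightarrow> rep_pow A u i j \<in> carrier A"
proof (induction k arbitrary: i j)
  case (Suc k)
  then obtain x i' y j' where "i = x # i'" "j = y # j'" "x < N" "y < N" "i' \<in> multi_idx N k" "j' \<in> multi_idx N k"
    by (auto simp: multi_idx_Suc)
  then show ?case using Suc.IH alg_matsD(3)[OF u] by simp
qed simp

lemma product_of_double_sums:
  assumes fin: "finite I" "finite J" and x: "\<And>a b. a \<in> I \<Longrightarrow> b \<in> I \<Longrightarrow> x a b \<in> carrier A"
    and y: "\<And>c d. c \<in> J \<Longrightarrow> d \<in> J \<Longrightarrow> y c d \<in> carrier A"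
  shows "(\<Oplus>a\<in>I. \<Oplus>b\<in>I. x a b) \<otimes> (\<Oplus>c\<in>J. \<Oplus>d\<in>J. y c d) =
    (\<Oplus>a\<in>I. \<Oplus>c\<in>J. \<Oplus>b\<in>I. \<Oplus>d\<in>J. x a b \<otimes> y c d)"
proof -
  have inner: "(\<Oplus>b\<in>I. x a b) \<otimes> (\<Oplus>d\<in>J. y c d) = (\<Oplus>b\<in>I. \<Oplus>d\<in>J. x a b \<otimes> y c d)" if "a \<in> I" "c \<in> J" for a c
    using that fin x y
    by (subst finsum_ldistr) (auto intro!: finsum_closed finsum_cong' finsum_rdistr)
  have "(\<Oplus>a\<in>I. \<Oplus>b\<in>I. x a b) \<otimes> (\<Oplus>c\<in>J. \<Oplus>d\<in>J. y c d) =
      (\<Oplus>a\<in>I. (\<Oplus>b\<in>I. x a b) \<otimes> (\<Oplus>c\<in>J. \<Oplus>d\<in>J. y c d))"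
    using fin x y by (intro finsum_ldistr) (auto intro!: finsum_closed)
  also have "\<dots> = (\<Oplus>a\<in>I. \<Oplus>c\<in>J. (\<Oplus>b\<in>I. x a b) \<otimes> (\<Oplus>d\<in>J. y c d))"
    using fin x y by (intro finsum_cong' finsum_rdistr refl) (auto intro!: finsum_closed)
  also have "\<dots> = (\<Oplus>a\<in>I. \<Oplus>c\<in>J. \<Oplus>b\<in>I. \<Oplus>d\<in>J. x a b \<otimes> y c d)"
    using fin x y by (intro finsum_cong' refl) (auto simp: inner intro!: finsum_closed)
  finally show ?thesis .
qed

text \<open>
  The tensor powers satisfy \<open>(T u T)\<^sup>\<otimes>\<^sup>k = T\<^sup>\<otimes>\<^sup>k u\<^sup>\<otimes>\<^sup>k T\<^sup>\<otimes>\<^sup>k\<close>. The induction splits off the first tensor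
  factor of all three tensor powers.
\<close>

lemma rep_pow_reflect:
  assumes u: "u \<in> alg_mats A N"
  shows "i \<in> multi_idx N k \<Longrightarrow> j \<in> multi_idx N k \<Longrightarrow>
    rep_pow A (reflect A N u) i j = conj_mat (multi_idx N k) (refl_pow N k) (rep_pow A u) (refl_pow N k) i j"
proof (induction k arbitrary: i j)
  case 0
  then show ?case
    by (subst conj_mat_eq) (auto simp: Tmap_basis delta_basic finsum_insert)
next
  case (Suc k)
  let ?K = "multi_idx N k" and ?R = "rep_pow A u" and ?t = "refl_pow N k" and ?s = "refl_pow N (Suc k)"
  note uc = alg_matsD(3)[OF u] and Rc = rep_pow_closed[OF u, of _ k]
  from Suc.prems obtain x i' y j' where ij: "i = x # i'" "j = y # j'" and xy: "x < N" "y < N"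
    and ij': "i' \<in> ?K" "j' \<in> ?K"
    by (auto simp: multi_idx_Suc)
  have "rep_pow A (reflect A N u) i j =
      (\<Oplus>a\<in>{..<N}. \<Oplus>b\<in>{..<N}. (refl_coeff N x a * refl_coeff N b y) \<odot> u $$ (a, b)) \<otimes>
      (\<Oplus>c\<in>?K. \<Oplus>d\<in>?K. (?t i' c * ?t d j') \<odot> ?R c d)"
    using Suc.IH[OF ij'] Rc by (simp add: ij reflect_sum[OF u xy] conj_mat_eq)
  also have "\<dots> = (\<Oplus>a\<in>{..<N}. \<Oplus>c\<in>?K. \<Oplus>b\<in>{..<N}. \<Oplus>d\<in>?K.
      ((refl_coeff N x a * refl_coeff N b y) \<odot> u $$ (a, b)) \<otimes> ((?t i' c * ?t d j') \<odot> ?R c d))"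
    using uc Rc by (intro product_of_double_sums) auto
  also have "\<dots> = (\<Oplus>a\<in>{..<N}. \<Oplus>c\<in>?K. \<Oplus>b\<in>{..<N}. \<Oplus>d\<in>?K.
      (?s i (a # c) * ?s (b # d) j) \<odot> ?R (a # c) (b # d))"
    using uc Rc xy ij'
    by (intro finsum_cong' refl) (auto simp: ij refl_pow_Cons smult_mult_left smult_mult_right smult_smult mult_ac
        simp del: tau_pow.simps intro!: finsum_closed)
  also have "\<dots> = (\<Oplus>a\<in>{..<N}. \<Oplus>c\<in>?K. \<Oplus>q\<in>multi_idx N (Suc k). (?s i (a # c) * ?s q j) \<odot> ?R (a # c) q)"
    using uc Rc by (intro finsum_cong' refl finsum_multi_idx_Suc[symmetric])
      (auto simp: multi_idx_Suc intro!: finsum_closed)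
  also have "\<dots> = (\<Oplus>p\<in>multi_idx N (Suc k). \<Oplus>q\<in>multi_idx N (Suc k). (?s i p * ?s q j) \<odot> ?R p q)"
    using uc Rc by (intro finsum_multi_idx_Suc[symmetric]) (auto simp: multi_idx_Suc intro!: finsum_closed)
  also have "\<dots> = conj_mat (multi_idx N (Suc k)) ?s ?R ?s i j"
    using rep_pow_closed[OF u, of _ "Suc k"] by (intro conj_mat_eq[symmetric]) auto
  finally show ?case .
qed

end

lemma Mor_iff:
  assumes "cstar_algebra (fun_alg G)"
  shows "S \<in> Mor N G k l \<longleftrightarrow> S \<in> tmaps N k l \<and> (\<forall>j\<in>multi_idx N l. \<forall>i\<in>multi_idx N k.
    cstar_algebra.lmul (fun_alg G) (multi_idx N k) S (rep_pow (fun_alg G) (fund G)) j i =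
    cstar_algebra.rmul (fun_alg G) (multi_idx N l) (rep_pow (fun_alg G) (fund G)) S j i)"
  by (simp add: Mor_def Let_def cstar_algebra.lmul_def[OF assms] cstar_algebra.rmul_def[OF assms])

text \<open>
  With \<open>T\<^sub>k = T\<^sup>\<otimes>\<^sup>k\<close> and \<open>S' = T\<^sub>l S T\<^sub>k\<close> the computation is
  \<open>S' T\<^sub>k u\<^sup>\<otimes>\<^sup>k T\<^sub>k = T\<^sub>l S u\<^sup>\<otimes>\<^sup>k T\<^sub>k = T\<^sub>l u\<^sup>\<otimes>\<^sup>l S T\<^sub>k = T\<^sub>l u\<^sup>\<otimes>\<^sup>l T\<^sub>l S'\<close>.
\<close>

lemma conj_tmap_Mor:
  assumes N: "N \<ge> 1" and A: "cstar_algebra (fun_alg G)" and u: "fund G \<in> alg_mats (fun_alg G) N"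
    and S: "S \<in> Mor N G k l"
  shows "conj_tmap N k l S \<in> Mor N (G\<lparr>fund := reflect (fun_alg G) N (fund G)\<rparr>) k l"
proof -
  interpret cstar_algebra "fun_alg G" by fact
  let ?A = "fun_alg G"
  let ?K = "multi_idx N k" and ?L = "multi_idx N l" and ?R = "rep_pow ?A (fund G)"
    and ?R' = "rep_pow ?A (reflect ?A N (fund G))" and ?k = "refl_pow N k" and ?l = "refl_pow N l" and ?S = "conj_tmap N k l S"
  note Rc = rep_pow_closed[OF u]
  have R': "?R' i j = conj_mat (multi_idx N m) (refl_pow N m) ?R (refl_pow N m) i j"
    if "i \<in> multi_idx N m" "j \<in> multi_idx N m" for m i j
    using rep_pow_reflect[OF u that] .
  have mor: "lmul ?K S ?R j i = rmul ?L ?R S j i" if "j \<in> ?L" "i \<in> ?K" for j i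
    using S that by (simp add: Mor_iff[OF A])
  have "lmul ?K ?S ?R' j i = rmul ?L ?R' ?S j i" if j: "j \<in> ?L" and i: "i \<in> ?K" for j i
  proof -
    have "lmul ?K ?S ?R' j i = lmul ?K ?S (lmul ?K ?k (rmul ?K ?R ?k)) j i"
      using i Rc by (intro lmul_cong) (auto simp: R' conj_mat_def)
    also have "\<dots> = lmul ?K (mcomp ?K ?S ?k) (rmul ?K ?R ?k) j i"
      unfolding mcomp_def using i Rc by (intro lmul_lmul) auto
    also have "\<dots> = lmul ?K (mcomp ?L ?l S) (rmul ?K ?R ?k) j i"
      using i Rc by (intro lmul_cong conj_tmap_mult_right[OF N]) auto
    also have "\<dots> = lmul ?L ?l (lmul ?K S (rmul ?K ?R ?k)) j i"
      unfolding mcomp_def using i Rc by (intro lmul_lmul[symmetric]) auto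
    also have "\<dots> = lmul ?L ?l (rmul ?K (lmul ?K S ?R) ?k) j i"
      using i Rc by (intro lmul_cong lmul_rmul) auto
    also have "\<dots> = lmul ?L ?l (rmul ?K (rmul ?L ?R S) ?k) j i"
      using i Rc by (intro lmul_cong rmul_cong) (auto simp: mor)
    also have "\<dots> = lmul ?L ?l (rmul ?L ?R (mcomp ?K S ?k)) j i"
      unfolding mcomp_def using i Rc by (intro lmul_cong rmul_rmul) auto
    also have "\<dots> = lmul ?L ?l (rmul ?L ?R (mcomp ?L ?l ?S)) j i"
      using i Rc by (intro lmul_cong rmul_cong conj_tmap_mult_left[OF N, symmetric]) auto
    also have "\<dots> = lmul ?L ?l (rmul ?L (rmul ?L ?R ?l) ?S) j i"
      unfolding mcomp_def using i Rc by (intro lmul_cong rmul_rmul[symmetric]) auto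
    also have "\<dots> = rmul ?L (lmul ?L ?l (rmul ?L ?R ?l)) ?S j i"
      using i Rc by (intro lmul_rmul) auto
    also have "\<dots> = rmul ?L ?R' ?S j i"
      using j Rc by (intro rmul_cong) (auto simp: R' conj_mat_def intro!: Rc rmul_closed lmul_closed)
    finally show ?thesis .
  qed
  then show ?thesis using A by (subst Mor_iff) (auto simp: conj_tmap_tmaps)
qed

text \<open>
  Conjugation maps the intertwiners of \<open>G\<close> to those of its reflection. As reflecting twice gives back
  \<open>G\<close>, it also maps them back, so it is onto.
\<close>

theorem corresponds_reflect:
  assumes N: "N \<ge> 1" and A: "cstar_algebra (fun_alg G)" and u: "fund G \<in> alg_mats (fun_alg G) N"
    and corr: "corresponds N G K"
  shows "corresponds N (G\<lparr>fund := reflect (fun_alg G) N (fund G)\<rparr>) (calT_family N K)"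
proof -
  let ?G' = "G\<lparr>fund := reflect (fun_alg G) N (fund G)\<rparr>"
  have K: "linear_category N K" and Mor: "Mor N G k l = Tmap N k l ` K k l" for k l
    using corr by (auto simp: corresponds_def)
  have KP: "f \<in> Plin k l" if "f \<in> K k l" for f k l using linear_categoryD(1)[OF K] that by blast
  have twice: "?G'\<lparr>fund := reflect (fun_alg ?G') N (fund ?G')\<rparr> = G"
    by (simp add: cstar_algebra.reflect_reflect[OF A u])
  have u': "fund ?G' \<in> alg_mats (fun_alg ?G') N" using cstar_algebra.reflect_mats[OF A u] by simp
  have A': "cstar_algebra (fun_alg ?G')" using A by simp
  have "Mor N ?G' k l = conj_tmap N k l ` Mor N G k l" for k l
  proof (intro equalityI subsetI)
    fix S assume S: "S \<in> Mor N ?G' k l"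
    then have "conj_tmap N k l S \<in> Mor N G k l" using conj_tmap_Mor[OF N A' u' S] unfolding twice by simp
    moreover have "S = conj_tmap N k l (conj_tmap N k l S)"
      using S conj_tmap_conj_tmap[OF N] by (simp add: Mor_iff[OF A'])
    ultimately show "S \<in> conj_tmap N k l ` Mor N G k l" by (metis image_eqI)
  next
    fix S assume "S \<in> conj_tmap N k l ` Mor N G k l"
    then show "S \<in> Mor N ?G' k l" using conj_tmap_Mor[OF N A u] by blast
  qed
  moreover have "conj_tmap N k l ` Mor N G k l = Tmap N k l ` calT_family N K k l" for k l
    unfolding Mor calT_family_def image_image by (intro image_cong refl Tmap_calT[symmetric] KP)
  ultimately show ?thesis
    using linear_category_calT[OF N K] by (simp add: corresponds_def)
qed

section \<open>Quantum subgroups of the bistochastic quantum group\<close>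

context cstar_algebra
begin

lemma finsum_refl_coeff:
  assumes "i < N" "\<And>a. a < N \<Longrightarrow> v a \<in> carrier A"
  shows "(\<Oplus>a\<in>{..<N}. refl_coeff N i a \<odot> v a) = v i \<oplus> (- (2 / of_nat N)) \<odot> (\<Oplus>a\<in>{..<N}. v a)"
proof -
  have "(\<Oplus>a\<in>{..<N}. refl_coeff N i a \<odot> v a) =
      (\<Oplus>a\<in>{..<N}. (if i = a then 1 else 0) \<odot> v a \<oplus> (- (2 / of_nat N)) \<odot> v a)"
  proof (rule finsum_cong')
    fix a assume "a \<in> {..<N}"
    then show "refl_coeff N i a \<odot> v a = (if i = a then 1 else 0) \<odot> v a \<oplus> (- (2 / of_nat N)) \<odot> v a"
      using smult_add_left[of "v a" "if i = a then 1 else 0" "- (2 / of_nat N)"] assms(2)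
      by (simp add: refl_coeff_def)
  qed (use assms(2) in auto)
  also have "\<dots> = (\<Oplus>a\<in>{..<N}. (if i = a then 1 else 0) \<odot> v a) \<oplus> (\<Oplus>a\<in>{..<N}. (- (2 / of_nat N)) \<odot> v a)"
    using assms by (intro finsum_addf) auto
  also have "(\<Oplus>a\<in>{..<N}. (if i = a then 1 else 0) \<odot> v a) = v i"
    using assms by (intro finsum_delta) auto
  also have "(\<Oplus>a\<in>{..<N}. (- (2 / of_nat N)) \<odot> v a) = (- (2 / of_nat N)) \<odot> (\<Oplus>a\<in>{..<N}. v a)"
    using assms by (intro smult_finsum[symmetric]) auto
  finally show ?thesis .
qed

text \<open>
  The hypothesis on the row sums makes all of them equal to one element \<open>s\<close> with \<open>s s = 1\<close>. Multiplying a
  column sum by \<open>s\<close> and writing \<open>s\<close> as a row sum gives 1 by orthogonality, so the column sums are \<open>s\<close>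
  as well. With the all-ones matrix \<open>J\<close> this says that \<open>J u\<close> and \<open>u J\<close> have all entries \<open>s\<close>, and
  \<open>J u J\<close> has all entries \<open>N s\<close>. The expansion of \<open>(1 - 2/N J) u (1 - 2/N J)\<close> is thus
  \<open>u - 2/N s - 2/N s + 4/N\<^sup>2 N s = u\<close> in each entry.
\<close>

theorem reflect_fixed:
  assumes u: "u \<in> alg_mats A N"
    and orth: "\<And>b c. b < N \<Longrightarrow> c < N \<Longrightarrow> (\<Oplus>a\<in>{..<N}. u $$ (a, b) \<otimes> u $$ (a, c)) = (if b = c then \<one> else \<zero>)"
    and rows: "\<And>a b. a < N \<Longrightarrow> b < N \<Longrightarrow> (\<Oplus>c\<in>{..<N}. u $$ (a, c)) \<otimes> (\<Oplus>c\<in>{..<N}. u $$ (b, c)) = \<one>"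
  shows "reflect A N u = u"
proof (cases "N = 0")
  case True
  then show ?thesis using alg_matsD[OF u] by (intro eq_matI) (auto simp: reflect_def)
next
  case False
  note uc = alg_matsD(3)[OF u]
  define r where "r a = (\<Oplus>c\<in>{..<N}. u $$ (a, c))" for a
  define s where "s = r 0"
  have rc: "r a \<in> carrier A" if "a < N" for a using uc that by (auto simp: r_def intro!: finsum_closed)
  have sc: "s \<in> carrier A" using rc False by (simp add: s_def)
  have ss: "s \<otimes> s = \<one>" using rows[of 0 0] False by (simp add: s_def r_def)
  have row: "r a = s" if "a < N" for a
  proof -
    have "s \<otimes> r a = \<one>" using rows[of 0 a] that False by (simp add: s_def r_def)
    then have "s \<otimes> s \<otimes> r a = s" using rc[OF that] sc by (simp add: m_assoc)
    then show ?thesis using rc[OF that] by (simp add: ss)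
  qed
  have col: "(\<Oplus>a\<in>{..<N}. u $$ (a, b)) = s" if b: "b < N" for b
  proof -
    let ?c = "\<Oplus>a\<in>{..<N}. u $$ (a, b)"
    have c: "?c \<in> carrier A" using uc b by (auto intro!: finsum_closed)
    have "?c \<otimes> s = (\<Oplus>a\<in>{..<N}. u $$ (a, b) \<otimes> s)"
      using uc b sc by (intro finsum_ldistr) auto
    also have "\<dots> = (\<Oplus>a\<in>{..<N}. \<Oplus>c\<in>{..<N}. u $$ (a, b) \<otimes> u $$ (a, c))"
    proof (intro finsum_cong' refl)
      fix a assume "a \<in> {..<N}"
      then have a: "a < N" by simp
      show "u $$ (a, b) \<otimes> s = (\<Oplus>c\<in>{..<N}. u $$ (a, b) \<otimes> u $$ (a, c))"
        unfolding row[OF a, symmetric] r_def using uc a b by (intro finsum_rdistr) auto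
    qed (use uc b in \<open>auto intro!: finsum_closed\<close>)
    also have "\<dots> = (\<Oplus>c\<in>{..<N}. \<Oplus>a\<in>{..<N}. u $$ (a, b) \<otimes> u $$ (a, c))"
      using uc b by (intro finsum_swap) auto
    also have "\<dots> = (\<Oplus>c\<in>{..<N}. if b = c then \<one> else \<zero>)"
      using b by (intro finsum_cong' refl) (auto simp: orth)
    also have "\<dots> = \<one>" using b by (intro finsum_singleton) auto
    finally have "?c \<otimes> s = \<one>" .
    then have "?c \<otimes> (s \<otimes> s) = s" using c sc by (simp add: m_assoc[symmetric])
    then show ?thesis using c by (simp add: ss)
  qed
  let ?k = "- (2 / of_nat N) :: complex"
  have inner: "rmul {..<N} (\<lambda>a b. u $$ (a, b)) (refl_coeff N) a j = u $$ (a, j) \<oplus> ?k \<odot> s" if "a < N" "j < N" for a j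
    using finsum_refl_coeff[of j N "\<lambda>b. u $$ (a, b)"] that uc row[of a]
    by (simp add: rmul_def refl_coeff_commute[of N _ j] r_def)
  show ?thesis
  proof (rule eq_matI)
    fix i j assume "i < dim_row u" "j < dim_col u"
    then have ij: "i < N" "j < N" using alg_matsD[OF u] by auto
    have "reflect A N u $$ (i, j) = (\<Oplus>a\<in>{..<N}. refl_coeff N i a \<odot> (u $$ (a, j) \<oplus> ?k \<odot> s))"
      unfolding reflect_index[OF ij] conj_mat_def lmul_def using ij uc sc
      by (intro finsum_cong' refl) (auto simp: inner)
    also have "\<dots> = u $$ (i, j) \<oplus> ?k \<odot> s \<oplus> ?k \<odot> (\<Oplus>a\<in>{..<N}. u $$ (a, j) \<oplus> ?k \<odot> s)"
      using ij uc sc by (intro finsum_refl_coeff) auto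
    also have "(\<Oplus>a\<in>{..<N}. u $$ (a, j) \<oplus> ?k \<odot> s) = s \<oplus> (\<Oplus>a\<in>{..<N}. ?k \<odot> s)"
      unfolding col[OF ij(2), symmetric] using ij uc by (intro finsum_addf) (auto intro!: finsum_closed)
    also have "(\<Oplus>a\<in>{..<N}. ?k \<odot> s) = (\<Sum>a<N. ?k) \<odot> s" using sc by (simp only: sum_smult finite_lessThan)
    also have "(\<Sum>a<N. ?k) = - 2" using False by simp
    also have "u $$ (i, j) \<oplus> ?k \<odot> s \<oplus> ?k \<odot> (s \<oplus> - 2 \<odot> s) = u $$ (i, j) \<oplus> (?k + (?k + ?k * (- 2))) \<odot> s"
      using ij uc sc by (simp only: smult_add_left smult_add_right smult_smult smult_closed a_assoc a_closed)
    also have "?k + (?k + ?k * (- 2)) = 0" by simp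
    finally show "reflect A N u $$ (i, j) = u $$ (i, j)" using ij uc sc by simp
  qed (use alg_matsD[OF u] in \<open>simp_all add: reflect_def\<close>)
qed

end

lemma up_tensor_up_Mor:
  assumes "corresponds N B (up_up_category N)"
  shows "Tmap N 0 2 up_tensor_up \<in> Mor N B 0 2"
proof -
  have "up_tensor_up \<in> up_up_category N 0 2"
    by (auto simp: up_up_category_def generated_category_def split: if_splits)
  then show ?thesis using assms by (auto simp: corresponds_def)
qed

lemma Tmap_up_tensor_up:
  assumes "j \<in> multi_idx N 2"
  shows "Tmap N 0 2 up_tensor_up j [] = 1"
proof -
  have "j \<in> multi_idx N (1 + 1)" using assms by (simp add: numeral_2_eq_2)
  then obtain j1 j2 where j: "j = j1 @ j2" "j1 \<in> multi_idx N 1" "j2 \<in> multi_idx N 1"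
    by (rule multi_idx_split)
  have "delta up_ptn i j = 1" for i j by (simp add: delta_def up_ptn_def)
  then show ?thesis
    using assms delta_ptensor[OF basic_Part(6), of "[]" N j1 up_ptn "[]" j2] j
    by (simp add: up_tensor_up_def ltensor_basis Tmap_basis)
qed

text \<open>
  The vector of \<open>\<up> \<otimes> \<up>\<close>, all of whose coordinates are 1, is fixed by \<open>u \<otimes> u\<close>. The product of two
  row sums is a coordinate of its image.
\<close>

lemma bistochastic_row_sums:
  assumes B: "cmqg N B" and corr: "corresponds N B (up_up_category N)" and ab: "a < N" "b < N"
  shows "(\<Oplus>\<^bsub>fun_alg B\<^esub>c\<in>{..<N}. fund B $$ (a, c)) \<otimes>\<^bsub>fun_alg B\<^esub> (\<Oplus>\<^bsub>fun_alg B\<^esub>c\<in>{..<N}. fund B $$ (b, c)) = \<one>\<^bsub>fun_alg B\<^esub>"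
proof -
  let ?A = "fun_alg B" and ?u = "fund B" and ?T = "Tmap N 0 2 up_tensor_up"
  interpret cstar_algebra ?A using cmqgD(1)[OF B] .
  note u = cmqgD(2)[OF B]
  note uc = alg_matsD(3)[OF u]
  have 2: "(2::nat) = Suc (Suc 0)" by simp
  have T1: "Tmap N 0 (Suc (Suc 0)) up_tensor_up [c, d] [] = 1" if "c < N" "d < N" for c d
    using Tmap_up_tensor_up[of "[c, d]" N] that by (simp add: numeral_2_eq_2 multi_idx_def)
  have j: "[a, b] \<in> multi_idx N 2" using ab by (auto simp: multi_idx_def)
  have row: "(\<Oplus>\<^bsub>?A\<^esub>c\<in>{..<N}. ?u $$ (x, c)) \<in> carrier ?A" if "x < N" for x
    using uc that by (auto intro!: finsum_closed)
  have "\<one>\<^bsub>?A\<^esub> = lmul (multi_idx N 0) ?T (rep_pow ?A ?u) [a, b] []"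
    using Tmap_up_tensor_up[OF j] by (simp add: lmul_def finsum_insert)
  also have "\<dots> = rmul (multi_idx N 2) (rep_pow ?A ?u) ?T [a, b] []"
    using up_tensor_up_Mor[OF corr] j Mor_iff[OF cmqgD(1)[OF B]] by simp
  also have "\<dots> = (\<Oplus>\<^bsub>?A\<^esub>m\<in>multi_idx N (Suc (Suc 0)). rep_pow ?A ?u [a, b] m)"
    unfolding rmul_def 2 using uc ab
    by (intro finsum_cong' refl) (auto simp: T1 multi_idx_Suc)
  also have "\<dots> = (\<Oplus>\<^bsub>?A\<^esub>c\<in>{..<N}. \<Oplus>\<^bsub>?A\<^esub>m\<in>multi_idx N (Suc 0). ?u $$ (a, c) \<otimes>\<^bsub>?A\<^esub> rep_pow ?A ?u [b] m)"
    using uc ab by (subst finsum_multi_idx_Suc) (auto simp: multi_idx_Suc)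
  also have "\<dots> = (\<Oplus>\<^bsub>?A\<^esub>c\<in>{..<N}. \<Oplus>\<^bsub>?A\<^esub>d\<in>{..<N}. ?u $$ (a, c) \<otimes>\<^bsub>?A\<^esub> ?u $$ (b, d))"
  proof (rule finsum_cong'[OF refl])
    fix c assume "c \<in> {..<N}"
    then show "(\<Oplus>\<^bsub>?A\<^esub>m\<in>multi_idx N (Suc 0). ?u $$ (a, c) \<otimes>\<^bsub>?A\<^esub> rep_pow ?A ?u [b] m) =
        (\<Oplus>\<^bsub>?A\<^esub>d\<in>{..<N}. ?u $$ (a, c) \<otimes>\<^bsub>?A\<^esub> ?u $$ (b, d))"
      using uc ab by (subst finsum_multi_idx_Suc) (auto simp: finsum_insert intro!: finsum_cong')
  qed (use uc ab in \<open>auto intro!: finsum_closed\<close>)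
  also have "\<dots> = (\<Oplus>\<^bsub>?A\<^esub>c\<in>{..<N}. ?u $$ (a, c) \<otimes>\<^bsub>?A\<^esub> (\<Oplus>\<^bsub>?A\<^esub>d\<in>{..<N}. ?u $$ (b, d)))"
    using uc ab row by (intro finsum_cong' refl finsum_rdistr[symmetric]) auto
  also have "\<dots> = (\<Oplus>\<^bsub>?A\<^esub>c\<in>{..<N}. ?u $$ (a, c)) \<otimes>\<^bsub>?A\<^esub> (\<Oplus>\<^bsub>?A\<^esub>d\<in>{..<N}. ?u $$ (b, d))"
    using uc ab row by (intro finsum_ldistr[symmetric]) auto
  finally show ?thesis by simp
qed

lemma qsubgroup_hom:
  assumes "qsubgroup H G" "fund G \<in> alg_mats (fun_alg G) N"
  obtains \<phi> where "unital_star_hom (fun_alg G) (fun_alg H) \<phi>"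
    "\<And>i j. i < N \<Longrightarrow> j < N \<Longrightarrow> \<phi> (fund G $$ (i, j)) = fund H $$ (i, j)"
  using assms(1) alg_matsD(1,2)[OF assms(2)] unfolding qsubgroup_def by auto

text \<open>
  The relation between row sums is transported along the homomorphism from the algebra of \<open>B\<close>, the
  orthogonality along the one from the algebra of \<open>Q\<close>.
\<close>

theorem reflect_bistochastic:
  assumes G: "cmqg N G" and Q: "free_orthogonal N Q" and GQ: "qsubgroup G Q"
    and B: "bistochastic_sharp N Q B" and GB: "qsubgroup G B"
  shows "reflect (fun_alg G) N (fund G) = fund G"
proof -
  let ?A = "fun_alg G" and ?u = "fund G" and ?D = "fun_alg Q" and ?w = "fund Q" and ?B = "fun_alg B"
  have B': "cmqg N B" "corresponds N B (up_up_category N)" using B by (simp_all add: bistochastic_sharp_def)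
  have D: "cstar_algebra ?D" and w: "?w \<in> alg_mats ?D N" and orthQ: "orthogonal_relations ?D N ?w"
    using Q by (simp_all add: free_orthogonal_def Let_def)
  note A = cmqgD(1)[OF G] and u = cmqgD(2)[OF G] and Bc = cmqgD(1)[OF B'(1)] and b = cmqgD(2)[OF B'(1)]
  interpret A: cstar_algebra ?A by fact
  interpret D: cstar_algebra ?D by fact
  interpret B: cstar_algebra ?B by fact
  obtain \<psi> where \<psi>: "unital_star_hom ?D ?A \<psi>" "\<And>i j. i < N \<Longrightarrow> j < N \<Longrightarrow> \<psi> (?w $$ (i, j)) = ?u $$ (i, j)"
    by (rule qsubgroup_hom[OF GQ w]) (rule that)
  obtain \<phi> where \<phi>: "unital_star_hom ?B ?A \<phi>" "\<And>i j. i < N \<Longrightarrow> j < N \<Longrightarrow> \<phi> (fund B $$ (i, j)) = ?u $$ (i, j)"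
    by (rule qsubgroup_hom[OF GB b]) (rule that)
  note h\<psi> = unital_star_homD[OF \<psi>(1)] and h\<phi> = unital_star_homD[OF \<phi>(1)]
  note wc = alg_matsD(3)[OF w] and uc = alg_matsD(3)[OF u] and bc = alg_matsD(3)[OF b]
  show ?thesis
  proof (rule A.reflect_fixed[OF u])
    fix x y assume xy: "x < N" "y < N"
    have "(\<Oplus>\<^bsub>?D\<^esub>a\<in>{..<N}. ?w $$ (a, x) \<otimes>\<^bsub>?D\<^esub> ?w $$ (a, y)) = alg_mat_mult ?D (transpose_mat ?w) ?w $$ (x, y)"
      unfolding D.alg_mat_mult_index[OF D.transpose_mats[OF w] w xy] using alg_matsD[OF w] xy
      by (intro D.finsum_cong') auto
    also have "\<dots> = (if x = y then \<one>\<^bsub>?D\<^esub> else \<zero>\<^bsub>?D\<^esub>)"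
      using orthQ xy by (simp add: orthogonal_relations_def alg_one_mat_def)
    finally have "\<psi> (\<Oplus>\<^bsub>?D\<^esub>a\<in>{..<N}. ?w $$ (a, x) \<otimes>\<^bsub>?D\<^esub> ?w $$ (a, y)) = (if x = y then \<one>\<^bsub>?A\<^esub> else \<zero>\<^bsub>?A\<^esub>)"
      using lin_map_finsum[OF D A lin_map_hom[OF \<psi>(1)], of "\<lambda>_. \<one>\<^bsub>?D\<^esub>" "{}"] by (simp add: h\<psi>)
    also have "\<psi> (\<Oplus>\<^bsub>?D\<^esub>a\<in>{..<N}. ?w $$ (a, x) \<otimes>\<^bsub>?D\<^esub> ?w $$ (a, y)) =
        (\<Oplus>\<^bsub>?A\<^esub>a\<in>{..<N}. \<psi> (?w $$ (a, x) \<otimes>\<^bsub>?D\<^esub> ?w $$ (a, y)))"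
      using wc xy by (intro lin_map_finsum[OF D A lin_map_hom[OF \<psi>(1)]]) auto
    also have "\<dots> = (\<Oplus>\<^bsub>?A\<^esub>a\<in>{..<N}. ?u $$ (a, x) \<otimes>\<^bsub>?A\<^esub> ?u $$ (a, y))"
      using wc uc xy by (intro A.finsum_cong') (auto simp: h\<psi> \<psi>(2))
    finally show "(\<Oplus>\<^bsub>?A\<^esub>a\<in>{..<N}. ?u $$ (a, x) \<otimes>\<^bsub>?A\<^esub> ?u $$ (a, y)) = (if x = y then \<one>\<^bsub>?A\<^esub> else \<zero>\<^bsub>?A\<^esub>)" .
    have row: "\<phi> (\<Oplus>\<^bsub>?B\<^esub>c\<in>{..<N}. fund B $$ (z, c)) = (\<Oplus>\<^bsub>?A\<^esub>c\<in>{..<N}. ?u $$ (z, c))" if "z < N" for z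
    proof -
      have "\<phi> (\<Oplus>\<^bsub>?B\<^esub>c\<in>{..<N}. fund B $$ (z, c)) = (\<Oplus>\<^bsub>?A\<^esub>c\<in>{..<N}. \<phi> (fund B $$ (z, c)))"
        using bc that by (intro lin_map_finsum[OF Bc A lin_map_hom[OF \<phi>(1)]]) auto
      also have "\<dots> = (\<Oplus>\<^bsub>?A\<^esub>c\<in>{..<N}. ?u $$ (z, c))"
        using that uc by (intro A.finsum_cong') (auto simp: \<phi>(2))
      finally show ?thesis .
    qed
    have closed: "(\<Oplus>\<^bsub>?B\<^esub>c\<in>{..<N}. fund B $$ (z, c)) \<in> carrier ?B" if "z < N" for z
      using bc that by (auto intro!: B.finsum_closed)
    show "(\<Oplus>\<^bsub>?A\<^esub>c\<in>{..<N}. ?u $$ (x, c)) \<otimes>\<^bsub>?A\<^esub> (\<Oplus>\<^bsub>?A\<^esub>c\<in>{..<N}. ?u $$ (y, c)) = \<one>\<^bsub>?A\<^esub>"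
      using arg_cong[OF bistochastic_row_sums[OF B' xy], of \<phi>] closed xy by (simp add: h\<phi> row)
  qed
qed

section \<open>The action on the orthogonal complement\<close>

lemma (in cstar_algebra) cstar_generated_star_subalgebra:
  assumes "X \<subseteq> carrier A"
  shows "star_subalgebra A (cstar_generated A X)" "X \<subseteq> cstar_generated A X"
proof -
  have "cstar_subalgebra A (carrier A)"
    by (auto simp: cstar_subalgebra_def star_subalgebra_def adj_closed)
  then have "cstar_generated A X \<subseteq> carrier A" using assms unfolding cstar_generated_def by blast
  moreover have mem: "x \<in> cstar_generated A X \<longleftrightarrow> (\<forall>S. cstar_subalgebra A S \<and> X \<subseteq> S \<longrightarrow> x \<in> S)" for x
    by (auto simp: cstar_generated_def)
  moreover have "star_subalgebra A S" if "cstar_subalgebra A S" for S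
    using that by (simp add: cstar_subalgebra_def)
  then have "\<one> \<in> S" "\<And>x y. x \<in> S \<Longrightarrow> y \<in> S \<Longrightarrow> x \<oplus> y \<in> S" "\<And>x y. x \<in> S \<Longrightarrow> y \<in> S \<Longrightarrow> x \<otimes> y \<in> S"
    "\<And>c x. x \<in> S \<Longrightarrow> c \<odot> x \<in> S" "\<And>x. x \<in> S \<Longrightarrow> adj A x \<in> S" if "cstar_subalgebra A S" for S
    using that unfolding star_subalgebra_def by blast+
  ultimately show "star_subalgebra A (cstar_generated A X)"
    unfolding star_subalgebra_def by simp
  show "X \<subseteq> cstar_generated A X" unfolding cstar_generated_def by blast
qed

text \<open>
  The carrier of \<open>irr N s G\<close> is a subalgebra, and the definition of finite sums depends on the carrier;
  their values do not.
\<close>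

lemma (in cstar_algebra) finsum_subcarrier:
  assumes S: "star_subalgebra A S" and f: "f \<in> I \<rightarrow> S"
  shows "finsum (A\<lparr>carrier := S\<rparr>) f I = finsum A f I"
proof -
  have SA: "S \<subseteq> carrier A" and add: "\<And>x y. x \<in> S \<Longrightarrow> y \<in> S \<Longrightarrow> x \<oplus> y \<in> S"
    using S by (auto simp: star_subalgebra_def)
  have zero: "\<zero> \<in> S" using star_subalgebra_finsum[OF S, of "\<lambda>_. \<zero>" "{}"] by simp
  interpret S: abelian_monoid "A\<lparr>carrier := S\<rparr>"
    using SA add zero by (intro abelian_monoidI) (auto simp: subset_eq intro: a_assoc a_comm)
  show ?thesis
    using f
  proof (induction I rule: infinite_finite_induct)
    case (infinite I)
    then show ?case by (simp add: finsum_infinite S.finsum_infinite)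
  next
    case (insert i I)
    then show ?case using SA by (subst S.finsum_insert) (auto simp: finsum_insert Pi_iff subset_eq)
  qed simp
qed

lemma (in cstar_algebra) sandwich_subcarrier:
  assumes S: "star_subalgebra A S" and u: "u \<in> carrier_mat n n" "elements_mat u \<subseteq> S"
  shows "sandwich (A\<lparr>carrier := S\<rparr>) M u M' = sandwich A M u M'"
proof -
  have uS: "u $$ (a, b) \<in> S" if "a < n" "b < n" for a b
    using u elements_matI[OF u(1) that refl] by blast
  have smult: "c \<odot> x \<in> S" if "x \<in> S" for c x using S that by (auto simp: star_subalgebra_def)
  have "(\<Oplus>\<^bsub>A\<lparr>carrier := S\<rparr>\<^esub>a\<in>{..<n}. \<Oplus>\<^bsub>A\<lparr>carrier := S\<rparr>\<^esub>b\<in>{..<n}. c a b \<odot> u $$ (a, b)) =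
      (\<Oplus>a\<in>{..<n}. \<Oplus>b\<in>{..<n}. c a b \<odot> u $$ (a, b))" for c
  proof -
    have inner: "(\<Oplus>\<^bsub>A\<lparr>carrier := S\<rparr>\<^esub>b\<in>{..<n}. c a b \<odot> u $$ (a, b)) = (\<Oplus>b\<in>{..<n}. c a b \<odot> u $$ (a, b))"
      if "a < n" for a
      using that uS smult by (intro finsum_subcarrier[OF S]) auto
    have "(\<Oplus>\<^bsub>A\<lparr>carrier := S\<rparr>\<^esub>a\<in>{..<n}. \<Oplus>\<^bsub>A\<lparr>carrier := S\<rparr>\<^esub>b\<in>{..<n}. c a b \<odot> u $$ (a, b)) =
        (\<Oplus>a\<in>{..<n}. \<Oplus>\<^bsub>A\<lparr>carrier := S\<rparr>\<^esub>b\<in>{..<n}. c a b \<odot> u $$ (a, b))"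
      using uS smult by (intro finsum_subcarrier[OF S]) (auto simp: inner intro!: star_subalgebra_finsum[OF S])
    also have "\<dots> = (\<Oplus>a\<in>{..<n}. \<Oplus>b\<in>{..<n}. c a b \<odot> u $$ (a, b))"
      using uS smult star_subalgebra_finsum[OF S] S
      by (intro finsum_cong') (auto simp: inner star_subalgebra_def intro!: finsum_closed)
    finally show ?thesis .
  qed
  then show ?thesis using u(1) unfolding sandwich_def by (intro cong_mat) auto
qed

definition V_coeff :: "nat \<Rightarrow> real \<Rightarrow> nat \<Rightarrow> nat \<Rightarrow> complex" where
  "V_coeff N s i a = complex_of_real (if a < N - 1
     then (if i = a then 1 else 0) - 1 / (real N - 1) * (1 + s / sqrt (real N)) else s / sqrt (real N))"

lemma Vmat_index: "i < N - 1 \<Longrightarrow> a < N \<Longrightarrow> Vmat N s $$ (i, a) = V_coeff N s i a"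
  by (simp add: Vmat_def Umat_def V_coeff_def)

lemma mat_adjoint_index:
  fixes M :: "complex mat"
  assumes "M \<in> carrier_mat n m" "a < m" "i < n"
  shows "mat_adjoint M \<in> carrier_mat m n" "mat_adjoint M $$ (a, i) = cnj (M $$ (i, a))"
proof -
  show "mat_adjoint M \<in> carrier_mat m n" using assms unfolding mat_adjoint_def by (auto simp: mat_of_rows_def)
  show "mat_adjoint M $$ (a, i) = cnj (M $$ (i, a))"
    using assms unfolding mat_adjoint_def by (simp add: mat_of_rows_def)
qed

text \<open>
  The product of the reflection in dimension \<open>N - 1\<close> with \<open>V\<^sub>+\<close> is \<open>V\<^sub>-\<close>. A column of \<open>V\<^sub>+\<close> other than the
  last one has sum \<open>- 1 / sqrt N\<close>, so the reflection adds \<open>2 / ((N - 1) sqrt N)\<close> to its entries, which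
  exchanges the two signs. The last column is constant and is negated.
\<close>

lemma reflect_V_coeff:
  assumes N: "N \<ge> 2" and i: "i < N - 1" and a: "a < N"
  shows "(\<Sum>b<N - 1. refl_coeff (N - 1) i b * V_coeff N 1 b a) = V_coeff N (- 1) i a"
proof -
  obtain m where m: "N = Suc m" "m \<noteq> 0" using N by (cases N) auto
  define q where "q = sqrt (real N)"
  have V: "V_coeff N s b a = complex_of_real (if a < m then (if b = a then 1 else 0) - 1 / real m * (1 + s / q) else s / q)"
    for s b by (simp add: V_coeff_def q_def m(1))
  have sum: "(\<Sum>b<m. V_coeff N 1 b a) = complex_of_real (if a < m then - (1 / q) else real m / q)"
  proof (cases "a < m")
    case True
    have "(\<Sum>b<m. V_coeff N 1 b a) =
        complex_of_real (\<Sum>b<m. (if b = a then 1 else 0) - 1 / real m * (1 + 1 / q))"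
      using True by (simp only: V of_real_sum if_True)
    also have "(\<Sum>b<m. (if b = a then 1 else 0) - 1 / real m * (1 + 1 / q)) = - (1 / q)"
      unfolding sum_subtractf using True m(2) by simp
    finally show ?thesis using True by simp
  next
    case False
    then show ?thesis by (simp add: V)
  qed
  have "(\<Sum>b<m. refl_coeff m i b * V_coeff N 1 b a) =
      V_coeff N 1 i a - 2 / of_nat m * (\<Sum>b<m. V_coeff N 1 b a)"
    using i m(1) by (intro sum_refl_coeff_mult) simp
  also have "\<dots> = V_coeff N (- 1) i a"
  proof -
    let ?x = "if a < m then (if i = a then 1 else 0) - 1 / real m * (1 + 1 / q) else 1 / q"
    let ?y = "if a < m then - (1 / q) else real m / q"
    have "?x - 2 / real m * ?y = (if a < m then (if i = a then 1 else 0) - 1 / real m * (1 + - 1 / q) else - 1 / q)"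
      using m(2) by (simp add: algebra_simps add_divide_distrib)
    then have "complex_of_real (?x - 2 / real m * ?y) = V_coeff N (- 1) i a" by (simp only: V)
    moreover have "complex_of_real (?x - 2 / real m * ?y) = V_coeff N 1 i a - 2 / of_nat m * (\<Sum>b<m. V_coeff N 1 b a)"
      unfolding sum V[of 1 i] by (simp only: of_real_diff of_real_mult of_real_divide of_real_numeral of_real_of_nat_eq)
    ultimately show ?thesis by simp
  qed
  finally show ?thesis by (simp add: m(1))
qed

text \<open>
  Conjugation by this reflection turns \<open>V\<^sub>+ u V\<^sub>+\<^sup>*\<close> into \<open>V\<^sub>- u V\<^sub>-\<^sup>*\<close>. Both quantum groups live on the
  same algebra, because the entries of these matrices are linear combinations of each other.
\<close>

theorem irr_reflect:
  assumes N: "N \<ge> 2" and G: "cmqg N G"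
  shows "conj_qgrp (Tmat (N - 1) (tau (N - 1))) (irr N 1 G) = irr N (- 1) G"
proof -
  let ?A = "fun_alg G" and ?u = "fund G" and ?n = "N - 1"
  interpret cstar_algebra ?A using cmqgD(1)[OF G] .
  note u = cmqgD(2)[OF G]
  note uc = alg_matsD(3)[OF u]
  let ?uf = "\<lambda>a b. ?u $$ (a, b)"
  define v where "v s = sandwich ?A (Vmat N s) ?u (mat_adjoint (Vmat N s))" for s
  have V: "Vmat N s \<in> carrier_mat ?n N" for s by (simp add: Vmat_def)
  have V': "mat_adjoint (Vmat N s) \<in> carrier_mat N ?n" for s
    using mat_adjoint_index(1)[OF V, of 0 0] N by simp
  have v_eq: "v s = mat ?n ?n (\<lambda>(i, j). conj_mat {..<N} (V_coeff N s) ?uf (\<lambda>a i. V_coeff N s i a) i j)" for s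
    unfolding v_def sandwich_conj_mat[OF u V V'] using uc
    by (intro cong_mat) (auto simp: mat_adjoint_index(2)[OF V] Vmat_index V_coeff_def intro!: conj_mat_cong)
  have v_mats: "v s \<in> alg_mats ?A ?n" for s
    unfolding v_eq alg_mats_def using uc by (auto intro!: conj_mat_closed)
  have refl_v: "reflect ?A ?n (v 1) = v (- 1)"
  proof (rule eq_matI)
    fix i j assume "i < dim_row (v (- 1))" "j < dim_col (v (- 1))"
    then have ij: "i < ?n" "j < ?n" by (simp_all add: v_eq)
    have "reflect ?A ?n (v 1) $$ (i, j) = conj_mat {..<?n} (refl_coeff ?n)
        (conj_mat {..<N} (V_coeff N 1) ?uf (\<lambda>a i. V_coeff N 1 i a)) (refl_coeff ?n) i j"
      unfolding reflect_index[OF ij] using uc by (intro conj_mat_cong) (auto simp: v_eq intro!: conj_mat_closed)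
    also have "\<dots> = conj_mat {..<N} (\<lambda>i a. \<Sum>b<?n. refl_coeff ?n i b * V_coeff N 1 b a) ?uf
        (\<lambda>a j. \<Sum>b<?n. V_coeff N 1 b a * refl_coeff ?n b j) i j"
      using uc by (intro conj_mat_conj_mat) auto
    also have "\<dots> = conj_mat {..<N} (V_coeff N (- 1)) ?uf (\<lambda>a i. V_coeff N (- 1) i a) i j"
    proof (intro conj_mat_cong)
      fix a assume "a \<in> {..<N}"
      then have a: "a < N" by simp
      show "(\<Sum>b<?n. refl_coeff ?n i b * V_coeff N 1 b a) = V_coeff N (- 1) i a"
        by (rule reflect_V_coeff[OF N ij(1) a])
      show "(\<Sum>b<?n. V_coeff N 1 b a * refl_coeff ?n b j) = V_coeff N (- 1) j a"
        using reflect_V_coeff[OF N ij(2) a] by (simp add: mult.commute refl_coeff_commute[of _ _ j])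
    qed (use uc in auto)
    also have "\<dots> = v (- 1) $$ (i, j)" using ij by (simp add: v_eq)
    finally show "reflect ?A ?n (v 1) $$ (i, j) = v (- 1) $$ (i, j)" .
  qed (simp_all add: reflect_def v_eq)
  let ?S = "\<lambda>s. cstar_generated ?A (elements_mat (v s))"
  have S: "?S (- 1) = ?S 1" unfolding refl_v[symmetric] by (rule cstar_generated_reflect[OF v_mats])
  have sub: "elements_mat (v 1) \<subseteq> carrier ?A" using alg_matsD[OF v_mats] by auto
  have "sandwich (?A\<lparr>carrier := ?S 1\<rparr>) (refl_mat ?n) (v 1) (the (mat_inverse (refl_mat ?n))) = v (- 1)"
    unfolding sandwich_subcarrier[OF cstar_generated_star_subalgebra(1)[OF sub] alg_matsD(4)[OF v_mats]
      cstar_generated_star_subalgebra(2)[OF sub]] sandwich_refl_mat[OF v_mats] by (rule refl_v)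
  moreover have "irr N s G = \<lparr>fun_alg = ?A\<lparr>carrier := ?S s\<rparr>, fund = v s\<rparr>" for s
    by (simp add: irr_def Let_def v_def)
  ultimately show ?thesis by (simp add: conj_qgrp_def Tmat_tau S)
qed

lemma qequal_refl: "qequal G G"
  unfolding qequal_def unital_star_hom_def Ring.ring_hom_def
  by (intro conjI refl exI[of _ "\<lambda>x. x"]) (auto simp: bij_betw_def inj_on_def)

theorem theoremB:
  fixes N :: nat and G :: "'a qgrp" and Q :: "'q qgrp"
  assumes "N \<ge> 1"
    and "free_orthogonal N Q"
    and "cmqg N G"
    and "qsubgroup (sym_qgrp N) G" and "qsubgroup G Q"
  shows
    "(\<forall>K. corresponds N G K \<longrightarrow>
        (let G' = conj_qgrp (Tmat N (tau N)) G in
           cmqg N G' \<and> qsubgroup (sym_qgrp N) G' \<and> qsubgroup G' Q \<and>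
           linear_category N (calT_family N K) \<and> corresponds N G' (calT_family N K) \<and>
           (\<forall>k l. calT N k l \<in> Plin k l \<rightarrow> Plin k l) \<and>
           monoidal_star_iso N (calT N) K (calT_family N K))) \<and>
     (\<forall>B :: 'b qgrp. N \<ge> 2 \<and> bistochastic_sharp N Q B \<and> qsubgroup G B \<longrightarrow>
        qequal (conj_qgrp (Tmat (N - 1) (tau (N - 1))) (irr N 1 G)) (irr N (- 1) G) \<and>
        qequal (conj_qgrp (Tmat N (tau N)) G) G)"
proof -
  note A = cmqgD(1)[OF assms(3)] and u = cmqgD(2)[OF assms(3)]
  note G' = conj_qgrp_reflect[OF A u]
  have qgrp: "cmqg N (conj_qgrp (Tmat N (tau N)) G)" "qsubgroup (sym_qgrp N) (conj_qgrp (Tmat N (tau N)) G)"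
    "qsubgroup (conj_qgrp (Tmat N (tau N)) G) Q"
    unfolding G' by (rule cmqg_reflect[OF assms(3)] sym_qsubgroup_reflect[OF A u assms(4)]
      qsubgroup_free_orthogonal_reflect[OF assms(2) A u assms(5)])+
  show ?thesis
  proof (intro conjI allI impI)
    fix K assume corr: "corresponds N G K"
    then have K: "linear_category N K" by (simp add: corresponds_def)
    have "corresponds N (conj_qgrp (Tmat N (tau N)) G) (calT_family N K)"
      unfolding G' by (rule corresponds_reflect[OF assms(1) A u corr])
    moreover have "\<forall>k l. calT N k l \<in> Plin k l \<rightarrow> Plin k l" using calT_Plin by blast
    ultimately show "let G' = conj_qgrp (Tmat N (tau N)) G in
        cmqg N G' \<and> qsubgroup (sym_qgrp N) G' \<and> qsubgroup G' Q \<and>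
        linear_category N (calT_family N K) \<and> corresponds N G' (calT_family N K) \<and>
        (\<forall>k l. calT N k l \<in> Plin k l \<rightarrow> Plin k l) \<and>
        monoidal_star_iso N (calT N) K (calT_family N K)"
      using qgrp linear_category_calT[OF assms(1) K] monoidal_star_iso_calT[OF assms(1) K] by (simp add: Let_def)
  next
    fix B :: "'b qgrp" assume B: "N \<ge> 2 \<and> bistochastic_sharp N Q B \<and> qsubgroup G B"
    show "qequal (conj_qgrp (Tmat (N - 1) (tau (N - 1))) (irr N 1 G)) (irr N (- 1) G)"
      using irr_reflect[OF _ assms(3)] B by (simp add: qequal_refl)
    have "conj_qgrp (Tmat N (tau N)) G = G"
    proof -
      have "reflect (fun_alg G) N (fund G) = fund G"
        by (rule reflect_bistochastic[OF assms(3,2,5)]) (use B in auto)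
      then show ?thesis unfolding G' by simp
    qed
    then show "qequal (conj_qgrp (Tmat N (tau N)) G) G" by (simp add: qequal_refl)
  qed
qed

end
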